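(* Let $K$ be an algebraic function field over a field $k$, and let $\nu$ be an Abhyankar valuation on $K$. Let $L$ be a finite extension of $K$ and let $\omega$ be an extension of $\nu$ to $L$. Suppose that $\mathcal{O}_\omega/\mathfrak{m}_\omega$ is separable over $k$. If $d(\omega|\nu)=1$ and $\epsilon(\omega|\nu)=e(\omega|\nu)$, then $\mathcal{O}_\omega$ is essentially finitely generated over $\mathcal{O}_\nu$.
   Context: Valuations on an algebraic function field $K$ over $k$ are taken trivial on $k$. The rational rank ${\rm ratrk}(\nu)$ is $\dim_{\mathbb{Q}}(\Gamma_\nu\otimes_{\mathbb Z}\mathbb{Q})$. One always has ${\rm trdeg}_kK\ge{\rm trdeg}_k\mathcal{O}_\nu/\mathfrak m_\nu+{\rm ratrk}(\nu)$; $\nu$ is an Abhyankar valuation if equality holds. For a finite field extension $L|K$ and a valuation $\omega$ on $L$ with restriction $\nu$ to $K$: $\mathcal{O}_\omega,\mathcal{O}_\nu$ are the valuation rings, $\mathfrak m_\omega,\mathfrak m_\nu$ their maximal ideals, $\Gamma_\omega\supseteq\Gamma_\nu$ the value groups (totally ordered abelian groups), $L\omega\supseteq K\nu$ the residue fields. Put $e(\omega|\nu)=(\Gamma_\omega:\Gamma_\nu)$ and $f(\omega|\nu)=[L\omega:K\nu]$. Initial index: for an extension $\Delta\subseteq\Gamma$ of ordered abelian groups, $\epsilon(\Gamma\mid\Delta)=|\{\gamma\in\Gamma\mid \gamma\ge 0 \text{ and } \gamma<\delta\text{ for all }\delta\in\Delta\text{ with }\delta>0\}|$; and $\epsilon(\omega|\nu)=\epsilon(\Gamma_\omega\mid\Gamma_\nu)$.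 Defect: fix an extension $\overline\nu$ of $\omega$ to an algebraic closure $\overline K$ of $L$. The henselization $K^h$ of $(K,\nu)$ is the smallest field with $K\subseteq K^h\subseteq\overline K$ such that $\overline\nu$ is the only extension of $\overline\nu|_{K^h}$ to $\overline K$; $L^h$ is defined likewise for $(L,\omega)$. The defect is $d(\omega|\nu)=\dfrac{[L^h:K^h]}{e(\omega|\nu)f(\omega|\nu)}$, a positive integer. A ring extension $A\subseteq B$ is essentially finitely generated if there are $x_1,\ldots,x_r\in B$ and a multiplicative set $S\subseteq A[x_1,\ldots,x_r]$ with $B=S^{-1}A[x_1,\ldots,x_r]$. *)

theory Defs
  imports
    "HOL-Algebra.Algebraic_Closure"
    "HOL-Algebra.Free_Abelian_Groups"
    "HOL-Algebra.Generated_Fields"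
    "HOL-Algebra.Generated_Rings"
    "HOL-Library.Extended_Nat"
begin

text \<open>All fields are subfields of one ambient field record. Extensions \<open>k \<subseteq> F\<close> are pairs of
  carrier sets; residue fields are quotient rings in the sense of HOL-Algebra.\<close>

section \<open>Rational rank\<close>

text \<open>The tensor product over the integers of an abelian group with the rationals, constructed
  literally: the free abelian group on the pairs \<open>(x, r)\<close>, modulo the subgroup generated by
  the bilinearity relations.\<close>

inductive_set tensor_relations :: "(('v::ab_group_add \<times> rat) \<Rightarrow>\<^sub>0 int) set" where
  zero: "0 \<in> tensor_relations"
| diff: "a \<in> tensor_relations \<Longrightarrow> b \<in> tensor_relations \<Longrightarrow> a - b \<in> tensor_relations"
| left: "frag_of (x + y, r) - frag_of (x, r) - frag_of (y, r) \<in> tensor_relations"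
| right: "frag_of (x, r + s) - frag_of (x, r) - frag_of (x, s) \<in> tensor_relations"

lemma tensor_relations_minus: "a \<in> tensor_relations \<Longrightarrow> - a \<in> tensor_relations"
  using tensor_relations.diff[OF tensor_relations.zero] by simp

lemma tensor_relations_add:
  "a \<in> tensor_relations \<Longrightarrow> b \<in> tensor_relations \<Longrightarrow> a + b \<in> tensor_relations"
  using tensor_relations.diff[of a "- b"] tensor_relations_minus[of b] by simp

quotient_type (overloaded) 'v rat_tensor =
  "('v::ab_group_add \<times> rat) \<Rightarrow>\<^sub>0 int" / "\<lambda>a b. a - b \<in> tensor_relations"
proof (rule equivpI)
  show "reflp (\<lambda>a b. a - b \<in> tensor_relations)"
    by (rule reflpI) (simp add: tensor_relations.zero)
  show "symp (\<lambda>a b. a - b \<in> tensor_relations)"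
    by (rule sympI) (drule tensor_relations_minus, simp)
  show "transp (\<lambda>a b. a - b \<in> tensor_relations)"
    by (rule transpI) (drule (1) tensor_relations_add, simp)
qed

instantiation rat_tensor :: (ab_group_add) ab_group_add
begin

lift_definition zero_rat_tensor :: "'a rat_tensor" is 0 .

lift_definition plus_rat_tensor :: "'a rat_tensor \<Rightarrow> 'a rat_tensor \<Rightarrow> 'a rat_tensor" is "(+)"
  by (simp add: add_diff_add tensor_relations_add)

lift_definition uminus_rat_tensor :: "'a rat_tensor \<Rightarrow> 'a rat_tensor" is uminus
  by (drule tensor_relations_minus) simp

lift_definition minus_rat_tensor :: "'a rat_tensor \<Rightarrow> 'a rat_tensor \<Rightarrow> 'a rat_tensor" is "(-)"
  by (drule (1) tensor_relations.diff) (simp add: algebra_simps)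

instance
  by standard (transfer, simp add: tensor_relations.zero algebra_simps)+

end

definition frag_scale :: "rat \<Rightarrow> (('v::ab_group_add \<times> rat) \<Rightarrow>\<^sub>0 int) \<Rightarrow> (('v \<times> rat) \<Rightarrow>\<^sub>0 int)" where
  "frag_scale q = frag_extend (\<lambda>(x, r). frag_of (x, q * r))"

lemma frag_scale_relations: "a \<in> tensor_relations \<Longrightarrow> frag_scale q a \<in> tensor_relations"
proof (induction rule: tensor_relations.induct)
  case zero
  show ?case by (simp add: frag_scale_def tensor_relations.zero)
next
  case (diff a b)
  then show ?case by (simp add: frag_scale_def frag_extend_diff tensor_relations.diff)
next
  case (left x y r)
  show ?case
    by (simp add: frag_scale_def frag_extend_diff tensor_relations.left)
next
  case (right x r s)
  show ?case
    by (simp add: frag_scale_def frag_extend_diff distrib_left tensor_relations.right)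
qed

lift_definition rat_tensor_scale :: "rat \<Rightarrow> 'v::ab_group_add rat_tensor \<Rightarrow> 'v rat_tensor"
  is frag_scale
  by (drule frag_scale_relations) (simp add: frag_scale_def frag_extend_diff)

lift_definition pure_tensor :: "'v::ab_group_add \<Rightarrow> rat \<Rightarrow> 'v rat_tensor"
  is "\<lambda>x r. frag_of (x, r)" .

lemma frag_scale_distrib_left:
  "frag_scale (p + q) a - (frag_scale p a + frag_scale q a) \<in> tensor_relations"
  using subset_UNIV[of "Poly_Mapping.keys a"]
proof (induction a rule: frag_induction)
  case zero
  show ?case by (simp add: frag_scale_def tensor_relations.zero)
next
  case (one x)
  show ?case
    using tensor_relations.right[of "fst x" "p * snd x" "q * snd x"]
    by (simp add: frag_scale_def case_prod_unfold distrib_right algebra_simps)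
next
  case (diff a b)
  have "frag_scale (p + q) (a - b) - (frag_scale p (a - b) + frag_scale q (a - b)) =
      (frag_scale (p + q) a - (frag_scale p a + frag_scale q a)) -
      (frag_scale (p + q) b - (frag_scale p b + frag_scale q b))"
    by (simp add: frag_scale_def frag_extend_diff)
  with diff show ?case by (simp only: tensor_relations.diff)
qed

lemma frag_scale_assoc: "frag_scale p (frag_scale q a) = frag_scale (p * q) a"
  using subset_UNIV[of "Poly_Mapping.keys a"]
  by (induction a rule: frag_induction)
     (auto simp: frag_scale_def frag_extend_diff mult.assoc)

lemma frag_scale_one: "frag_scale 1 a = a"
  using subset_UNIV[of "Poly_Mapping.keys a"]
  by (induction a rule: frag_induction)
     (auto simp: frag_scale_def frag_extend_diff)

lemma rat_tensor_vector_space: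
  "vector_space (rat_tensor_scale :: rat \<Rightarrow> 'v::ab_group_add rat_tensor \<Rightarrow> 'v rat_tensor)"
proof
  fix p q :: rat and x y :: "'v rat_tensor"
  show "rat_tensor_scale p (x + y) = rat_tensor_scale p x + rat_tensor_scale p y"
    by transfer (simp add: frag_scale_def frag_extend_add tensor_relations.zero)
  show "rat_tensor_scale (p + q) x = rat_tensor_scale p x + rat_tensor_scale q x"
    by transfer (rule frag_scale_distrib_left)
  show "rat_tensor_scale p (rat_tensor_scale q x) = rat_tensor_scale (p * q) x"
    by transfer (simp add: frag_scale_assoc tensor_relations.zero)
  show "rat_tensor_scale 1 x = x"
    by transfer (simp add: frag_scale_one tensor_relations.zero)
qed

text \<open>The rationals are flat over the integers, so for a subgroup \<open>\<Gamma>\<close> the tensor product of \<open>\<Gamma>\<close>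
  with the rationals is the subspace spanned by the elements \<open>\<gamma> \<otimes> 1\<close>. The library's \<open>dim\<close> is \<open>0\<close>
  on infinite-dimensional spaces; this does not occur for value groups of valuations of function
  fields, by the Abhyankar inequality.\<close>

definition rational_rank :: "'v::ab_group_add set \<Rightarrow> nat" where
  "rational_rank \<Gamma> =
     vector_space.dim rat_tensor_scale
       (module.span rat_tensor_scale ((\<lambda>\<gamma>. pure_tensor \<gamma> 1) ` \<Gamma>))"


section \<open>Field extensions\<close>

text \<open>Value at the point \<open>(s)\<^sub>s\<close> of a polynomial whose indeterminates are indexed by
  field elements \<open>s\<close>.\<close>

definition indexed_value :: "('a, 'm) ring_scheme \<Rightarrow> ('a multiset \<Rightarrow> 'a) \<Rightarrow> 'a" where
  "indexed_value R P =
     (\<Oplus>\<^bsub>R\<^esub> m \<in> {m. P m \<noteq> \<zero>\<^bsub>R\<^esub>}.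
        P m \<otimes>\<^bsub>R\<^esub> (\<Otimes>\<^bsub>R\<^esub> s \<in> set_mset m. s [^]\<^bsub>R\<^esub> count m s))"

definition alg_independent :: "('a, 'm) ring_scheme \<Rightarrow> 'a set \<Rightarrow> 'a set \<Rightarrow> bool" where
  "alg_independent R k S \<longleftrightarrow>
     S \<subseteq> carrier R \<and>
     (\<forall>P \<in> ring.indexed_pset R S k.
        indexed_value R P = \<zero>\<^bsub>R\<^esub> \<longrightarrow> P = ring.indexed_const R \<zero>\<^bsub>R\<^esub>)"

definition trdeg :: "('a, 'm) ring_scheme \<Rightarrow> 'a set \<Rightarrow> 'a set \<Rightarrow> enat" where
  "trdeg R k F = (SUP S \<in> {S. S \<subseteq> F \<and> finite S \<and> alg_independent R k S}. enat (card S))"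

definition algebraic_function_field :: "('a, 'm) ring_scheme \<Rightarrow> 'a set \<Rightarrow> 'a set \<Rightarrow> bool" where
  "algebraic_function_field R k K \<longleftrightarrow>
     subfield k R \<and> subfield K R \<and>
     (\<exists>S. finite S \<and> S \<subseteq> carrier R \<and> K = generate_field R (k \<union> S))"

text \<open>Polynomials of HOL-Algebra are coefficient lists, leading coefficient first:
  \<open>p ! i\<close> is the coefficient of \<open>X ^ (degree p - i)\<close>.\<close>

definition formal_deriv :: "('a, 'm) ring_scheme \<Rightarrow> 'a list \<Rightarrow> 'a list" where
  "formal_deriv R p =
     ring.normalize R (map (\<lambda>i. add_pow R (degree p - i) (p ! i)) [0..<degree p])"

definition separable_poly :: "('a, 'm) ring_scheme \<Rightarrow> 'a set \<Rightarrow> 'a list \<Rightarrow> bool" where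
  "separable_poly R F p \<longleftrightarrow>
     (\<forall>d \<in> carrier (F [X]\<^bsub>R\<^esub>).
        d divides\<^bsub>F [X]\<^bsub>R\<^esub>\<^esub> p \<and> d divides\<^bsub>F [X]\<^bsub>R\<^esub>\<^esub> formal_deriv R p \<longrightarrow>
        d \<in> Units (F [X]\<^bsub>R\<^esub>))"

definition separable_element :: "('a, 'm) ring_scheme \<Rightarrow> 'a set \<Rightarrow> 'a \<Rightarrow> bool" where
  "separable_element R F x \<longleftrightarrow> ring.algebraic R F x \<and> separable_poly R F (ring.Irr R F x)"

definition separably_generated :: "('a, 'm) ring_scheme \<Rightarrow> 'a set \<Rightarrow> 'a set \<Rightarrow> bool" where
  "separably_generated R k F \<longleftrightarrow>
     (\<exists>B \<subseteq> F. alg_independent R k B \<and>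
        (\<forall>x \<in> F. separable_element R (generate_field R (k \<union> B)) x))"

text \<open>Separability of a not necessarily algebraic extension.\<close>

definition separable_extension :: "('a, 'm) ring_scheme \<Rightarrow> 'a set \<Rightarrow> 'a set \<Rightarrow> bool" where
  "separable_extension R k F \<longleftrightarrow>
     (\<forall>S \<subseteq> F. finite S \<longrightarrow> separably_generated R k (generate_field R (k \<union> S)))"


section \<open>Valuations\<close>

text \<open>A valuation on a subfield \<open>F\<close> is a function on the nonzero elements of \<open>F\<close>; its value at
  zero (mathematically \<open>\<infinity>\<close>) is left unspecified.\<close>

definition valuation_on ::
  "('a, 'm) ring_scheme \<Rightarrow> 'a set \<Rightarrow> ('a \<Rightarrow> 'v::linordered_ab_group_add) \<Rightarrow> bool" where
  "valuation_on R F v \<longleftrightarrow>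
     subfield F R \<and>
     (\<forall>x \<in> F - {\<zero>\<^bsub>R\<^esub>}. \<forall>y \<in> F - {\<zero>\<^bsub>R\<^esub>}. v (x \<otimes>\<^bsub>R\<^esub> y) = v x + v y) \<and>
     (\<forall>x \<in> F - {\<zero>\<^bsub>R\<^esub>}. \<forall>y \<in> F - {\<zero>\<^bsub>R\<^esub>}.
        x \<oplus>\<^bsub>R\<^esub> y \<noteq> \<zero>\<^bsub>R\<^esub> \<longrightarrow> min (v x) (v y) \<le> v (x \<oplus>\<^bsub>R\<^esub> y))"

definition trivial_on ::
  "('a, 'm) ring_scheme \<Rightarrow> 'a set \<Rightarrow> ('a \<Rightarrow> 'v::linordered_ab_group_add) \<Rightarrow> bool" where
  "trivial_on R k v \<longleftrightarrow> (\<forall>x \<in> k - {\<zero>\<^bsub>R\<^esub>}. v x = 0)"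

text \<open>\<open>extends_on R F w v\<close>: the valuation \<open>w\<close> restricts to \<open>v\<close> on \<open>F\<close>.\<close>

definition extends_on ::
  "('a, 'm) ring_scheme \<Rightarrow> 'a set \<Rightarrow> ('a \<Rightarrow> 'v) \<Rightarrow> ('a \<Rightarrow> 'v) \<Rightarrow> bool" where
  "extends_on R F w v \<longleftrightarrow> (\<forall>x \<in> F - {\<zero>\<^bsub>R\<^esub>}. w x = v x)"

definition value_group :: "('a, 'm) ring_scheme \<Rightarrow> 'a set \<Rightarrow> ('a \<Rightarrow> 'v) \<Rightarrow> 'v set" where
  "value_group R F v = v ` (F - {\<zero>\<^bsub>R\<^esub>})"

definition valuation_ring ::
  "('a, 'm) ring_scheme \<Rightarrow> 'a set \<Rightarrow> ('a \<Rightarrow> 'v::linordered_ab_group_add) \<Rightarrow> 'a set" where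
  "valuation_ring R F v = {x \<in> F. x = \<zero>\<^bsub>R\<^esub> \<or> 0 \<le> v x}"

definition valuation_ideal ::
  "('a, 'm) ring_scheme \<Rightarrow> 'a set \<Rightarrow> ('a \<Rightarrow> 'v::linordered_ab_group_add) \<Rightarrow> 'a set" where
  "valuation_ideal R F v = {x \<in> F. x = \<zero>\<^bsub>R\<^esub> \<or> 0 < v x}"

definition residue_field ::
  "('a, 'm) ring_scheme \<Rightarrow> 'a set \<Rightarrow> ('a \<Rightarrow> 'v::linordered_ab_group_add) \<Rightarrow> 'a set ring" where
  "residue_field R F v = (R\<lparr>carrier := valuation_ring R F v\<rparr>) Quot (valuation_ideal R F v)"

definition residue_map ::
  "('a, 'm) ring_scheme \<Rightarrow> 'a set \<Rightarrow> ('a \<Rightarrow> 'v::linordered_ab_group_add) \<Rightarrow> 'a \<Rightarrow> 'a set" where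
  "residue_map R F v x = valuation_ideal R F v +>\<^bsub>R\<^esub> x"

text \<open>For a valuation trivial on \<open>k\<close>, the field \<open>k\<close> is identified with its image in the residue
  field.\<close>

definition abhyankar_valuation ::
  "('a, 'm) ring_scheme \<Rightarrow> 'a set \<Rightarrow> 'a set \<Rightarrow> ('a \<Rightarrow> 'v::linordered_ab_group_add) \<Rightarrow> bool" where
  "abhyankar_valuation R k K v \<longleftrightarrow>
     valuation_on R K v \<and> trivial_on R k v \<and>
     trdeg R k K =
       trdeg (residue_field R K v) (residue_map R K v ` k) (carrier (residue_field R K v)) +
       enat (rational_rank (value_group R K v))"


section \<open>Invariants of an extension of valuations\<close>

definition initial_index :: "'v::linordered_ab_group_add set \<Rightarrow> 'v set \<Rightarrow> nat" where
  "initial_index \<Gamma> \<Delta> = card {\<gamma> \<in> \<Gamma>. 0 \<le> \<gamma> \<and> (\<forall>\<delta> \<in> \<Delta>. 0 < \<delta> \<longrightarrow> \<gamma> < \<delta>)}"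

definition group_index :: "'v::ab_group_add set \<Rightarrow> 'v set \<Rightarrow> nat" where
  "group_index \<Gamma> \<Delta> = card ((\<lambda>\<gamma>. (+) \<gamma> ` \<Delta>) ` \<Gamma>)"

text \<open>In the following, \<open>w\<close> is a valuation on \<open>L\<close> with restriction \<open>v\<close> to \<open>K\<close>.\<close>

definition ramification_index ::
  "('a, 'm) ring_scheme \<Rightarrow> 'a set \<Rightarrow> 'a set \<Rightarrow>
     ('a \<Rightarrow> 'v::linordered_ab_group_add) \<Rightarrow> ('a \<Rightarrow> 'v) \<Rightarrow> nat" where
  "ramification_index R K L v w = group_index (value_group R L w) (value_group R K v)"

text \<open>The residue field of \<open>v\<close> is embedded into that of \<open>w\<close> as the image of the valuation ring
  of \<open>v\<close>.\<close>

definition inertia_degree ::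
  "('a, 'm) ring_scheme \<Rightarrow> 'a set \<Rightarrow> 'a set \<Rightarrow>
     ('a \<Rightarrow> 'v::linordered_ab_group_add) \<Rightarrow> ('a \<Rightarrow> 'v) \<Rightarrow> nat" where
  "inertia_degree R K L v w =
     ring.dim (residue_field R L w)
       (residue_map R L w ` valuation_ring R K v) (carrier (residue_field R L w))"

text \<open>Here \<open>R\<close> is an algebraic closure of \<open>F\<close> and \<open>u\<close> a valuation on \<open>R\<close>. It suffices to let the
  competing extensions \<open>u'\<close> take values in the same ordered group as \<open>u\<close>: every extension to \<open>R\<close>
  of the restriction of \<open>u\<close> to \<open>F'\<close> has the divisible hull of the value group of \<open>F'\<close> as value
  group, and the range of \<open>u\<close> contains that hull. As that group is torsion free, extensions with
  the same valuation ring are equal as functions.\<close>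

definition henselization ::
  "('a, 'm) ring_scheme \<Rightarrow> ('a \<Rightarrow> 'v::linordered_ab_group_add) \<Rightarrow> 'a set \<Rightarrow> 'a set" where
  "henselization R u F =
     (LEAST F'. subfield F' R \<and> F \<subseteq> F' \<and>
        (\<forall>u' :: 'a \<Rightarrow> 'v. valuation_on R (carrier R) u' \<and> extends_on R F' u' u \<longrightarrow>
           extends_on R (carrier R) u' u))"

definition defect ::
  "('a, 'm) ring_scheme \<Rightarrow> ('a \<Rightarrow> 'v::linordered_ab_group_add) \<Rightarrow> 'a set \<Rightarrow> 'a set \<Rightarrow>
     ('a \<Rightarrow> 'v) \<Rightarrow> ('a \<Rightarrow> 'v) \<Rightarrow> rat" where
  "defect R u K L v w =
     of_nat (ring.dim R (henselization R u K) (henselization R u L)) /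
     of_nat (ramification_index R K L v w * inertia_degree R K L v w)"


section \<open>Essentially finitely generated extensions\<close>

text \<open>For \<open>S \<subseteq> A[Y] \<subseteq> B\<close> the equality \<open>B = S\<^sup>-\<^sup>1 A[Y]\<close> says that the elements of \<open>S\<close> are units of
  \<open>B\<close> and that every element of \<open>B\<close> is a fraction with denominator in \<open>S\<close>.\<close>

definition essentially_finitely_generated ::
  "('a, 'm) ring_scheme \<Rightarrow> 'a set \<Rightarrow> 'a set \<Rightarrow> bool" where
  "essentially_finitely_generated R A B \<longleftrightarrow>
     subring A R \<and> subring B R \<and> A \<subseteq> B \<and>
     (\<exists>Y S. finite Y \<and> Y \<subseteq> B \<and>
        submonoid S (R\<lparr>carrier := generate_ring R (A \<union> Y)\<rparr>) \<and>
        S \<subseteq> Units (R\<lparr>carrier := B\<rparr>) \<and>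
        B = {a \<otimes>\<^bsub>R\<^esub> inv\<^bsub>R\<lparr>carrier := B\<rparr>\<^esub> s | a s. a \<in> generate_ring R (A \<union> Y) \<and> s \<in> S})"

end

theory Submission
  imports Defs
begin

text \<open>
  Write \<open>u\<close> for the valuation of the algebraic closure, \<open>V \<subseteq> W\<close> for the valuation rings of \<open>K \<subseteq> L\<close>
  and \<open>H\<close> for the henselization of \<open>K\<close>. Since \<open>\<epsilon> = e\<close>, there are elements of \<open>W\<close> whose values
  represent the cosets of the value groups and are smaller than all positive values of \<open>K\<close>;
  multiplying them by lifts of a basis of the residue field extension gives \<open>e f\<close> elements \<open>s\<^sub>j\<close> of
  \<open>W\<close> that are independent modulo the ideal generated by the maximal ideal of \<open>V\<close>. Let \<open>z\<close> be a
  separable element of \<open>L\<close> that is a unit of \<open>W\<close>, while its image under every \<open>K\<close>-embedding of \<open>L\<close>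
  that does not preserve the values of \<open>L\<close> has positive value, and let \<open>D\<close> be the number of these
  images. As \<open>d = 1\<close>, the elements \<open>x\<close> and \<open>s\<^sub>j\<close> satisfy a linear relation over \<open>H\<close> for every
  \<open>x \<in> W\<close>. The value-preserving embeddings of \<open>L\<close> extend to \<open>H\<close>-embeddings, so they preserve this
  relation, and the polynomial with the above images as roots annihilates the other conjugates. From this
  one gets a relation \<open>\<Sum> a\<^sub>m\<^sub>i z\<^sup>m y\<^sub>i = 0\<close> over \<open>V\<close> between \<open>x\<close> and the \<open>s\<^sub>j\<close>, whose coefficients are
  non-units for \<open>m < D\<close> and not all non-units for \<open>m = D\<close>. Independence of the \<open>s\<^sub>j\<close> makes the
  coefficient of \<open>x\<close> a unit in \<open>V[z]\<close>, hence \<open>W\<close> is a localization of \<open>V[z, s\<^sub>1, s\<^sub>2, \<dots>]\<close>.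

  The henselization is identified with the field of all elements that are separable over \<open>K\<close> and fixed
  by the automorphisms preserving the values of some finite set.
\<close>


section \<open>Automorphisms of algebraic closures\<close>

text \<open>The obstacle is that the linear relation between \<open>x\<close> and the
  \<open>s\<^sub>j\<close> has coefficients in \<open>H\<close>, whereas the fraction representing
  \<open>x\<close> must be built inside \<open>L\<close>. A relation that holds under all
  \<open>K\<close>-embeddings of \<open>L\<close> descends to \<open>K\<close>, but this one is only
  known to hold under those preserving the values of \<open>L\<close>. Multiplication by the monic
  polynomial in \<open>z\<close> whose roots are the conjugates of \<open>z\<close> of positive
  value makes it hold under the others too. The lower coefficients of that polynomial have positive
  value, so formally the product keeps the old coefficients at \<open>z^D\<close> and has
  coefficients of positive value below; this explains the shape of the relation over
  \<open>V\<close>. The initial index enters when the coefficient of \<open>x\<close> is to be a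
  unit. A non-unit of \<open>V\<close> has a larger value than each chosen coset representative, so
  a combination of the \<open>s\<^sub>j\<close> over \<open>V\<close> with some unit coefficient has
  the value of a representative, and terms with non-unit coefficients cannot cancel it. As
  \<open>L\<close> may be inseparable over \<open>K\<close>, only the coefficients in the descent
  are required to be separable; \<open>z\<close> is made separable by passing to a power.\<close>

definition field_auts :: "('a, 'm) ring_scheme \<Rightarrow> 'a set \<Rightarrow> ('a \<Rightarrow> 'a) set" where
  "field_auts R F = {s \<in> ring_iso R R. \<forall>a\<in>F. s a = a}"

text \<open>Graphs of isomorphisms between subfields. The definition is symmetric under converse, so a
  maximal such graph is total on both sides.\<close>

definition partial_iso :: "('a, 'm) ring_scheme \<Rightarrow> ('a \<times> 'a) set \<Rightarrow> bool" where
  "partial_iso R G \<longleftrightarrow> G \<subseteq> carrier R \<times> carrier R \<and> (\<one>\<^bsub>R\<^esub>, \<one>\<^bsub>R\<^esub>) \<in> G \<and>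
     (\<forall>a b c d. (a, b) \<in> G \<longrightarrow> (c, d) \<in> G \<longrightarrow>
        (a \<oplus>\<^bsub>R\<^esub> c, b \<oplus>\<^bsub>R\<^esub> d) \<in> G \<and> (a \<otimes>\<^bsub>R\<^esub> c, b \<otimes>\<^bsub>R\<^esub> d) \<in> G) \<and>
     (\<forall>a b. (a, b) \<in> G \<longrightarrow> (\<ominus>\<^bsub>R\<^esub> a, \<ominus>\<^bsub>R\<^esub> b) \<in> G \<and> (a = \<zero>\<^bsub>R\<^esub> \<longleftrightarrow> b = \<zero>\<^bsub>R\<^esub>) \<and>
        (a \<noteq> \<zero>\<^bsub>R\<^esub> \<longrightarrow> (inv\<^bsub>R\<^esub> a, inv\<^bsub>R\<^esub> b) \<in> G))"

lemma partial_iso_converse: "partial_iso R G \<Longrightarrow> partial_iso R (G\<inverse>)"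
  unfolding partial_iso_def by fastforce

lemma partial_iso_Union:
  assumes "C \<noteq> {}" and "\<And>G. G \<in> C \<Longrightarrow> partial_iso R G"
    and chain: "\<And>G H. G \<in> C \<Longrightarrow> H \<in> C \<Longrightarrow> G \<subseteq> H \<or> H \<subseteq> G"
  shows "partial_iso R (\<Union>C)"
proof -
  have two: "\<exists>G\<in>C. x \<in> G \<and> y \<in> G" if "x \<in> \<Union>C" "y \<in> \<Union>C" for x y
    using that chain by blast
  show ?thesis
    unfolding partial_iso_def
  proof (intro conjI allI impI)
    show "\<Union>C \<subseteq> carrier R \<times> carrier R"
      using assms(2) unfolding partial_iso_def by blast
    show "(\<one>\<^bsub>R\<^esub>, \<one>\<^bsub>R\<^esub>) \<in> \<Union>C"
      using assms(1,2) unfolding partial_iso_def by blast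
  next
    fix a b c d assume "(a, b) \<in> \<Union>C" "(c, d) \<in> \<Union>C"
    then obtain G where "G \<in> C" "(a, b) \<in> G" "(c, d) \<in> G" using two by blast
    then show "(a \<oplus>\<^bsub>R\<^esub> c, b \<oplus>\<^bsub>R\<^esub> d) \<in> \<Union>C" "(a \<otimes>\<^bsub>R\<^esub> c, b \<otimes>\<^bsub>R\<^esub> d) \<in> \<Union>C"
      using assms(2) unfolding partial_iso_def by blast+
  next
    fix a b assume "(a, b) \<in> \<Union>C"
    then obtain G where "G \<in> C" "(a, b) \<in> G" by blast
    then show "(\<ominus>\<^bsub>R\<^esub> a, \<ominus>\<^bsub>R\<^esub> b) \<in> \<Union>C" "a = \<zero>\<^bsub>R\<^esub> \<longleftrightarrow> b = \<zero>\<^bsub>R\<^esub>"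
      "a \<noteq> \<zero>\<^bsub>R\<^esub> \<Longrightarrow> (inv\<^bsub>R\<^esub> a, inv\<^bsub>R\<^esub> b) \<in> \<Union>C"
      using assms(2) unfolding partial_iso_def by blast+
  qed
qed

context field
begin

text \<open>Subtracting the two pairs gives \<open>(0, b - c)\<close>, and zero is paired only with
  zero.\<close>

lemma partial_iso_functional:
  assumes G: "partial_iso R G" and "(a, b) \<in> G" "(a, c) \<in> G"
  shows "b = c"
proof -
  have car: "a \<in> carrier R" "b \<in> carrier R" "c \<in> carrier R"
    using assms unfolding partial_iso_def by auto
  have "(a \<oplus> \<ominus> a, b \<oplus> \<ominus> c) \<in> G"
    using assms unfolding partial_iso_def by blast
  then have "b \<oplus> \<ominus> c = \<zero>"
    using G car unfolding partial_iso_def by (metis r_neg)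
  then show ?thesis
    using car by (metis a_minus_def r_right_minus_eq)
qed

lemma partial_iso_domain_subfield:
  assumes G: "partial_iso R G"
  shows "subfield (Domain G) R"
proof (rule subfieldI'[OF subringI])
  show "Domain G \<subseteq> carrier R" "\<one> \<in> Domain G"
    using G unfolding partial_iso_def by auto
  show "\<ominus> h \<in> Domain G" if "h \<in> Domain G" for h
    using G that unfolding partial_iso_def Domain_iff by metis
  show "a \<otimes> b \<in> Domain G" "a \<oplus> b \<in> Domain G" if "a \<in> Domain G" "b \<in> Domain G" for a b
    using G that unfolding partial_iso_def Domain_iff by metis+
  show "inv k \<in> Domain G" if "k \<in> Domain G - {\<zero>}" for k
    using G that unfolding partial_iso_def Domain_iff by (metis DiffD1 DiffD2 Domain_iff singletonI)
qed

lemma partial_iso_hom: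
  assumes G: "partial_iso R G"
  shows "\<exists>h\<in>ring_hom (R\<lparr>carrier := Domain G\<rparr>) R. \<forall>a\<in>Domain G. (a, h a) \<in> G"
proof -
  define h where "h = (\<lambda>a. SOME b. (a, b) \<in> G)"
  have h: "(a, h a) \<in> G" if "a \<in> Domain G" for a
    using that unfolding h_def by (auto intro: someI)
  have eq: "h a = b" if "(a, b) \<in> G" for a b
    using partial_iso_functional[OF G] h that by blast
  have "h \<in> ring_hom (R\<lparr>carrier := Domain G\<rparr>) R"
  proof (rule ring_hom_memI; simp)
    show "h x \<in> carrier R" if "x \<in> Domain G" for x
      using h[OF that] G unfolding partial_iso_def by auto
    show "h (x \<otimes> y) = h x \<otimes> h y" "h (x \<oplus> y) = h x \<oplus> h y"
      if "x \<in> Domain G" "y \<in> Domain G" for x y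
      using h[OF that(1)] h[OF that(2)] G eq unfolding partial_iso_def by blast+
    show "h \<one> = \<one>"
      using eq G unfolding partial_iso_def by blast
  qed
  then show ?thesis using h by blast
qed

lemma eval_map_hom:
  assumes M: "subfield M R" and h: "h \<in> ring_hom (R\<lparr>carrier := M\<rparr>) R" and t: "t \<in> carrier R"
  shows "(\<lambda>q. eval (map h q) t) \<in> ring_hom (M[X]) R"
proof -
  interpret H: ring_hom_ring "R\<lparr>carrier := M\<rparr>" R h
    using ring_hom_ringI2[OF subring_is_ring[OF subfieldE(1)[OF M]] ring_axioms h] .
  have set: "set q \<subseteq> M" if "q \<in> carrier (M[X])" for q
    using that by (auto simp: univ_poly_carrier[symmetric] polynomial_def)
  have img: "set (map h q) \<subseteq> carrier R" if "set q \<subseteq> M" for q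
    using H.hom_closed that by auto
  show ?thesis
  proof (rule ring_hom_memI)
    show "eval (map h q) t \<in> carrier R" if "q \<in> carrier (M[X])" for q
      using eval_in_carrier[OF img[OF set[OF that]] t] .
    fix p q assume p: "p \<in> carrier (M[X])" and q: "q \<in> carrier (M[X])"
    note sp = set[OF p] and sq = set[OF q]
    \<comment> \<open>Mapping a list entrywise commutes with the polynomial operations only up to
      leading zeros, which \<open>eval\<close> does not see.\<close>
    have *: "normalize (map h (poly_mult p q)) = poly_mult (map h p) (map h q)"
      using H.poly_mult_hom'[of p q] sp sq poly_mult_consistent[OF subfieldE(1)[OF M]] by simp
    have **: "normalize (map h (poly_add p q)) = poly_add (map h p) (map h q)"
      using H.poly_add_hom'[of p q] sp sq poly_add_consistent[OF subfieldE(1)[OF M]] by simp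
    have cm: "p \<otimes>\<^bsub>M[X]\<^esub> q \<in> carrier (M[X])" "p \<oplus>\<^bsub>M[X]\<^esub> q \<in> carrier (M[X])"
      using p q cring.cring_simprules[OF univ_poly_is_cring[OF subfieldE(1)[OF M]]] by auto
    show "eval (map h (p \<otimes>\<^bsub>M[X]\<^esub> q)) t = eval (map h p) t \<otimes> eval (map h q) t"
      using eval_poly_mult[OF img[OF sp] img[OF sq] t] * eval_normalize[OF img[OF set[OF cm(1)]] t]
      by (simp add: univ_poly_mult del: poly_mult.simps)
    show "eval (map h (p \<oplus>\<^bsub>M[X]\<^esub> q)) t = eval (map h p) t \<oplus> eval (map h q) t"
      using eval_poly_add[OF img[OF sp] img[OF sq] t] ** eval_normalize[OF img[OF set[OF cm(2)]] t]
      by (simp add: univ_poly_add del: poly_add.simps)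
  next
    show "eval (map h \<one>\<^bsub>M[X]\<^esub>) t = \<one>"
      using t H.hom_one by (simp add: univ_poly_one)
  qed
qed

text \<open>The extension sends \<open>q(t)\<close> to \<open>(h q)(t')\<close>. It is well defined
  because the minimal polynomial of \<open>t\<close> divides every \<open>q\<close> with
  \<open>q(t) = 0\<close>, and no nonzero \<open>q(t)\<close> goes to zero because its inverse is
  again a polynomial in \<open>t\<close>.\<close>

lemma partial_iso_step:
  assumes M: "subfield M R" and h: "h \<in> ring_hom (R\<lparr>carrier := M\<rparr>) R"
    and t: "t \<in> carrier R" "(algebraic over M) t"
    and t': "t' \<in> carrier R" "eval (map h (Irr M t)) t' = \<zero>"
  shows "\<exists>G. partial_iso R G \<and> (t, t') \<in> G \<and> (\<forall>a\<in>M. (a, h a) \<in> G)"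
proof -
  let ?P = "M[X]"
  have sM: "subring M R" using subfieldE(1)[OF M] .
  interpret UP: cring ?P using univ_poly_is_cring[OF sM] .
  define f g where "f = (\<lambda>q. eval q t)" and "g = (\<lambda>q. eval (map h q) t')"
  interpret f: ring_hom_ring ?P R f
    unfolding f_def using eval_ring_hom[OF sM t(1)] .
  interpret g: ring_hom_ring ?P R g
    using ring_hom_ringI2[OF UP.ring_axioms ring_axioms] eval_map_hom[OF M h t'(1)]
    unfolding g_def by blast
  interpret H: ring_hom_ring "R\<lparr>carrier := M\<rparr>" R h
    using ring_hom_ringI2[OF subring_is_ring[OF sM] ring_axioms h] .
  note Irr = IrrE[OF M t]
  have MC: "M \<subseteq> carrier R" using subfieldE(3)[OF M] .
  have ker: "g q = \<zero>" if q: "q \<in> carrier ?P" "f q = \<zero>" for q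
  proof -
    have "Irr M t pdivides q"
      using Irr_minimal[OF M t q(1)] q(2) unfolding f_def by simp
    then have "Irr M t divides\<^bsub>?P\<^esub> q"
      using pdivides_iff_shell[OF M Irr(1) q(1)] by simp
    then obtain r where "r \<in> carrier ?P" "q = Irr M t \<otimes>\<^bsub>?P\<^esub> r"
      by (auto simp: factor_def)
    then have "g q = g (Irr M t) \<otimes> g r" using Irr(1) by simp
    then show ?thesis using t'(2) g.hom_closed[OF \<open>r \<in> carrier ?P\<close>] unfolding g_def by simp
  qed
  have sf: "subfield (f ` carrier ?P) R"
    using simple_extension_is_subfield[OF M t(1)] t(2) simple_extension_as_eval_img[OF MC t(1)]
    unfolding f_def by simp
  have nz: "g q \<noteq> \<zero> \<and> (\<exists>r\<in>carrier ?P. f r = inv (f q) \<and> g r = inv (g q))"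
    if q: "q \<in> carrier ?P" "f q \<noteq> \<zero>" for q
  proof -
    have "inv (f q) \<in> f ` carrier ?P"
      using subfield_m_inv(1)[OF sf] q by auto
    then obtain r where r: "r \<in> carrier ?P" "f r = inv (f q)" by auto
    have "f q \<otimes> f r = \<one>"
      using q r field_Units[of ] by (metis DiffI Units_r_inv f.hom_closed singletonD)
    then have "f (q \<otimes>\<^bsub>?P\<^esub> r \<ominus>\<^bsub>?P\<^esub> \<one>\<^bsub>?P\<^esub>) = \<zero>"
      using q r by (simp add: UP.minus_eq, simp add: r_neg)
    then have "g (q \<otimes>\<^bsub>?P\<^esub> r \<ominus>\<^bsub>?P\<^esub> \<one>\<^bsub>?P\<^esub>) = \<zero>"
      using ker q r by simp
    then have "g q \<otimes> g r \<oplus> \<ominus> \<one> = \<zero>"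
      using q r by (simp add: UP.minus_eq)
    then have "g q \<otimes> g r = \<one>"
      using q r by (metis a_minus_def g.hom_closed m_closed one_closed r_right_minus_eq)
    then show ?thesis
      using q r by (metis comm_inv_char g.hom_closed l_null one_not_zero)
  qed
  define G where "G = (\<lambda>q. (f q, g q)) ` carrier ?P"
  have "partial_iso R G"
    unfolding partial_iso_def
  proof (intro conjI allI impI)
    show "G \<subseteq> carrier R \<times> carrier R" by (auto simp: G_def)
    show "(\<one>, \<one>) \<in> G"
      unfolding G_def by (rule image_eqI[of _ _ "\<one>\<^bsub>?P\<^esub>"]) auto
  next
    fix a b c d assume "(a, b) \<in> G" "(c, d) \<in> G"
    then obtain q r where qr: "q \<in> carrier ?P" "r \<in> carrier ?P" "a = f q" "b = g q" "c = f r" "d = g r"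
      by (auto simp: G_def)
    show "(a \<oplus> c, b \<oplus> d) \<in> G"
      unfolding G_def by (rule image_eqI[of _ _ "q \<oplus>\<^bsub>?P\<^esub> r"]) (use qr in auto)
    show "(a \<otimes> c, b \<otimes> d) \<in> G"
      unfolding G_def by (rule image_eqI[of _ _ "q \<otimes>\<^bsub>?P\<^esub> r"]) (use qr in auto)
  next
    fix a b assume "(a, b) \<in> G"
    then obtain q where q: "q \<in> carrier ?P" "a = f q" "b = g q"
      by (auto simp: G_def)
    show "(\<ominus> a, \<ominus> b) \<in> G"
      unfolding G_def by (rule image_eqI[of _ _ "\<ominus>\<^bsub>?P\<^esub> q"]) (use q in auto)
    show "a = \<zero> \<longleftrightarrow> b = \<zero>"
      using ker nz q by metis
    show "(inv a, inv b) \<in> G" if "a \<noteq> \<zero>"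
    proof -
      have "f q \<noteq> \<zero>" using that q(2) by simp
      then have "\<exists>r\<in>carrier ?P. f r = inv (f q) \<and> g r = inv (g q)" using nz[OF q(1)] by simp
      then obtain r where r: "r \<in> carrier ?P" "f r = inv (f q)" "g r = inv (g q)"
        by (elim bexE conjE)
      then have "(inv (f q), inv (g q)) \<in> G"
        unfolding G_def by (intro image_eqI[of _ _ r]) simp_all
      then show ?thesis using q(2,3) by simp
    qed
  qed
  moreover have "(t, t') \<in> G"
  proof -
    have X: "[\<one>, \<zero>] \<in> carrier ?P" using var_closed(1)[OF sM] by (simp add: var_def)
    have "f [\<one>, \<zero>] = t" "g [\<one>, \<zero>] = t'"
      unfolding f_def g_def using t t' H.hom_one H.hom_zero by simp_all
    then show ?thesis unfolding G_def using X by (intro image_eqI[of _ _ "[\<one>, \<zero>]"]) simp_all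
  qed
  moreover have "(a, h a) \<in> G" if a: "a \<in> M" for a
  proof (cases "a = \<zero>")
    case True
    have "f [] = \<zero>" "g [] = \<zero>" unfolding f_def g_def by auto
    moreover have "h \<zero> = \<zero>" using H.hom_zero by simp
    ultimately show ?thesis
      unfolding G_def True by (intro image_eqI[of _ _ "[]"]) auto
  next
    case False
    then have "[a] \<in> carrier ?P"
      using a by (auto simp: univ_poly_carrier[symmetric] polynomial_def)
    moreover have "f [a] = a" "g [a] = h a"
      unfolding f_def g_def using a MC H.hom_closed[of a] by auto
    ultimately show ?thesis unfolding G_def by (intro image_eqI[of _ _ "[a]"]) simp_all
  qed
  ultimately show ?thesis by blast
qed

end

text \<open>A name of its own lets the base field vary: the results are applied over
  \<open>K\<close>, over \<open>L\<close> and over decomposition fields, all inside the same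
  closure.\<close>

locale closed_extension = algebraic_closure R K for R (structure) and K
begin

text \<open>The image of the minimal polynomial of \<open>t\<close> over \<open>Domain G\<close> is
  monic of positive degree and splits, and any of its roots can serve as the image of
  \<open>t\<close>.\<close>

lemma partial_iso_extend:
  assumes G: "partial_iso R G" and K: "\<And>a. a \<in> K \<Longrightarrow> (a, a) \<in> G" and t: "t \<in> carrier R"
  shows "\<exists>G'. partial_iso R G' \<and> G \<subseteq> G' \<and> t \<in> Domain G'"
proof -
  note M = partial_iso_domain_subfield[OF G]
  obtain h where h: "h \<in> ring_hom (R\<lparr>carrier := Domain G\<rparr>) R" "\<forall>a\<in>Domain G. (a, h a) \<in> G"
    using partial_iso_hom[OF G] by (elim bexE)
  have "K \<subseteq> Domain G" using K by blast
  then have alg: "(algebraic over (Domain G)) t"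
    using algebraic_mono algebraic_extension[OF t] by blast
  let ?p = "Irr (Domain G) t"
  note p = IrrE[OF M t alg]
  have deg: "degree ?p > 0"
    using pirreducible_degree[OF M p(1,2)] by simp
  have setp: "set ?p \<subseteq> Domain G" and ne: "?p \<noteq> []"
    using p(1) deg by (auto simp: univ_poly_carrier[symmetric] polynomial_def)
  have "h \<one> = \<one>"
    using ring_hom_one[OF h(1)] by simp
  then have lc: "lead_coeff (map h ?p) = \<one>"
    using p(3) ne by (simp add: hd_map)
  have mp: "map h ?p \<in> carrier (poly_ring R)"
    using setp lc ring_hom_closed[OF h(1)] by (auto simp: univ_poly_carrier[symmetric] polynomial_def)
  then have "splitted (map h ?p)" using roots_over_carrier by blast
  then have "size (roots (map h ?p)) > 0" using deg unfolding splitted_def by simp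
  then obtain t' where "t' \<in># roots (map h ?p)"
    by (metis multiset_nonemptyE size_empty not_less_zero)
  then have t': "t' \<in> carrier R" "eval (map h ?p) t' = \<zero>"
    using roots_mem_iff_is_root[OF mp] unfolding is_root_def by auto
  obtain G' where G': "partial_iso R G'" "(t, t') \<in> G'" "\<forall>a\<in>Domain G. (a, h a) \<in> G'"
    using partial_iso_step[OF M h(1) t alg t'] by (elim exE conjE)
  have "G \<subseteq> G'"
  proof (rule subrelI)
    fix a b assume "(a, b) \<in> G"
    moreover from this have "a \<in> Domain G" by blast
    ultimately show "(a, b) \<in> G'"
      using partial_iso_functional[OF G, of a b "h a"] h(2) G'(3) by metis
  qed
  then show ?thesis using G' by blast
qed

lemma partial_iso_extends_to_aut:
  assumes G: "partial_iso R G" and K: "\<And>a. a \<in> K \<Longrightarrow> (a, a) \<in> G"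
  shows "\<exists>s\<in>field_auts R K. \<forall>a b. (a, b) \<in> G \<longrightarrow> s a = b"
proof -
  define S where "S = {G'. partial_iso R G' \<and> G \<subseteq> G'}"
  have "\<exists>U\<in>S. \<forall>H\<in>C. H \<subseteq> U" if "subset.chain S C" for C
  proof (cases "C = {}")
    case True then show ?thesis using G S_def by blast
  next
    case False
    have "partial_iso R (\<Union>C)"
    proof (rule partial_iso_Union[OF False])
      show "\<And>H. H \<in> C \<Longrightarrow> partial_iso R H" using that unfolding S_def subset.chain_def by blast
      show "\<And>H H'. H \<in> C \<Longrightarrow> H' \<in> C \<Longrightarrow> H \<subseteq> H' \<or> H' \<subseteq> H"
        using that by (metis subset_chain_def)
    qed
    moreover have "G \<subseteq> \<Union>C" using that False unfolding S_def subset.chain_def by blast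
    ultimately show ?thesis unfolding S_def by blast
  qed
  then have "\<exists>N\<in>S. \<forall>H\<in>S. N \<subseteq> H \<longrightarrow> H = N"
    by (rule subset_Zorn)
  then obtain N where N: "N \<in> S" "\<forall>H\<in>S. N \<subseteq> H \<longrightarrow> H = N" by (elim bexE)
  have pN: "partial_iso R N" and GN: "G \<subseteq> N" using N(1) unfolding S_def by auto
  have dom: "t \<in> Domain N" if t: "t \<in> carrier R" for t
  proof -
    obtain G' where "partial_iso R G'" "N \<subseteq> G'" "t \<in> Domain G'"
      using partial_iso_extend[OF pN _ t] K GN by blast
    then show ?thesis using N(2)[rule_format, of G'] GN unfolding S_def by auto
  qed
  have ran: "t \<in> Range N" if t: "t \<in> carrier R" for t
  proof -
    obtain G' where G': "partial_iso R G'" "N\<inverse> \<subseteq> G'" "t \<in> Domain G'"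
      using partial_iso_extend[OF partial_iso_converse[OF pN] _ t] K GN by blast
    have sub: "N \<subseteq> G'\<inverse>" using G'(2) by auto
    then have "G \<subseteq> G'\<inverse>" using GN by blast
    then have "G'\<inverse> = N" using sub N(2)[rule_format, of "G'\<inverse>"] partial_iso_converse[OF G'(1)] G'(2) GN unfolding S_def by auto
    then show ?thesis using G'(3) by blast
  qed
  obtain s where s: "s \<in> ring_hom (R\<lparr>carrier := Domain N\<rparr>) R" "\<forall>a\<in>Domain N. (a, s a) \<in> N"
    using partial_iso_hom[OF pN] by (elim bexE)
  have NC: "N \<subseteq> carrier R \<times> carrier R" using pN unfolding partial_iso_def by (elim conjE)
  then have D: "Domain N = carrier R" using dom by auto
  have sN: "s a = b" if "(a, b) \<in> N" for a b
    using partial_iso_functional[OF pN, of a "s a" b] s(2) that by (metis DomainI)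
  have "bij_betw s (carrier R) (carrier R)"
  proof (rule bij_betwI')
    fix x y assume "x \<in> carrier R" "y \<in> carrier R"
    then have "(s x, x) \<in> N\<inverse>" "(s y, y) \<in> N\<inverse>" using s(2) D by auto
    then show "(s x = s y) = (x = y)"
      using partial_iso_functional[OF partial_iso_converse[OF pN]] by metis
  next
    fix x assume "x \<in> carrier R"
    then have "(x, s x) \<in> N" using s(2) D by simp
    then show "s x \<in> carrier R" using NC by auto
  next
    fix y assume "y \<in> carrier R"
    then obtain x where x: "(x, y) \<in> N" using ran by auto
    then have "x \<in> carrier R" using NC by auto
    then show "\<exists>x\<in>carrier R. y = s x" using sN[OF x] by auto
  qed
  moreover have "s \<in> ring_hom R R" using s(1) unfolding D by simp
  moreover have "s a = a" if "a \<in> K" for a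
    using sN[of a a] K[OF that] GN by auto
  ultimately have "s \<in> field_auts R K"
    unfolding field_auts_def ring_iso_def by simp
  moreover have "\<forall>a b. (a, b) \<in> G \<longrightarrow> s a = b" using sN GN by auto
  ultimately show ?thesis by auto
qed

lemma K_subfield: "subfield K R" ..

lemma auts_transitive:
  assumes x: "x \<in> carrier R" and y: "y \<in> carrier R" "eval (Irr K x) y = \<zero>"
  obtains s where "s \<in> field_auts R K" "s x = y"
proof -
  have h: "(\<lambda>a. a) \<in> ring_hom (R\<lparr>carrier := K\<rparr>) R"
    using subfieldE(3)[OF K_subfield] by (intro ring_hom_memI) auto
  have "eval (map (\<lambda>a. a) (Irr K x)) y = \<zero>" using y(2) by simp
  then obtain G where G: "partial_iso R G" "(x, y) \<in> G" "\<forall>a\<in>K. (a, a) \<in> G"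
    using partial_iso_step[OF K_subfield h x algebraic_extension[OF x] y(1)] by metis
  then obtain s where "s \<in> field_auts R K" "\<forall>a b. (a, b) \<in> G \<longrightarrow> s a = b"
    using partial_iso_extends_to_aut[OF G(1)] by blast
  then show thesis using that G(2) by blast
qed

end


section \<open>Polynomials and their roots\<close>

context field
begin

lemma aut_ring_hom: "s \<in> field_auts R F \<Longrightarrow> ring_hom_ring R R s"
  by (intro ring_hom_ringI2 ring_axioms) (auto simp: field_auts_def ring_iso_def)

lemma aut_ring_hom_cring: "s \<in> field_auts R F \<Longrightarrow> ring_hom_cring R R s"
  by (intro ring_hom_cring.intro ring_hom_cring_axioms.intro cring_axioms)
     (auto simp: field_auts_def ring_iso_def)

lemma aut_bij: "s \<in> field_auts R F \<Longrightarrow> bij_betw s (carrier R) (carrier R)"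
  by (auto simp: field_auts_def ring_iso_def)

lemma aut_fix: "s \<in> field_auts R F \<Longrightarrow> a \<in> F \<Longrightarrow> s a = a"
  by (auto simp: field_auts_def)

lemma aut_closed [simp, intro]: "s \<in> field_auts R F \<Longrightarrow> x \<in> carrier R \<Longrightarrow> s x \<in> carrier R"
  using ring_hom_closed[of s R R x] by (auto simp: field_auts_def ring_iso_def)

lemma aut_simps [simp]:
  assumes "s \<in> field_auts R F"
  shows "x \<in> carrier R \<Longrightarrow> y \<in> carrier R \<Longrightarrow> s (x \<otimes> y) = s x \<otimes> s y"
    and "x \<in> carrier R \<Longrightarrow> y \<in> carrier R \<Longrightarrow> s (x \<oplus> y) = s x \<oplus> s y"
    and "x \<in> carrier R \<Longrightarrow> s (\<ominus> x) = \<ominus> s x"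
    and "s \<zero> = \<zero>" and "s \<one> = \<one>"
    and "x \<in> carrier R \<Longrightarrow> s (x [^] (n::nat)) = s x [^] n"
proof -
  interpret s: ring_hom_cring R R s using aut_ring_hom_cring[OF assms] .
  show "x \<in> carrier R \<Longrightarrow> y \<in> carrier R \<Longrightarrow> s (x \<otimes> y) = s x \<otimes> s y"
    "x \<in> carrier R \<Longrightarrow> y \<in> carrier R \<Longrightarrow> s (x \<oplus> y) = s x \<oplus> s y"
    "x \<in> carrier R \<Longrightarrow> s (\<ominus> x) = \<ominus> s x" "s \<zero> = \<zero>" "s \<one> = \<one>"
    by simp_all
  show "x \<in> carrier R \<Longrightarrow> s (x [^] (n::nat)) = s x [^] n"
    by (induction n) auto
qed

lemma aut_eq_iff:
  "s \<in> field_auts R F \<Longrightarrow> x \<in> carrier R \<Longrightarrow> y \<in> carrier R \<Longrightarrow> s x = s y \<longleftrightarrow> x = y"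
  using aut_bij by (auto simp: bij_betw_def inj_on_def)

lemma aut_zero_iff [simp]:
  "s \<in> field_auts R F \<Longrightarrow> x \<in> carrier R \<Longrightarrow> s x = \<zero> \<longleftrightarrow> x = \<zero>"
  using aut_eq_iff[of s F x \<zero>] by simp

lemma inv_closed_nonzero: "x \<in> carrier R \<Longrightarrow> x \<noteq> \<zero> \<Longrightarrow> inv x \<in> carrier R"
  and r_inv_nonzero: "x \<in> carrier R \<Longrightarrow> x \<noteq> \<zero> \<Longrightarrow> x \<otimes> inv x = \<one>"
  and l_inv_nonzero: "x \<in> carrier R \<Longrightarrow> x \<noteq> \<zero> \<Longrightarrow> inv x \<otimes> x = \<one>"
  by (simp_all add: field_Units)

lemma inv_nonzero: "x \<in> carrier R \<Longrightarrow> x \<noteq> \<zero> \<Longrightarrow> inv x \<noteq> \<zero>"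
  using r_inv_nonzero[of x] by auto

lemma pow_nonzero: "x \<in> carrier R \<Longrightarrow> x \<noteq> \<zero> \<Longrightarrow> x [^] (n::nat) \<noteq> \<zero>"
  by (induction n) (auto simp: integral_iff)

lemma pow_zero_iff: "x \<in> carrier R \<Longrightarrow> n \<ge> 1 \<Longrightarrow> x [^] (n::nat) = \<zero> \<longleftrightarrow> x = \<zero>"
  using pow_nonzero[of x n] by (cases n) auto

lemma aut_compose:
  "s \<in> field_auts R F \<Longrightarrow> t \<in> field_auts R F \<Longrightarrow> (\<lambda>x. s (t x)) \<in> field_auts R F"
  unfolding field_auts_def
  using ring_iso_set_trans[of t R R s R] by (auto simp: comp_def)

lemma aut_mono: "F \<subseteq> F' \<Longrightarrow> field_auts R F' \<subseteq> field_auts R F"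
  by (auto simp: field_auts_def)

lemma aut_id: "(\<lambda>x. x) \<in> field_auts R F"
  using ring_iso_set_refl[of R] by (simp add: field_auts_def id_def)

lemma aut_inverse:
  assumes s: "s \<in> field_auts R F" and F: "F \<subseteq> carrier R"
  obtains t where "t \<in> field_auts R F" "\<forall>x\<in>carrier R. t (s x) = x \<and> s (t x) = x"
proof
  have iso: "s \<in> ring_iso R R" using s by (simp add: field_auts_def)
  have bij: "bij_betw s (carrier R) (carrier R)" using aut_bij[OF s] .
  have left: "inv_into (carrier R) s (s x) = x" if "x \<in> carrier R" for x
    using bij that by (simp add: bij_betw_def)
  show "inv_into (carrier R) s \<in> field_auts R F"
    unfolding field_auts_def using ring_iso_set_sym[OF ring_axioms iso] left aut_fix[OF s] F
    by (auto simp: subset_iff) (metis left)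
  show "\<forall>x\<in>carrier R. inv_into (carrier R) s (s x) = x \<and> s (inv_into (carrier R) s x) = x"
    using left bij by (auto simp: bij_betw_def f_inv_into_f)
qed

text \<open>The coefficient of \<open>X^i\<close> in the product of the \<open>X - y\<close> for
  \<open>y\<close> in the list, up to sign an elementary symmetric polynomial. Indices ascend, in
  contrast to the coefficient lists of polynomials.\<close>

fun root_coeff :: "'a list \<Rightarrow> nat \<Rightarrow> 'a" where
  "root_coeff [] i = (if i = 0 then \<one> else \<zero>)"
| "root_coeff (y # ys) i = (if i = 0 then \<zero> else root_coeff ys (i - 1)) \<oplus> \<ominus> (y \<otimes> root_coeff ys i)"

lemma root_coeff_closed [simp]: "set ys \<subseteq> carrier R \<Longrightarrow> root_coeff ys i \<in> carrier R"
  by (induction ys arbitrary: i) auto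

lemma root_coeff_beyond: "set ys \<subseteq> carrier R \<Longrightarrow> i > length ys \<Longrightarrow> root_coeff ys i = \<zero>"
  by (induction ys arbitrary: i) auto

lemma root_coeff_top: "set ys \<subseteq> carrier R \<Longrightarrow> root_coeff ys (length ys) = \<one>"
  by (induction ys) (auto simp: root_coeff_beyond)

lemma root_coeff_eval:
  assumes "set ys \<subseteq> carrier R" and x: "x \<in> carrier R"
  shows "(\<Oplus>i\<in>{..length ys}. root_coeff ys i \<otimes> x [^] i) = foldr (\<lambda>y a. (x \<ominus> y) \<otimes> a) ys \<one>"
  using assms(1)
proof (induction ys)
  case Nil
  then show ?case by simp
next
  case (Cons y ys)
  then have y: "y \<in> carrier R" and ys: "set ys \<subseteq> carrier R" by auto
  let ?n = "length ys"
  let ?S = "\<Oplus>i\<in>{..?n}. root_coeff ys i \<otimes> x [^] i"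
  have S: "?S \<in> carrier R" using ys x by auto
  have cl: "root_coeff ys i \<otimes> x [^] i \<in> carrier R" for i using ys x by simp
  have "(\<Oplus>i\<in>{..Suc ?n}. root_coeff (y # ys) i \<otimes> x [^] i) =
      (\<Oplus>i\<in>{..Suc ?n}. (if i = 0 then \<zero> else root_coeff ys (i - 1) \<otimes> x [^] i) \<oplus>
          \<ominus> y \<otimes> (root_coeff ys i \<otimes> x [^] i))"
  proof (intro finsum_cong' refl)
    fix i
    have "(a \<oplus> \<ominus> (y \<otimes> b)) \<otimes> c = a \<otimes> c \<oplus> \<ominus> y \<otimes> (b \<otimes> c)"
      if "a \<in> carrier R" "b \<in> carrier R" "c \<in> carrier R" for a b c
      using that y by (simp add: l_distr l_minus m_assoc)
    from this[of "if i = 0 then \<zero> else root_coeff ys (i - 1)" "root_coeff ys i" "x [^] i"]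
    show "root_coeff (y # ys) i \<otimes> x [^] i =
        (if i = 0 then \<zero> else root_coeff ys (i - 1) \<otimes> x [^] i) \<oplus>
          \<ominus> y \<otimes> (root_coeff ys i \<otimes> x [^] i)"
      using x ys by simp
  qed (use x y ys in auto)
  also have "\<dots> = (\<Oplus>i\<in>{..Suc ?n}. if i = 0 then \<zero> else root_coeff ys (i - 1) \<otimes> x [^] i) \<oplus>
      (\<Oplus>i\<in>{..Suc ?n}. \<ominus> y \<otimes> (root_coeff ys i \<otimes> x [^] i))"
    using x y ys by (intro finsum_addf) auto
  also have "(\<Oplus>i\<in>{..Suc ?n}. \<ominus> y \<otimes> (root_coeff ys i \<otimes> x [^] i)) =
      \<ominus> y \<otimes> (\<Oplus>i\<in>{..Suc ?n}. root_coeff ys i \<otimes> x [^] i)"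
    using x y ys by (intro finsum_rdistr[symmetric]) auto
  also have "(\<Oplus>i\<in>{..Suc ?n}. root_coeff ys i \<otimes> x [^] i) = ?S"
    using x ys by (subst finsum_Suc) (auto simp: root_coeff_beyond)
  also have "(\<Oplus>i\<in>{..Suc ?n}. if i = 0 then \<zero> else root_coeff ys (i - 1) \<otimes> x [^] i) =
      (\<Oplus>i\<in>{..?n}. x \<otimes> (root_coeff ys i \<otimes> x [^] i))"
    using x ys by (subst finsum_Suc2) (auto intro!: finsum_cong' simp: m_ac)
  also have "\<dots> = x \<otimes> ?S"
    using x ys by (intro finsum_rdistr[symmetric]) auto
  also have "x \<otimes> ?S \<oplus> \<ominus> y \<otimes> ?S = (x \<ominus> y) \<otimes> ?S"
    using x y S by (simp add: a_minus_def l_distr)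
  finally show ?case using Cons.IH ys by simp
qed

lemma foldr_prod_closed:
  "set ys \<subseteq> carrier R \<Longrightarrow> x \<in> carrier R \<Longrightarrow> foldr (\<lambda>y a. (x \<ominus> y) \<otimes> a) ys \<one> \<in> carrier R"
  by (induction ys) auto

lemma foldr_prod_zero:
  assumes "set ys \<subseteq> carrier R" "x \<in> set ys"
  shows "foldr (\<lambda>y a. (x \<ominus> y) \<otimes> a) ys \<one> = \<zero>"
  using assms
proof (induction ys)
  case (Cons y ys)
  then show ?case
    using foldr_prod_closed[of ys x] by (auto simp: a_minus_def r_neg)
qed simp

lemma root_coeff_eval_root:
  assumes "set ys \<subseteq> carrier R" "x \<in> set ys"
  shows "(\<Oplus>i\<in>{..length ys}. root_coeff ys i \<otimes> x [^] i) = \<zero>"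
  using root_coeff_eval[of ys x] foldr_prod_zero[of ys x] assms by auto

lemma root_coeff_subfield:
  assumes "subfield F R" "set ys \<subseteq> F"
  shows "root_coeff ys i \<in> F"
  using assms(2)
proof (induction ys arbitrary: i)
  case (Cons y ys)
  then show ?case
    using subringE[OF subfieldE(1)[OF assms(1)]] by auto
qed (use subringE[OF subfieldE(1)[OF assms(1)]] in auto)

lemma coeff_linear_mult:
  assumes a: "a \<in> carrier R" and q: "set q \<subseteq> carrier R"
  shows "coeff (poly_mult [\<one>, \<ominus> a] q) i =
    (if i = 0 then \<zero> else coeff q (i - 1)) \<oplus> \<ominus> (a \<otimes> coeff q i)"
proof -
  have c1: "coeff [\<one>, \<ominus> a] k = (if k = 0 then \<ominus> a else if k = 1 then \<one> else \<zero>)" for k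
    by simp
  have cq: "coeff q k \<in> carrier R" for k using q by simp
  have *: "coeff (poly_mult [\<one>, \<ominus> a] q) i = (\<Oplus>k\<in>{..i}. coeff [\<one>, \<ominus> a] k \<otimes> coeff q (i - k))"
    using poly_mult_coeff[of "[\<one>, \<ominus> a]" q] a q by (simp del: poly_mult.simps coeff.simps)
  show ?thesis
  proof (cases i)
    case 0
    then show ?thesis
      unfolding * using a cq by (simp add: l_minus)
  next
    case (Suc j)
    have "(\<Oplus>k\<in>{..Suc j}. coeff [\<one>, \<ominus> a] k \<otimes> coeff q (Suc j - k)) =
        (\<Oplus>k\<in>{..j}. if k = 0 then coeff q j else \<zero>) \<oplus> \<ominus> a \<otimes> coeff q (Suc j)"
      using a cq by (subst finsum_Suc2)
        (auto intro!: arg_cong2[where f = "(\<oplus>)"] finsum_cong' simp del: coeff.simps simp: c1)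
    also have "(\<Oplus>k\<in>{..j}. if k = 0 then coeff q j else \<zero>) = coeff q j"
      using finsum_singleton[of 0 "{..j}" "\<lambda>_. coeff q j"] cq
      by (simp add: eq_commute[of 0])
    finally show ?thesis unfolding * using Suc a cq by (simp add: l_minus)
  qed
qed

end

context algebraically_closed
begin

text \<open>Roots are split off one at a time, and \<open>coeff_linear_mult\<close> matches the
  recursion that defines \<open>root_coeff\<close>.\<close>

lemma monic_roots:
  assumes "p \<in> carrier (poly_ring L)" "p \<noteq> []" "lead_coeff p = \<one>"
  shows "\<exists>ys. set ys \<subseteq> carrier L \<and> length ys = degree p \<and> (\<forall>i. coeff p i = root_coeff ys i) \<and>
    (\<forall>x\<in>carrier L. eval p x = \<zero> \<longleftrightarrow> x \<in> set ys)"
  using assms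
proof (induction "degree p" arbitrary: p)
  case 0
  then have "length p = 1" by (cases p) auto
  then have "p = [\<one>]" using 0 by (cases p) auto
  then show ?case by (intro exI[of _ "[]"]) auto
next
  case (Suc n)
  have "splitted p" using roots_over_carrier[OF Suc.prems(1)] .
  then have "size (roots p) > 0" using Suc(2) unfolding splitted_def by simp
  then obtain a where "a \<in># roots p"
    by (metis multiset_nonemptyE size_empty not_less_zero)
  then have root: "is_root p a" using roots_mem_iff_is_root[OF Suc.prems(1)] by simp
  then have a: "a \<in> carrier L" unfolding is_root_def by simp
  have la: "[\<one>, \<ominus> a] \<in> carrier (poly_ring L)"
    using a by (auto simp: univ_poly_carrier[symmetric] polynomial_def)
  from is_root_imp_pdivides[OF Suc.prems(1) root]
  obtain q where q: "q \<in> carrier (poly_ring L)" and p: "p = poly_mult [\<one>, \<ominus> a] q"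
    unfolding pdivides_def by (auto simp: factor_def univ_poly_mult simp del: poly_mult.simps)
  have pol: "polynomial (carrier L) [\<one>, \<ominus> a]" "polynomial (carrier L) q"
    using la q by (simp_all add: univ_poly_carrier)
  have setq: "set q \<subseteq> carrier L" using pol(2) by (auto simp: polynomial_def)
  have seta: "set [\<one>, \<ominus> a] \<subseteq> carrier L" using a by simp
  have qn: "q \<noteq> []"
    using Suc.prems(2) poly_mult_integral[OF carrier_is_subring pol] p
      poly_mult_zero[OF seta] by metis
  have deg: "degree p = Suc (degree q)"
    using poly_mult_degree_eq[OF carrier_is_subring pol] qn unfolding p
    by (simp del: poly_mult.simps)
  have "lead_coeff q \<in> carrier L" using setq hd_in_set[OF qn] by blast
  then have lc: "lead_coeff q = \<one>"
    using poly_mult_lead_coeff[OF carrier_is_subring pol] qn Suc.prems(3)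
    unfolding p by (simp del: poly_mult.simps)
  have "n = degree q" using deg Suc(2) by simp
  from Suc(1)[OF this q qn lc] obtain ys where ys: "set ys \<subseteq> carrier L" "length ys = degree q"
    "\<forall>i. coeff q i = root_coeff ys i" "\<forall>x\<in>carrier L. eval q x = \<zero> \<longleftrightarrow> x \<in> set ys"
    by auto
  have "coeff p i = root_coeff (a # ys) i" for i
    unfolding p coeff_linear_mult[OF a setq] using ys(3) by simp
  moreover have "eval p x = \<zero> \<longleftrightarrow> x \<in> set (a # ys)" if x: "x \<in> carrier L" for x
  proof -
    have "eval p x = eval [\<one>, \<ominus> a] x \<otimes> eval q x"
      unfolding p using eval_poly_mult[OF seta setq x] .
    also have "eval [\<one>, \<ominus> a] x = x \<ominus> a" using x a by (simp add: a_minus_def)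
    finally show ?thesis
      using ys(4) x a eval_in_carrier[OF setq x] by (auto simp: integral_iff)
  qed
  ultimately show ?case
    using ys a deg by (intro exI[of _ "a # ys"]) auto
qed

end

context closed_extension
begin

lemma base_in_carrier: "K \<subseteq> carrier R"
  using subfieldE(3)[OF K_subfield] .

lemma closed_extension_intermediate:
  assumes "subfield F R" "K \<subseteq> F"
  shows "closed_extension R F"
proof -
  interpret F: subfield F R by fact
  show ?thesis
  proof
    show "x \<in> carrier R \<Longrightarrow> (algebraic over F) x" for x
      using algebraic_mono[OF assms(2)] algebraic_extension by blast
    show "P \<in> carrier (F [X]) \<Longrightarrow> splitted P" for P
      using roots_over_carrier carrier_polynomial_shell[OF subfieldE(1)[OF assms(1)]] by blast
  qed
qed

text \<open>Collects all that is used later about conjugates, so that minimal polynomials need not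
  be handled again. The list keeps multiplicities: with them \<open>root_coeff\<close> yields the
  coefficients of the minimal polynomial even for inseparable \<open>x\<close>.\<close>

lemma Irr_roots:
  assumes x: "x \<in> carrier R"
  shows "\<exists>ys. set ys \<subseteq> carrier R \<and> length ys = degree (Irr K x) \<and> x \<in> set ys \<and>
    (\<forall>i. root_coeff ys i \<in> K) \<and> (\<forall>i. coeff (Irr K x) i = root_coeff ys i) \<and>
    (\<forall>y\<in>set ys. \<exists>s\<in>field_auts R K. s x = y) \<and> (\<forall>s\<in>field_auts R K. s x \<in> set ys)"
proof -
  note alg = algebraic_extension[OF x]
  note Irr = IrrE[OF K_subfield x alg]
  have ne: "Irr K x \<noteq> []"
    using Irr(2) pirreducible_degree[OF K_subfield Irr(1)] by auto
  have setI: "set (Irr K x) \<subseteq> K" using Irr(1) by (auto simp: univ_poly_carrier[symmetric] polynomial_def)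
  have "Irr K x \<in> carrier (poly_ring R)"
    using Irr(1) carrier_polynomial_shell[OF subfieldE(1)[OF K_subfield]] by blast
  from monic_roots[OF this ne Irr(3)] obtain ys where ys: "set ys \<subseteq> carrier R"
    "length ys = degree (Irr K x)" "\<forall>i. coeff (Irr K x) i = root_coeff ys i"
    "\<forall>z\<in>carrier R. eval (Irr K x) z = \<zero> \<longleftrightarrow> z \<in> set ys" by auto
  have zK: "\<zero> \<in> K" using subringE(2)[OF subfieldE(1)[OF K_subfield]] .
  have "coeff (Irr K x) i \<in> K" for i
    using coeff_img_restrict[of "Irr K x"] coeff_length[of "Irr K x" i] setI zK
    by (cases "i < length (Irr K x)") auto
  then have K: "\<forall>i. root_coeff ys i \<in> K" using ys(3) by simp
  have "\<exists>s\<in>field_auts R K. s x = y" if "y \<in> set ys" for y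
  proof -
    have "y \<in> carrier R" "eval (Irr K x) y = \<zero>" using that ys by auto
    from auts_transitive[OF x this] show ?thesis by metis
  qed
  moreover have "s x \<in> set ys" if s: "s \<in> field_auts R K" for s
  proof -
    interpret s: ring_hom_ring R R s using aut_ring_hom[OF s] .
    have "map s (Irr K x) = Irr K x" using setI aut_fix[OF s] by (auto intro: map_idI)
    then have "eval (Irr K x) (s x) = s (eval (Irr K x) x)"
      using s.eval_hom[OF subfieldE(1)[OF K_subfield] x Irr(1)] by simp
    then show ?thesis using ys(4) Irr(4) aut_closed[OF s x] by simp
  qed
  moreover have "x \<in> set ys" using ys(4) Irr(4) x by simp
  ultimately show ?thesis using ys(1-3) K by (intro exI[of _ ys]) auto
qed

lemma finite_conjugates: "x \<in> carrier R \<Longrightarrow> finite {s x | s. s \<in> field_auts R K}"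
  using Irr_roots[of x] by (auto intro: finite_subset[OF _ List.finite_set])

end


section \<open>Separability in terms of additive powers\<close>

context ring
begin

declare Span.simps [simp del]

end

context field
begin

text \<open>The powers of the characteristic exponent; using them, characteristic \<open>0\<close> needs no separate
  treatment.\<close>

definition additive_exps :: "nat set" where
  "additive_exps = {d. 1 \<le> d \<and>
     (\<forall>a\<in>carrier R. \<forall>b\<in>carrier R. (a \<oplus> b) [^] d = a [^] d \<oplus> b [^] d)}"

lemma additive_exps_one: "1 \<in> additive_exps"
  by (auto simp: additive_exps_def)

lemma additive_exps_mult: "d \<in> additive_exps \<Longrightarrow> e \<in> additive_exps \<Longrightarrow> d * e \<in> additive_exps"
  by (auto simp: additive_exps_def nat_pow_pow[symmetric])

lemma additive_expsD:
  assumes "d \<in> additive_exps"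
  shows "1 \<le> d" and "a \<in> carrier R \<Longrightarrow> b \<in> carrier R \<Longrightarrow> (a \<oplus> b) [^] d = a [^] d \<oplus> b [^] d"
  using assms by (auto simp: additive_exps_def)

lemma zero_pow_pos: "1 \<le> d \<Longrightarrow> \<zero> [^] (d::nat) = \<zero>"
  by (cases d) auto

lemma Span_combination_induct [consumes 3, case_names zero add]:
  assumes K: "subfield K R" and U: "set Us \<subseteq> carrier R" and x: "x \<in> Span K Us"
    and zero: "P \<zero>"
    and add: "\<And>k e v. k \<in> K \<Longrightarrow> e \<in> set Us \<Longrightarrow> v \<in> Span K Us \<Longrightarrow> P v \<Longrightarrow> P (k \<otimes> e \<oplus> v)"
  shows "P x"
proof -
  have "P v" if "set Vs \<subseteq> set Us" "v \<in> Span K Vs" for Vs v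
    using that
  proof (induction Vs arbitrary: v)
    case Nil then show ?case using zero by (simp add: Span.simps)
  next
    case (Cons e Vs)
    then obtain k w where w: "k \<in> K" "w \<in> Span K Vs" "v = k \<otimes> e \<oplus> w"
      by (auto simp: Span.simps line_extension_mem_iff)
    have "w \<in> Span K Us"
      using w(2) mono_Span_sublist[OF K, of Vs Us] Cons.prems(1) U by auto
    then show ?case using add[of k e w] Cons w by auto
  qed
  then show ?thesis using x by blast
qed

lemma Span_superset_field:
  assumes K: "subfield K R" and F: "subfield F R" and "K \<subseteq> F" and U: "set Us \<subseteq> carrier R"
  shows "Span K Us \<subseteq> Span F Us"
proof
  fix x assume "x \<in> Span K Us"
  with K U show "x \<in> Span F Us"
  proof (induction rule: Span_combination_induct)
    case zero
    then show ?case using Span_subgroup_props(2)[OF F U] by simp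
  next
    case (add k e v)
    then show ?case
      using Span_subgroup_props(3)[OF F U] Span_smult_closed[OF F U] Span_base_incl[OF F U] assms(3)
      by (meson subsetD)
  qed
qed

lemma Span_pow:
  assumes K: "subfield K R" and U: "set Us \<subseteq> carrier R" and d: "d \<in> additive_exps"
    and x: "x \<in> Span K Us"
  shows "x [^] d \<in> Span K (map (\<lambda>e. e [^] d) Us)"
  using K U x
proof (induction rule: Span_combination_induct)
  have U': "set (map (\<lambda>e. e [^] d) Us) \<subseteq> carrier R" using U by auto
  note KC = subfieldE(3)[OF K]
  {
    case zero
    then show ?case using Span_subgroup_props(2)[OF K U'] zero_pow_pos additive_expsD(1)[OF d] by simp
  next
    case (add k e v)
    have c: "k \<in> carrier R" "e \<in> carrier R" "v \<in> carrier R"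
      using add KC U Span_subgroup_props(1)[OF K U] by auto
    have "k [^] d \<in> K"
      using add(1) by (induction d) (auto simp: subringE[OF subfieldE(1)[OF K]])
    moreover have "e [^] d \<in> Span K (map (\<lambda>e. e [^] d) Us)"
      using Span_base_incl[OF K U'] add(2) by auto
    ultimately have "k [^] d \<otimes> e [^] d \<oplus> v [^] d \<in> Span K (map (\<lambda>e. e [^] d) Us)"
      using Span_subgroup_props(3)[OF K U'] Span_smult_closed[OF K U'] add(4) by blast
    then show ?case
      using additive_expsD(2)[OF d, of "k \<otimes> e" v] c by (simp add: nat_pow_distrib)
  }
qed

lemma Span_mult:
  assumes K: "subfield K R" and U: "set Us \<subseteq> carrier R" and V: "set Vs \<subseteq> carrier R"
    and W: "set Ws \<subseteq> carrier R"
    and prod: "\<And>u v. u \<in> set Us \<Longrightarrow> v \<in> set Vs \<Longrightarrow> u \<otimes> v \<in> Span K Ws"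
    and x: "x \<in> Span K Us" and y: "y \<in> Span K Vs"
  shows "x \<otimes> y \<in> Span K Ws"
proof -
  note KC = subfieldE(3)[OF K]
  note yC = Span_subgroup_props(1)[OF K V]
  have *: "u \<otimes> y \<in> Span K Ws" if u: "u \<in> set Us" for u
    using K V y
  proof (induction rule: Span_combination_induct)
    case zero then show ?case using u U Span_subgroup_props(2)[OF K W] by auto
  next
    case (add k e v)
    have c: "k \<in> carrier R" "e \<in> carrier R" "v \<in> carrier R" "u \<in> carrier R"
      using add KC U V u Span_subgroup_props(1)[OF K V] by auto
    have "k \<otimes> (u \<otimes> e) \<oplus> u \<otimes> v \<in> Span K Ws"
      using Span_subgroup_props(3)[OF K W] Span_smult_closed[OF K W] prod[OF u] add by blast
    then show ?case using c by (simp add: r_distr m_lcomm)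
  qed
  show ?thesis
    using K U x
  proof (induction rule: Span_combination_induct)
    case zero then show ?case using y yC Span_subgroup_props(2)[OF K W] by auto
  next
    case (add k e v)
    have c: "k \<in> carrier R" "e \<in> carrier R" "v \<in> carrier R" "y \<in> carrier R"
      using add KC U y yC Span_subgroup_props(1)[OF K U] by auto
    have "k \<otimes> (e \<otimes> y) \<oplus> v \<otimes> y \<in> Span K Ws"
      using Span_subgroup_props(3)[OF K W] Span_smult_closed[OF K W] * add by blast
    then show ?case using c by (simp add: l_distr m_assoc)
  qed
qed

lemma Span_dimension_le:
  assumes K: "subfield K R" and "set Us \<subseteq> carrier R"
  shows "\<exists>m\<le>length Us. dimension m K (Span K Us) \<and> (m = length Us \<longrightarrow> independent K Us)"
  using assms(2)
proof (induction Us)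
  case Nil then show ?case by (intro exI[of _ 0]) (auto simp: Span.simps)
next
  case (Cons u Us)
  then obtain m where m: "m \<le> length Us" "dimension m K (Span K Us)" "m = length Us \<longrightarrow> independent K Us"
    by auto
  have u: "u \<in> carrier R" and U: "set Us \<subseteq> carrier R" using Cons by auto
  show ?case
  proof (cases "u \<in> Span K Us")
    case True
    then have "Span K (u # Us) = Span K Us"
      using mono_Span_subset[OF K, of "u # Us" Us] mono_Span[OF K U u] Span_base_incl[OF K U] U
      by (intro equalityI) auto
    then show ?thesis using m by (intro exI[of _ m]) auto
  next
    case False
    have "dimension (Suc m) K (Span K (u # Us))"
      using Suc_dim[OF u False m(2)] by (simp add: Span.simps)
    moreover have "Suc m = length (u # Us) \<longrightarrow> independent K (u # Us)"
      using m(3) li_Cons[OF u False] by auto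
    ultimately show ?thesis using m(1) by (intro exI[of _ "Suc m"]) auto
  qed
qed

text \<open>MacLane's criterion: a finite extension \<open>M\<close> of \<open>K\<close> is separable if and only if \<open>M = K M\<^sup>p\<close>.
  Unlike the one by minimal polynomials, this definition of separability makes sums and products
  of separable elements obviously separable.\<close>

definition separable_span :: "'a set \<Rightarrow> 'a list \<Rightarrow> bool" where
  "separable_span K es \<longleftrightarrow> set es \<subseteq> carrier R \<and>
     (\<forall>d\<in>additive_exps. set es \<subseteq> Span K (map (\<lambda>e. e [^] d) es))"

definition separable_elems :: "'a set \<Rightarrow> 'a set" where
  "separable_elems K = {x. \<exists>es. separable_span K es \<and> x \<in> Span K es}"

lemma separable_elems_carrier:
  assumes "subfield K R" shows "separable_elems K \<subseteq> carrier R"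
  using Span_subgroup_props(1)[OF assms]
  unfolding separable_elems_def separable_span_def by blast

lemma separable_span_append:
  assumes K: "subfield K R" and "separable_span K es" "separable_span K fs"
  shows "separable_span K (es @ fs)"
  unfolding separable_span_def
proof (intro conjI ballI)
  show C: "set (es @ fs) \<subseteq> carrier R" using assms by (auto simp: separable_span_def)
  fix d assume d: "d \<in> additive_exps"
  have "set (map (\<lambda>e. e [^] d) es) \<subseteq> carrier R" "set (map (\<lambda>e. e [^] d) fs) \<subseteq> carrier R"
    using C by auto
  note sub = mono_Span_append(1)[OF K this] mono_Span_append(2)[OF K this(2,1)]
  have "set es \<subseteq> Span K (map (\<lambda>e. e [^] d) es)" "set fs \<subseteq> Span K (map (\<lambda>e. e [^] d) fs)"
    using assms(2,3) d unfolding separable_span_def by blast+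
  then show "set (es @ fs) \<subseteq> Span K (map (\<lambda>e. e [^] d) (es @ fs))"
    unfolding map_append set_append using sub by (meson Un_least order_trans)
qed

lemma separable_span_mult:
  assumes K: "subfield K R" and es: "separable_span K es" and fs: "separable_span K fs"
  shows "separable_span K (map (\<lambda>(e, f). e \<otimes> f) (List.product es fs))"
    (is "separable_span K ?p")
  unfolding separable_span_def
proof (intro conjI ballI)
  have C: "set es \<subseteq> carrier R" "set fs \<subseteq> carrier R"
    using assms by (auto simp: separable_span_def)
  then show Cp: "set ?p \<subseteq> carrier R" by auto
  fix d assume d: "d \<in> additive_exps"
  let ?q = "map (\<lambda>e. e [^] d) ?p"
  have Cq: "set ?q \<subseteq> carrier R" using Cp by auto
  have Cd: "set (map (\<lambda>e. e [^] d) es) \<subseteq> carrier R" "set (map (\<lambda>e. e [^] d) fs) \<subseteq> carrier R"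
    using C by auto
  have base: "u \<otimes> v \<in> Span K ?q"
    if uv: "u \<in> set (map (\<lambda>e. e [^] d) es)" "v \<in> set (map (\<lambda>e. e [^] d) fs)" for u v
  proof -
    obtain e f where ef: "e \<in> set es" "f \<in> set fs" "u = e [^] d" "v = f [^] d" using uv by auto
    then have "u \<otimes> v = (e \<otimes> f) [^] d" using C by (auto simp: nat_pow_distrib subset_iff)
    moreover have "(e \<otimes> f) [^] d \<in> set ?q" using ef by force
    ultimately have "u \<otimes> v \<in> set ?q" by (simp only:)
    then show ?thesis using Span_base_incl[OF K Cq] by blast
  qed
  show "set ?p \<subseteq> Span K ?q"
  proof
    fix x assume "x \<in> set ?p"
    then obtain e f where "e \<in> set es" "f \<in> set fs" "x = e \<otimes> f" by auto
    moreover from this have "e \<in> Span K (map (\<lambda>e. e [^] d) es)" "f \<in> Span K (map (\<lambda>e. e [^] d) fs)"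
      using es fs d unfolding separable_span_def by blast+
    ultimately show "x \<in> Span K ?q"
      using Span_mult[OF K Cd Cq base] by blast
  qed
qed

lemma separable_span_one: "subfield K R \<Longrightarrow> separable_span K [\<one>]"
  unfolding separable_span_def
  using Span_base_incl[of K "[\<one>]"] by auto

lemma base_separable:
  assumes K: "subfield K R" and a: "a \<in> K" shows "a \<in> separable_elems K"
proof -
  have "a \<in> Span K [\<one>]"
    using Span_smult_closed[OF K _ a, of "[\<one>]" "\<one>"] Span_base_incl[OF K, of "[\<one>]"]
      subfieldE(3)[OF K] a by auto
  then show ?thesis unfolding separable_elems_def using separable_span_one[OF K] by blast
qed

lemma separable_elems_subring:
  assumes K: "subfield K R"
  shows "subring (separable_elems K) R"
proof (rule subringI)
  show "separable_elems K \<subseteq> carrier R" by (rule separable_elems_carrier[OF K])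
  show "\<one> \<in> separable_elems K"
    using base_separable[OF K] subringE(3)[OF subfieldE(1)[OF K]] by blast
  show "\<ominus> x \<in> separable_elems K" if x: "x \<in> separable_elems K" for x
  proof -
    obtain es where es: "separable_span K es" "x \<in> Span K es"
      using x unfolding separable_elems_def by auto
    then have "set es \<subseteq> carrier R" by (simp add: separable_span_def)
    from Span_subgroup_props(4)[OF K this] show ?thesis
      unfolding separable_elems_def using es by blast
  qed
  fix x y assume "x \<in> separable_elems K" "y \<in> separable_elems K"
  then obtain es fs where es: "separable_span K es" "x \<in> Span K es" and fs: "separable_span K fs" "y \<in> Span K fs"
    unfolding separable_elems_def by auto
  have C: "set es \<subseteq> carrier R" "set fs \<subseteq> carrier R"
    using es fs by (auto simp: separable_span_def)
  have "x \<in> Span K (es @ fs)" "y \<in> Span K (es @ fs)"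
    using mono_Span_append(1)[OF K C] mono_Span_append(2)[OF K C(2,1)] es(2) fs(2) by blast+
  moreover have "set (es @ fs) \<subseteq> carrier R" using C by auto
  ultimately have "x \<oplus> y \<in> Span K (es @ fs)"
    using Span_subgroup_props(3)[OF K] by blast
  then show "x \<oplus> y \<in> separable_elems K"
    using separable_span_append[OF K es(1) fs(1)] unfolding separable_elems_def by blast
  let ?p = "map (\<lambda>(e, f). e \<otimes> f) (List.product es fs)"
  have Cp: "set ?p \<subseteq> carrier R" using C by auto
  have "x \<otimes> y \<in> Span K ?p"
  proof (rule Span_mult[OF K C Cp _ es(2) fs(2)])
    fix u v assume "u \<in> set es" "v \<in> set fs"
    then have "u \<otimes> v \<in> set ?p" by force
    then show "u \<otimes> v \<in> Span K ?p" using Span_base_incl[OF K Cp] by blast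
  qed
  then show "x \<otimes> y \<in> separable_elems K"
    using separable_span_mult[OF K es(1) fs(1)] unfolding separable_elems_def by blast
qed

lemma separable_elems_mono:
  assumes K: "subfield K R" and F: "subfield F R" and "K \<subseteq> F"
  shows "separable_elems K \<subseteq> separable_elems F"
proof
  fix x assume "x \<in> separable_elems K"
  then obtain es where es: "separable_span K es" "x \<in> Span K es"
    unfolding separable_elems_def by auto
  then have C: "set es \<subseteq> carrier R" by (simp add: separable_span_def)
  have "separable_span F es"
    unfolding separable_span_def
  proof (intro conjI ballI C)
    fix d assume "d \<in> additive_exps"
    then have "set es \<subseteq> Span K (map (\<lambda>e. e [^] d) es)" using es(1) by (simp add: separable_span_def)
    moreover have "set (map (\<lambda>e. e [^] d) es) \<subseteq> carrier R" using C by auto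
    ultimately show "set es \<subseteq> Span F (map (\<lambda>e. e [^] d) es)"
      using Span_superset_field[OF K F assms(3)] by blast
  qed
  then show "x \<in> separable_elems F"
    unfolding separable_elems_def using Span_superset_field[OF K F assms(3) C] es(2) by blast
qed

lemma Span_aut:
  assumes K: "subfield K R" and s: "s \<in> field_auts R K" and U: "set Us \<subseteq> carrier R"
    and x: "x \<in> Span K Us"
  shows "s x \<in> Span K (map s Us)"
  using K U x
proof (induction rule: Span_combination_induct)
  have U': "set (map s Us) \<subseteq> carrier R" using U aut_closed[OF s] by auto
  {
    case zero then show ?case using Span_subgroup_props(2)[OF K U'] s by simp
  next
    case (add k e v)
    have c: "k \<in> carrier R" "e \<in> carrier R" "v \<in> carrier R"
      using add subfieldE(3)[OF K] U Span_subgroup_props(1)[OF K U] by auto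
    have "s e \<in> Span K (map s Us)"
      using Span_base_incl[OF K U'] add(2) by auto
    then have "k \<otimes> s e \<oplus> s v \<in> Span K (map s Us)"
      using Span_subgroup_props(3)[OF K U'] Span_smult_closed[OF K U'] add by blast
    then show ?case using c s aut_fix[OF s add(1)] by simp
  }
qed

lemma separable_elems_aut:
  assumes K: "subfield K R" and s: "s \<in> field_auts R K" and "x \<in> separable_elems K"
  shows "s x \<in> separable_elems K"
proof -
  obtain es where es: "separable_span K es" "x \<in> Span K es"
    using assms(3) unfolding separable_elems_def by auto
  then have C: "set es \<subseteq> carrier R" by (simp add: separable_span_def)
  have "separable_span K (map s es)"
    unfolding separable_span_def
  proof (intro conjI ballI)
    show "set (map s es) \<subseteq> carrier R" using C aut_closed[OF s] by auto
    fix d assume d: "d \<in> additive_exps"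
    have C': "set (map (\<lambda>e. e [^] d) es) \<subseteq> carrier R" using C by auto
    have eq: "map s (map (\<lambda>e. e [^] d) es) = map (\<lambda>e. e [^] d) (map s es)"
      using C s by (auto simp: subset_iff)
    show "set (map s es) \<subseteq> Span K (map (\<lambda>e. e [^] d) (map s es))"
    proof
      fix y assume "y \<in> set (map s es)"
      then obtain e where e: "e \<in> set es" "y = s e" by auto
      then have "e \<in> Span K (map (\<lambda>e. e [^] d) es)" using es(1) d unfolding separable_span_def by blast
      from Span_aut[OF K s C' this] show "y \<in> Span K (map (\<lambda>e. e [^] d) (map s es))"
        unfolding eq e(2) .
    qed
  qed
  then show ?thesis
    unfolding separable_elems_def using Span_aut[OF K s C es(2)] by blast
qed

end

section \<open>Separable elements fixed by all automorphisms\<close>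

context field
begin

lemma root_coeff_replicate:
  assumes x: "x \<in> carrier R"
  shows "root_coeff (replicate d x) i = add_pow R (d choose i) ((\<ominus> x) [^] (d - i))"
proof (induction d arbitrary: i)
  case 0
  then show ?case by (cases i) auto
next
  case (Suc d)
  show ?case
  proof (cases i)
    case 0
    then show ?thesis using Suc[of 0] x by (simp add: l_minus m_comm)
  next
    case (Suc j)
    show ?thesis
    proof (cases "j < d")
      case True
      have "\<ominus> (x \<otimes> (add_pow R (d choose Suc j) ((\<ominus> x) [^] (d - Suc j)))) =
          \<ominus> x \<otimes> (add_pow R (d choose Suc j) ((\<ominus> x) [^] (d - Suc j)))"
        using x by (simp add: l_minus)
      also have "\<dots> = add_pow R (d choose Suc j) ((\<ominus> x) \<otimes> (\<ominus> x) [^] (d - Suc j))"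
        using x by (intro add_pow_rdistr) auto
      also have "(\<ominus> x) \<otimes> (\<ominus> x) [^] (d - Suc j) = (\<ominus> x) [^] (d - j)"
        using x True Suc_diff_Suc[OF True] by (metis a_inv_closed m_comm nat_pow_Suc nat_pow_closed)
      finally show ?thesis
        using Suc.IH[of j] Suc.IH[of "Suc j"] x Suc by (simp add: add.nat_pow_mult)
    next
      case False
      then show ?thesis
        using Suc.IH[of j] Suc.IH[of "Suc j"] x Suc by (simp add: binomial_eq_0)
    qed
  qed
qed

lemma foldr_replicate_pow:
  assumes "x \<in> carrier R" "y \<in> carrier R"
  shows "foldr (\<lambda>y a. (x \<ominus> y) \<otimes> a) (replicate d y) \<one> = (x \<ominus> y) [^] d"
  using assms by (induction d) (auto simp: m_comm)

lemma pow_minus_in_subfield: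
  assumes K: "subfield K R" and x: "x \<in> carrier R" and "(\<ominus> x) [^] (n::nat) \<in> K"
  shows "x [^] n \<in> K"
proof -
  note sr = subringE[OF subfieldE(1)[OF K]]
  have "(\<ominus> \<one>) [^] n \<in> K" by (induction n) (simp_all add: sr(3,5,6))
  moreover have "x [^] n = (\<ominus> \<one>) [^] n \<otimes> (\<ominus> x) [^] n"
    using x by (simp add: nat_pow_distrib[symmetric] l_minus)
  ultimately show ?thesis using sr(6) assms(3) by simp
qed

text \<open>The binomial theorem, obtained from \<open>root_coeff_eval\<close> for \<open>d\<close>
  copies of \<open>- b\<close>; only the two end terms survive.\<close>

lemma additive_expI:
  assumes "1 \<le> d" and vanish: "\<And>i. 0 < i \<Longrightarrow> i < d \<Longrightarrow> add_pow R (d choose i) \<one> = \<zero>"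
  shows "d \<in> additive_exps"
  unfolding additive_exps_def
proof (intro CollectI conjI ballI assms(1))
  fix a b assume ab: "a \<in> carrier R" "b \<in> carrier R"
  obtain e where e: "d = Suc e" using assms(1) by (cases d) auto
  have rep: "set (replicate d (\<ominus> b)) \<subseteq> carrier R" using ab by auto
  have c: "root_coeff (replicate d (\<ominus> b)) i = add_pow R (d choose i) (b [^] (d - i))" for i
    using root_coeff_replicate[of "\<ominus> b" d i] ab by simp
  have v: "add_pow R (d choose i) (b [^] (d - i)) = \<zero>" if "0 < i" "i < d" for i
    using vanish[OF that] ab add_pow_ldistr[of \<one> "b [^] (d - i)" "d choose i"] by simp
  have "(a \<oplus> b) [^] d = (a \<ominus> \<ominus> b) [^] d" using ab by (simp add: a_minus_def)
  also have "\<dots> = (\<Oplus>i\<in>{..d}. add_pow R (d choose i) (b [^] (d - i)) \<otimes> a [^] i)"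
    using root_coeff_eval[OF rep ab(1)]
    unfolding foldr_replicate_pow[OF ab(1) a_inv_closed[OF ab(2)]] c length_replicate by (rule sym)
  also have "\<dots> = (\<Oplus>i\<in>{..d}. if i = 0 then b [^] d else if i = d then a [^] d else \<zero>)"
    using ab v by (intro finsum_cong') auto
  also have "\<dots> = a [^] d \<oplus> (\<Oplus>i\<in>{..e}. if i = 0 then b [^] d else if i = d then a [^] d else \<zero>)"
    using ab unfolding e by (subst finsum_Suc) auto
  also have "(\<Oplus>i\<in>{..e}. if i = 0 then b [^] d else if i = d then a [^] d else \<zero>) =
      (\<Oplus>i\<in>{..e}. if 0 = i then b [^] d else \<zero>)"
    using ab e by (intro finsum_cong') auto
  also have "\<dots> = b [^] d"
    using finsum_singleton[of 0 "{..e}" "\<lambda>_. b [^] d"] ab by simp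
  finally show "(a \<oplus> b) [^] d = a [^] d \<oplus> b [^] d" .
qed

end

context closed_extension
begin

lemma Irr_degree_le:
  assumes x: "x \<in> carrier R" and "0 < j" and a: "x [^] (j::nat) \<in> K"
  shows "degree (Irr K x) \<le> j"
proof -
  note sr = subringE[OF subfieldE(1)[OF K_subfield]]
  \<comment> \<open>\<open>monom \<one> (j - 1)\<close> has \<open>j\<close> entries, so appending a
    constant term raises its degree to \<open>j\<close>; the result is
    \<open>X^j - x^j\<close>.\<close>
  define p where "p = monom \<one> (j - 1) @ [\<ominus> (x [^] j)]"
  have setp: "set p \<subseteq> K"
    using sr(2,3) sr(5)[OF a] unfolding p_def monom_def by auto
  then have p: "p \<in> carrier (K[X])"
    unfolding univ_poly_carrier[symmetric] polynomial_def p_def monom_def by auto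
  have "eval p x = eval (monom \<one> (j - 1)) x \<otimes> x [^] length [\<ominus> (x [^] j)] \<oplus> eval [\<ominus> (x [^] j)] x"
    unfolding p_def by (rule eval_append) (use x in \<open>auto simp: monom_def\<close>)
  also have "eval (monom \<one> (j - 1)) x = \<one> \<otimes> x [^] (j - 1)"
    by (rule eval_monom) (use x in auto)
  also have "\<one> \<otimes> x [^] (j - 1) \<otimes> x [^] length [\<ominus> (x [^] j)] \<oplus> eval [\<ominus> (x [^] j)] x =
      x [^] (j - 1) \<otimes> x \<oplus> \<ominus> (x [^] j)"
    using x by simp
  also have "x [^] (j - 1) \<otimes> x = x [^] j" using assms(2) by (cases j) auto
  finally have "eval p x = \<zero>" using x by (simp add: r_neg)
  then have "Irr K x pdivides p"
    using Irr_minimal[OF K_subfield x algebraic_extension[OF x] p] by simp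
  moreover have "degree p = j" using assms(2) by (simp add: p_def monom_def)
  moreover have "p \<noteq> []" by (simp add: p_def)
  ultimately show ?thesis
    using pdivides_imp_degree_le[OF subfieldE(1)[OF K_subfield]
        IrrE(1)[OF K_subfield x algebraic_extension[OF x]] p] by simp
qed

text \<open>All conjugates equal \<open>x\<close>, so the minimal polynomial is
  \<open>(X - x)^d\<close>, and its constant term gives the power in \<open>K\<close>. If a binomial
  coefficient \<open>d choose i\<close> with \<open>0 < i < d\<close> were nonzero in the field, the
  coefficient of \<open>X^i\<close> would put \<open>x^(d - i)\<close> into \<open>K\<close>,
  against the minimality of the degree \<open>d\<close>. Thus all inner binomial coefficients vanish
  and \<open>d\<close> is additive.\<close>

lemma fixed_imp_pow_in_base:
  assumes x: "x \<in> carrier R" and fixed: "\<forall>s\<in>field_auts R K. s x = x"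
  shows "\<exists>d\<in>additive_exps. x [^] d \<in> K"
proof -
  obtain ys where ys: "set ys \<subseteq> carrier R" "length ys = degree (Irr K x)" "x \<in> set ys"
    "\<forall>i. root_coeff ys i \<in> K" "\<forall>y\<in>set ys. \<exists>s\<in>field_auts R K. s x = y"
    using Irr_roots[OF x] by blast
  define d where "d = length ys"
  have "\<forall>y\<in>set ys. y = x" using ys(5) fixed by auto
  then have yd: "ys = replicate d x"
    unfolding d_def by (simp add: replicate_length_same)
  have d1: "1 \<le> d" using ys(3) by (cases ys) (auto simp: d_def)
  note sr = subringE[OF subfieldE(1)[OF K_subfield]]
  have rc: "add_pow R (d choose i) ((\<ominus> x) [^] (d - i)) \<in> K" for i
  proof -
    have "root_coeff ys i = add_pow R (d choose i) ((\<ominus> x) [^] (d - i))"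
      by (subst yd) (rule root_coeff_replicate[OF x])
    then show ?thesis using ys(4) by metis
  qed
  have "add_pow R (d choose i) \<one> = \<zero>" if i: "0 < i" "i < d" for i
  proof (rule ccontr)
    define c where "c = add_pow R (d choose i) \<one>"
    assume "add_pow R (d choose i) \<one> \<noteq> \<zero>"
    then have c0: "c \<noteq> \<zero>" by (simp add: c_def)
    have "add_pow R (n) \<one> \<in> K" for n :: nat
      by (induction n) (simp_all add: sr(2,3,7))
    then have cK: "c \<in> K" by (simp add: c_def)
    have cC: "c \<in> carrier R" using cK base_in_carrier by auto
    have pc: "(\<ominus> x) [^] (d - i) \<in> carrier R" using x by simp
    have "c \<otimes> (\<ominus> x) [^] (d - i) \<in> K"
      using rc[of i] add_pow_ldistr[of \<one> "(\<ominus> x) [^] (d - i)" "d choose i"] x by (simp add: c_def)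
    then have "inv c \<otimes> (c \<otimes> (\<ominus> x) [^] (d - i)) \<in> K"
      using sr(6) subfield_m_inv(1)[OF K_subfield, of c] cK c0 by auto
    then have "(\<ominus> x) [^] (d - i) \<in> K"
      using cC c0 pc l_inv_nonzero inv_closed_nonzero by (simp add: m_assoc[symmetric])
    then have "x [^] (d - i) \<in> K" by (rule pow_minus_in_subfield[OF K_subfield x])
    then have "d \<le> d - i" using Irr_degree_le[OF x, of "d - i"] i ys(2) by (simp add: d_def)
    then show False using i by simp
  qed
  then have "d \<in> additive_exps" using additive_expI[OF d1] by blast
  moreover have "x [^] d \<in> K"
    using pow_minus_in_subfield[OF K_subfield x] rc[of 0] x by simp
  ultimately show ?thesis by blast
qed

text \<open>Let \<open>x^d\<close> be in \<open>K\<close> with \<open>d\<close> additive, and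
  complete 1 to a basis of a finite-dimensional space as in MacLane's criterion. The
  \<open>d\<close>-th powers of the basis span at least that space and are therefore independent.
  For \<open>x = v + k\<close> with \<open>k\<close> in \<open>K\<close> and \<open>v\<close> in the
  span of the other basis elements, \<open>v^d = x^d - k^d\<close> lies both in \<open>K\<close> and
  in the span of the other powers; so it is zero, and \<open>x = k\<close>.\<close>

lemma separable_fixed_in_base:
  assumes x: "x \<in> separable_elems K" and fixed: "\<forall>s\<in>field_auts R K. s x = x"
  shows "x \<in> K"
proof -
  note K = K_subfield
  note sr = subringE[OF subfieldE(1)[OF K]]
  have xC: "x \<in> carrier R" using x separable_elems_carrier[OF K] by blast
  obtain d where d: "d \<in> additive_exps" "x [^] d \<in> K"
    using fixed_imp_pow_in_base[OF xC fixed] by blast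
  obtain es0 where es0: "separable_span K es0" "x \<in> Span K es0"
    using x unfolding separable_elems_def by auto
  \<comment> \<open>Adjoining 1 to the list keeps it separable and makes 1 available as a basis
    element.\<close>
  define es where "es = [\<one>] @ es0"
  have es: "separable_span K es"
    unfolding es_def by (rule separable_span_append[OF K separable_span_one[OF K] es0(1)])
  then have C: "set es \<subseteq> carrier R" by (simp add: separable_span_def)
  have xes: "x \<in> Span K es"
    using mono_Span_append(2)[OF K, of es0 "[\<one>]"] es0 unfolding es_def separable_span_def by auto
  obtain n where n: "dimension n K (Span K es)"
    using Span_dimension_le[OF K C] by blast
  have one: "\<one> \<in> Span K es" using Span_base_incl[OF K C] by (auto simp: es_def)
  have "independent K [\<one>]"
    by (rule li_Cons) (auto simp: Span.simps)
  from complete_base[OF K n this] one obtain Vs where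
    Vs: "length (Vs @ [\<one>]) = n" "independent K (Vs @ [\<one>])" "Span K (Vs @ [\<one>]) = Span K es"
    by auto
  let ?p = "map (\<lambda>e. e [^] d)"
  have VC: "set (Vs @ [\<one>]) \<subseteq> carrier R" using independent_in_carrier[OF Vs(2)] .
  have pVC: "set (?p (Vs @ [\<one>])) \<subseteq> carrier R" using VC by auto
  have "set (?p es) \<subseteq> Span K (?p (Vs @ [\<one>]))"
  proof
    fix y assume "y \<in> set (?p es)"
    then obtain e where e: "e \<in> set es" "y = e [^] d" by auto
    then have "e \<in> Span K (Vs @ [\<one>])" using Span_base_incl[OF K C] Vs(3) by blast
    from Span_pow[OF K VC d(1) this] show "y \<in> Span K (?p (Vs @ [\<one>]))" using e by simp
  qed
  then have "Span K (?p es) \<subseteq> Span K (?p (Vs @ [\<one>]))"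
    using mono_Span_subset[OF K _ pVC] by blast
  moreover have "set es \<subseteq> Span K (?p es)" using es d(1) by (auto simp: separable_span_def)
  ultimately have sub: "set es \<subseteq> Span K (?p (Vs @ [\<one>]))" by blast
  have sub2: "Span K es \<subseteq> Span K (?p (Vs @ [\<one>]))"
    using mono_Span_subset[OF K sub pVC] .
  obtain m where m: "m \<le> length (?p (Vs @ [\<one>]))" "dimension m K (Span K (?p (Vs @ [\<one>])))"
    "m = length (?p (Vs @ [\<one>])) \<longrightarrow> independent K (?p (Vs @ [\<one>]))"
    using Span_dimension_le[OF K pVC] by blast
  have "set (Vs @ [\<one>]) \<subseteq> Span K es" using Span_base_incl[OF K VC] Vs(3) by blast
  then have "length (Vs @ [\<one>]) \<le> m"
    using independent_length_le_dimension[OF K m(2) Vs(2)] sub2 by blast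
  then have ind: "independent K (?p Vs @ [\<one>])" using m(1,3) by auto
  have V1: "set Vs \<subseteq> carrier R" "set [\<one>] \<subseteq> carrier R" using VC by auto
  have "x \<in> Span K Vs <+> Span K [\<one>]"
    using xes Span_append_eq_set_add[OF K V1] Vs(3) by simp
  then obtain v k' where v: "v \<in> Span K Vs" and k': "k' \<in> Span K [\<one>]" "x = v \<oplus> k'"
    by (auto simp: set_add_def')
  obtain k where k: "k \<in> K" "k' = k"
    using k' base_in_carrier by (auto simp: Span.simps line_extension_mem_iff)
  have cC: "v \<in> carrier R" "k \<in> carrier R"
    using Span_subgroup_props(1)[OF K V1(1)] v k base_in_carrier by auto
  have "v [^] d = x [^] d \<oplus> \<ominus> (k [^] d)"
    using additive_expsD(2)[OF d(1) cC] k k' cC by (simp add: a_assoc r_neg)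
  moreover have "k [^] d \<in> K" using k(1) by (induction d) (simp_all add: sr(3,6))
  ultimately have vd: "v [^] d \<in> K" using sr(5,7) d(2) by simp
  then have "v [^] d \<in> Span K [\<one>]"
    using Span_smult_closed[OF K, of "[\<one>]" "v [^] d" \<one>] Span_base_incl[OF K, of "[\<one>]"] cC by auto
  moreover have "v [^] d \<in> Span K (?p Vs)"
    using Span_pow[OF K V1(1) d(1) v] .
  ultimately have "v [^] d = \<zero>"
    using independent_split(3)[OF K ind] by auto
  then have "v = \<zero>" using pow_zero_iff[OF cC(1)] additive_expsD(1)[OF d(1)] by blast
  then show ?thesis using k k' cC by simp
qed

text \<open>Only inverses are missing, and the inverse of an algebraic element is a polynomial in
  it.\<close>

lemma separable_elems_subfield: "subfield (separable_elems K) R"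
proof (rule subfieldI'[OF separable_elems_subring[OF K_subfield]])
  fix x assume x: "x \<in> separable_elems K - {\<zero>}"
  then have xC: "x \<in> carrier R" using separable_elems_carrier[OF K_subfield] by auto
  have "simple_extension K x \<subseteq> separable_elems K"
    using simple_extension_subring_incl[OF separable_elems_subring[OF K_subfield]]
      base_separable[OF K_subfield] x by blast
  moreover have "inv x \<in> simple_extension K x"
    using subfield_m_inv(1)[of "simple_extension K x" x]
      simple_extension_is_subfield[OF K_subfield xC] algebraic_extension[OF xC]
      simple_extension_mem[OF subfieldE(1)[OF K_subfield] xC] x by auto
  ultimately show "inv x \<in> separable_elems K" by blast
qed

text \<open>Choose \<open>q\<close> such that \<open>v = w^q\<close> has least degree over
  \<open>K\<close> among the additive powers of \<open>w\<close>. For additive \<open>d\<close>, the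
  field generated by \<open>v^d\<close> is contained in that of \<open>v\<close> and has no smaller
  degree. The two coincide, so the \<open>d\<close>-th powers of the power basis of \<open>v\<close>
  span the same space.\<close>

lemma exists_separable_power:
  assumes w: "w \<in> carrier R"
  shows "\<exists>q\<in>additive_exps. w [^] q \<in> separable_elems K"
proof -
  note K = K_subfield
  define deg where "deg x = degree (Irr K x)" for x
  obtain q where q: "q \<in> additive_exps" "\<forall>d\<in>additive_exps. deg (w [^] q) \<le> deg (w [^] d)"
    using arg_min_nat_lemma[of "\<lambda>d. d \<in> additive_exps" 1 "\<lambda>d. deg (w [^] d)"] additive_exps_one by blast
  define v where "v = w [^] q"
  define n where "n = deg v"
  have v: "v \<in> carrier R" using w by (simp add: v_def)
  let ?es = "exp_base v n"
  have C: "set ?es \<subseteq> carrier R" using exp_base_closed[OF v] .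
  have sp: "Span K ?es = simple_extension K v"
    using Span_exp_base[OF K v algebraic_extension[OF v]] by (simp add: n_def deg_def)
  have dimv: "dimension n K (simple_extension K v)"
    using dimension_simple_extension[OF K v algebraic_extension[OF v]] by (simp add: n_def deg_def)
  have "set ?es \<subseteq> Span K (map (\<lambda>e. e [^] d) ?es)" if d: "d \<in> additive_exps" for d
  proof -
    define y where "y = v [^] d"
    have y: "y \<in> carrier R" using v by (simp add: y_def)
    have "n \<le> deg y"
      using q(2) additive_exps_mult[OF q(1) d] w by (simp add: n_def v_def y_def nat_pow_pow)
    have "y \<in> simple_extension K v"
      using simple_extension_is_subring[OF subfieldE(1)[OF K] v] simple_extension_mem[OF subfieldE(1)[OF K] v]
      unfolding y_def by (induction d) (auto simp: subringE)
    then have incl: "simple_extension K y \<subseteq> simple_extension K v"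
      using simple_extension_subring_incl[OF simple_extension_is_subring[OF subfieldE(1)[OF K] v]]
        simple_extension_incl[OF base_in_carrier v] by blast
    have ind: "independent K (exp_base y (deg y))"
      using exp_base_independent[OF K y algebraic_extension[OF y]] by (simp add: deg_def)
    have spy: "Span K (exp_base y (deg y)) = simple_extension K y"
      using Span_exp_base[OF K y algebraic_extension[OF y]] by (simp add: deg_def)
    have sub: "set (exp_base y (deg y)) \<subseteq> simple_extension K v"
      using Span_base_incl[OF K exp_base_closed[OF y]] spy incl by blast
    have "length (exp_base y (deg y)) \<le> n"
      using independent_length_le_dimension[OF K dimv ind sub] .
    then have "deg y = n" using \<open>n \<le> deg y\<close> by (simp add: exp_base_def)
    then have "Span K (exp_base y n) = simple_extension K v"
      using independent_length_eq_dimension[OF K dimv ind sub] by (simp add: exp_base_def)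
    moreover have "map (\<lambda>e. e [^] d) ?es = exp_base y n"
      using v by (simp add: exp_base_def y_def nat_pow_pow mult.commute)
    ultimately show ?thesis using sp Span_base_incl[OF K C] by simp
  qed
  then have "separable_span K ?es" using C by (simp add: separable_span_def)
  moreover have "v \<in> Span K ?es" unfolding sp using simple_extension_mem[OF subfieldE(1)[OF K] v] .
  ultimately show ?thesis using q(1) unfolding separable_elems_def v_def by blast
qed

end


section \<open>Conjugate valuations\<close>

primrec nmul :: "nat \<Rightarrow> 'v::ordered_ab_group_add \<Rightarrow> 'v" where
  "nmul 0 g = 0"
| "nmul (Suc n) g = g + nmul n g"

lemma nmul_plus: "nmul (m + n) g = nmul m g + nmul n g"
  by (induction m) (auto simp: algebra_simps)

lemma nmul_strict_mono:
  fixes g :: "'v::linordered_ab_group_add"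
  assumes "g < h" "0 < n" shows "nmul n g < nmul n h"
proof -
  have "nmul n g \<le> nmul n h" for n
    by (induction n) (simp_all add: add_mono order_less_imp_le[OF assms(1)])
  then have "nmul (Suc n) g < nmul (Suc n) h" for n
    using add_less_le_mono[OF assms(1)] by simp
  then show ?thesis using assms(2) by (cases n) auto
qed

lemma nmul_eq_iff:
  fixes g :: "'v::linordered_ab_group_add"
  assumes "0 < n" shows "nmul n g = nmul n h \<longleftrightarrow> g = h"
  using nmul_strict_mono[of g h n] nmul_strict_mono[of h g n] assms by (metis less_irrefl not_less_iff_gr_or_eq)

lemma nmul_zero [simp]: "nmul n 0 = 0"
  by (induction n) auto

lemma nmul_pos:
  fixes g :: "'v::linordered_ab_group_add"
  assumes "0 < g" "0 < n" shows "0 < nmul n g"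
  using nmul_strict_mono[OF assms] by simp

lemma nmul_inj_nat:
  fixes g :: "'v::linordered_ab_group_add"
  assumes "nmul m g = nmul n g" "g \<noteq> 0" shows "m = n"
proof -
  have False if mn: "m < n" "nmul m g = nmul n g" for m n
  proof -
    obtain k where k: "n = m + k" "0 < k" using less_imp_add_positive[OF mn(1)] by metis
    then have "nmul k g = nmul k 0" using mn(2) by (simp add: nmul_plus)
    then show False using nmul_eq_iff[OF k(2)] assms(2) by blast
  qed
  then show ?thesis using assms(1) by (metis linorder_neqE_nat)
qed

section \<open>Valuations and Newton polygons\<close>

locale valued_field = field R for R (structure) +
  fixes u :: "'a \<Rightarrow> 'v::linordered_ab_group_add"
  assumes valuation: "valuation_on R (carrier R) u"
begin

lemma u_mult:
  "x \<in> carrier R \<Longrightarrow> y \<in> carrier R \<Longrightarrow> x \<noteq> \<zero> \<Longrightarrow> y \<noteq> \<zero> \<Longrightarrow> u (x \<otimes> y) = u x + u y"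
  using valuation by (simp add: valuation_on_def)

lemma u_add:
  "x \<in> carrier R \<Longrightarrow> y \<in> carrier R \<Longrightarrow> x \<noteq> \<zero> \<Longrightarrow> y \<noteq> \<zero> \<Longrightarrow> x \<oplus> y \<noteq> \<zero> \<Longrightarrow>
    min (u x) (u y) \<le> u (x \<oplus> y)"
  using valuation unfolding valuation_on_def by blast

lemma u_one: "u \<one> = 0"
  using u_mult[of \<one> \<one>] by simp

lemma u_pow: "x \<in> carrier R \<Longrightarrow> x \<noteq> \<zero> \<Longrightarrow> u (x [^] n) = nmul n (u x)"
  by (induction n) (simp_all add: u_one u_mult pow_nonzero add.commute)

lemma u_minus:
  assumes "x \<in> carrier R" "x \<noteq> \<zero>" shows "u (\<ominus> x) = u x"
proof -
  have m: "\<ominus> \<one> \<noteq> \<zero>" by (metis minus_minus minus_zero one_closed zero_not_one)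
  have "u (\<ominus> \<one>) + u (\<ominus> \<one>) = 0"
    using u_mult[of "\<ominus> \<one>" "\<ominus> \<one>"] m u_one by (simp add: l_minus)
  then have "u (\<ominus> \<one>) = 0" by simp
  then show ?thesis
    using u_mult[of "\<ominus> \<one>" x] assms m by (simp add: l_minus)
qed

lemma u_inv: "x \<in> carrier R \<Longrightarrow> x \<noteq> \<zero> \<Longrightarrow> u (inv x) = - u x"
  using u_mult[of x "inv x"] inv_closed_nonzero[of x] inv_nonzero[of x] r_inv_nonzero[of x] u_one
  by (simp add: eq_neg_iff_add_eq_0 add.commute)

text \<open>With \<open>vgt\<close>, the closed and open balls around zero. Zero is added by hand
  because its value is unspecified.\<close>

definition vge :: "'v \<Rightarrow> 'a set" where
  "vge g = {x \<in> carrier R. x = \<zero> \<or> g \<le> u x}"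

definition vgt :: "'v \<Rightarrow> 'a set" where
  "vgt g = {x \<in> carrier R. x = \<zero> \<or> g < u x}"

lemma vgt_subset_vge: "vgt g \<subseteq> vge g"
  by (auto simp: vge_def vgt_def)

lemma vge_carrier: "vge g \<subseteq> carrier R" and vgt_carrier: "vgt g \<subseteq> carrier R"
  by (auto simp: vge_def vgt_def)

lemma vge_vgt: "g < h \<Longrightarrow> vge h \<subseteq> vgt g"
  by (auto simp: vge_def vgt_def)

lemma zero_vge: "\<zero> \<in> vge g" and zero_vgt: "\<zero> \<in> vgt g"
  by (auto simp: vge_def vgt_def)

lemma vge_add: "x \<in> vge g \<Longrightarrow> y \<in> vge g \<Longrightarrow> x \<oplus> y \<in> vge g"
  unfolding vge_def using u_add[of x y]
  by (cases "x = \<zero>"; cases "y = \<zero>"; cases "x \<oplus> y = \<zero>") (auto simp: min_le_iff_disj)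

lemma vgt_add: "x \<in> vgt g \<Longrightarrow> y \<in> vgt g \<Longrightarrow> x \<oplus> y \<in> vgt g"
  unfolding vgt_def using u_add[of x y]
  by (cases "x = \<zero>"; cases "y = \<zero>"; cases "x \<oplus> y = \<zero>") (auto simp: min_le_iff_disj)

lemma vge_minus: "x \<in> vge g \<Longrightarrow> \<ominus> x \<in> vge g" and vgt_minus: "x \<in> vgt g \<Longrightarrow> \<ominus> x \<in> vgt g"
  unfolding vge_def vgt_def using u_minus[of x] by (cases "x = \<zero>"; simp)+

lemma vge_mult: "x \<in> vge g \<Longrightarrow> y \<in> vge h \<Longrightarrow> x \<otimes> y \<in> vge (g + h)"
  unfolding vge_def using u_mult[of x y]
  by (cases "x = \<zero>"; cases "y = \<zero>") (auto simp: add_mono)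

lemma vgt_mult: "x \<in> vgt g \<Longrightarrow> y \<in> vge h \<Longrightarrow> x \<otimes> y \<in> vgt (g + h)"
  unfolding vge_def vgt_def using u_mult[of x y]
  by (cases "x = \<zero>"; cases "y = \<zero>") (auto simp: add_less_le_mono)

lemma vge_finsum:
  "(\<And>i. i \<in> A \<Longrightarrow> f i \<in> vge g) \<Longrightarrow> finsum R f A \<in> vge g"
proof (induction A rule: infinite_finite_induct)
  case (insert a A)
  then have "f \<in> A \<rightarrow> carrier R" "f a \<in> carrier R" using vge_carrier by auto
  then show ?case using insert by (simp add: vge_add)
qed (simp_all add: zero_vge finsum_infinite)

lemma vgt_finsum:
  "(\<And>i. i \<in> A \<Longrightarrow> f i \<in> vgt g) \<Longrightarrow> finsum R f A \<in> vgt g"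
proof (induction A rule: infinite_finite_induct)
  case (insert a A)
  then have "f \<in> A \<rightarrow> carrier R" "f a \<in> carrier R" using vgt_carrier by auto
  then show ?case using insert by (simp add: vgt_add)
qed (simp_all add: zero_vgt finsum_infinite)

lemma u_add_strict:
  assumes x: "x \<in> carrier R" "x \<noteq> \<zero>" and y: "y \<in> vgt (u x)"
  shows "x \<oplus> y \<noteq> \<zero>" "u (x \<oplus> y) = u x"
proof -
  have yC: "y \<in> carrier R" using y vgt_carrier by auto
  have eq: "x = (x \<oplus> y) \<oplus> \<ominus> y" using x yC by (simp add: a_assoc r_neg)
  show nz: "x \<oplus> y \<noteq> \<zero>"
  proof
    assume "x \<oplus> y = \<zero>"
    then have "x = \<ominus> y" using eq yC by simp
    then have "x \<in> vgt (u x)" using vgt_minus[OF y] by simp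
    then show False using x by (simp add: vgt_def)
  qed
  have "x \<oplus> y \<in> vge (u x)"
    using vge_add[of x "u x" y] x y vgt_subset_vge[of "u x"] by (auto simp: vge_def)
  then have "u x \<le> u (x \<oplus> y)" using nz by (simp add: vge_def)
  moreover have "\<not> u x < u (x \<oplus> y)"
  proof
    assume "u x < u (x \<oplus> y)"
    then have "x \<oplus> y \<in> vgt (u x)" using x yC by (simp add: vgt_def)
    then have "(x \<oplus> y) \<oplus> \<ominus> y \<in> vgt (u x)" using vgt_add vgt_minus[OF y] by blast
    then show False using eq x by (simp add: vgt_def)
  qed
  ultimately show "u (x \<oplus> y) = u x" by simp
qed

lemma finsum_unique_min:
  assumes A: "finite A" "k \<in> A" and k: "f k \<in> carrier R" "f k \<noteq> \<zero>"
    and rest: "\<And>i. i \<in> A \<Longrightarrow> i \<noteq> k \<Longrightarrow> f i \<in> vgt (u (f k))"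
  shows "finsum R f A \<noteq> \<zero>" "u (finsum R f A) = u (f k)"
proof -
  have "f \<in> (A - {k}) \<rightarrow> carrier R" using rest vgt_carrier by blast
  then have eq: "finsum R f A = f k \<oplus> finsum R f (A - {k})"
    using finsum_insert[of "A - {k}" k f] A k by (simp add: insert_absorb)
  have "finsum R f (A - {k}) \<in> vgt (u (f k))"
    by (rule vgt_finsum) (use rest in auto)
  from u_add_strict[OF k this] show "finsum R f A \<noteq> \<zero>" "u (finsum R f A) = u (f k)"
    unfolding eq .
qed

text \<open>The Newton polygon of \<open>\<Prod>(X - y)\<close> has no side of slope \<open>g\<close>.\<close>

lemma root_coeff_unique_min:
  assumes "set ys \<subseteq> carrier R - {\<zero>}" "\<forall>y\<in>set ys. u y \<noteq> g"
  shows "\<exists>k\<le>length ys. root_coeff ys k \<noteq> \<zero> \<and>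
    (\<forall>i. i \<noteq> k \<longrightarrow> root_coeff ys i \<in> vgt (u (root_coeff ys k) + nmul k g - nmul i g))"
  using assms
proof (induction ys)
  case Nil
  then show ?case by (intro exI[of _ 0]) (auto simp: zero_vgt)
next
  case (Cons y ys)
  then obtain k where k: "k \<le> length ys" "root_coeff ys k \<noteq> \<zero>"
    "\<forall>i. i \<noteq> k \<longrightarrow> root_coeff ys i \<in> vgt (u (root_coeff ys k) + nmul k g - nmul i g)"
    by auto
  define c where "c = root_coeff ys"
  \<comment> \<open>The least value of a term of the polynomial at slope \<open>g\<close>: every
    nonzero \<open>c i\<close> has \<open>u (c i) + i g\<close> at least \<open>m\<close>, with
    equality only for \<open>i = k\<close>.\<close>
  define m where "m = u (c k) + nmul k g"
  have ysC: "set ys \<subseteq> carrier R" using Cons by auto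
  have cC: "c i \<in> carrier R" for i unfolding c_def using ysC by simp
  have ck: "c k \<noteq> \<zero>" using k(2) by (simp add: c_def)
  have ci: "c i \<in> vgt (m - nmul i g)" if "i \<noteq> k" for i
    using k(3) that unfolding c_def m_def by blast
  have ci': "c i \<in> vge (m - nmul i g)" for i
  proof (cases "i = k")
    case True
    then show ?thesis using cC by (simp add: vge_def m_def)
  next
    case False
    then show ?thesis using ci vgt_subset_vge by blast
  qed
  have y: "y \<in> carrier R" "y \<noteq> \<zero>" "u y \<noteq> g" using Cons.prems by auto
  have ygt: "y \<in> vge (u y)" using y by (simp add: vge_def)
  define d where "d i = (if i = 0 then \<zero> else c (i - 1))" for i
  have dC: "d i \<in> carrier R" for i using cC by (simp add: d_def)
  have rc: "root_coeff (y # ys) i = d i \<oplus> \<ominus> (y \<otimes> c i)" for i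
    by (simp add: d_def c_def)
  have d1: "d i \<in> vgt (m + g - nmul i g)" if "i \<noteq> Suc k" for i
  proof (cases i)
    case 0 then show ?thesis by (simp add: d_def zero_vgt)
  next
    case (Suc j)
    then show ?thesis using ci[of j] that by (simp add: d_def algebra_simps)
  qed
  have d2: "d i \<in> vge (m + g - nmul i g)" for i
  proof (cases i)
    case 0 then show ?thesis by (simp add: d_def zero_vge)
  next
    case (Suc j)
    then show ?thesis using ci'[of j] by (simp add: d_def algebra_simps)
  qed
  have e1: "\<ominus> (y \<otimes> c i) \<in> vgt (u y + m - nmul i g)" if "i \<noteq> k" for i
    using vgt_minus[OF vgt_mult[OF ci[OF that] ygt]] cC y by (simp add: algebra_simps m_comm)
  have e2: "\<ominus> (y \<otimes> c i) \<in> vge (u y + m - nmul i g)" for i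
    using vge_minus[OF vge_mult[OF ygt ci'[of i]]] by (simp add: algebra_simps)
  \<comment> \<open>In the product with \<open>X - y\<close>, the constant \<open>- y\<close>
    dominates if \<open>u y < g\<close>, and the position of the minimum stays at \<open>k\<close>.
    If \<open>g < u y\<close>, the term \<open>X\<close> dominates and the position moves to
    \<open>k + 1\<close>.\<close>
  consider "u y < g" | "g < u y" using y(3) by (meson linorder_neqE)
  then show ?case
  proof cases
    case 1
    have nz: "\<ominus> (y \<otimes> c k) \<noteq> \<zero>" and val: "u (\<ominus> (y \<otimes> c k)) = u y + u (c k)"
      using y cC ck u_minus[of "y \<otimes> c k"] u_mult[of y "c k"] by (auto simp: integral_iff)
    have lt: "u y + m - nmul i g < m + g - nmul i g" for i using 1 by (simp add: algebra_simps)
    have "d k \<in> vgt (u y + m - nmul k g)" using d2 vge_vgt[OF lt] by blast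
    then have "d k \<in> vgt (u (\<ominus> (y \<otimes> c k)))" unfolding val m_def by (simp add: algebra_simps)
    from u_add_strict[OF _ nz this] have r: "root_coeff (y # ys) k \<noteq> \<zero>"
      "u (root_coeff (y # ys) k) = u y + u (c k)"
      using cC y dC val unfolding rc by (simp_all add: a_comm)
    have "root_coeff (y # ys) i \<in> vgt (u (root_coeff (y # ys) k) + nmul k g - nmul i g)" if "i \<noteq> k" for i
    proof -
      have "d i \<in> vgt (u y + m - nmul i g)" using d2 vge_vgt[OF lt] by blast
      from vgt_add[OF this e1[OF that]] show ?thesis
        unfolding rc[of i] r(2) m_def by (simp add: algebra_simps)
    qed
    then show ?thesis using k(1) r(1) by (intro exI[of _ k]) auto
  next
    case 2
    have lt: "m + g - nmul i g < u y + m - nmul i g" for i using 2 by (simp add: algebra_simps)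
    have dS: "d (Suc k) = c k" by (simp add: d_def)
    have "\<ominus> (y \<otimes> c (Suc k)) \<in> vgt (m + g - nmul (Suc k) g)" using e2 vge_vgt[OF lt] by blast
    then have "\<ominus> (y \<otimes> c (Suc k)) \<in> vgt (u (c k))" unfolding m_def by (simp add: algebra_simps)
    from u_add_strict[OF cC ck this] have r: "root_coeff (y # ys) (Suc k) \<noteq> \<zero>"
      "u (root_coeff (y # ys) (Suc k)) = u (c k)"
      unfolding rc dS by simp_all
    have "root_coeff (y # ys) i \<in> vgt (u (root_coeff (y # ys) (Suc k)) + nmul (Suc k) g - nmul i g)"
      if "i \<noteq> Suc k" for i
    proof -
      have "\<ominus> (y \<otimes> c i) \<in> vgt (m + g - nmul i g)" using e2 vge_vgt[OF lt] by blast
      from vgt_add[OF d1[OF that] this] show ?thesis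
        unfolding rc[of i] r(2) m_def by (simp add: algebra_simps)
    qed
    then show ?thesis using k(1) r(1) by (intro exI[of _ "Suc k"]) auto
  qed
qed

end

text \<open>Let \<open>y\<close> be good for all of \<open>\<Phi>\<close> while
  \<open>\<psi>\<close> vanishes at \<open>y\<close> but not at \<open>x\<close>. Then
  \<open>\<psi>\<close> is nonzero at every \<open>y^m x\<close>, and each other map vanishes for at
  most one \<open>m\<close>, because ordered groups are torsion free. It is this lemma that turns
  conditions on single elements into conditions on finitely many automorphisms at once.\<close>

lemma finite_homs_common_nonzero:
  fixes prd :: "'a \<Rightarrow> 'a \<Rightarrow> 'a"
    and \<Phi> :: "('a \<Rightarrow> 'v::linordered_ab_group_add) set"
  assumes fin: "finite \<Phi>" and M: "e \<in> M"
    "\<And>x y. x \<in> M \<Longrightarrow> y \<in> M \<Longrightarrow> prd x y \<in> M"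
    and hom: "\<And>\<phi> x y. \<phi> \<in> \<Phi> \<Longrightarrow> x \<in> M \<Longrightarrow> y \<in> M \<Longrightarrow> \<phi> (prd x y) = \<phi> x + \<phi> y"
    and nz: "\<And>\<phi>. \<phi> \<in> \<Phi> \<Longrightarrow> \<exists>x\<in>M. \<phi> x \<noteq> 0"
  shows "\<exists>y\<in>M. \<forall>\<phi>\<in>\<Phi>. \<phi> y \<noteq> 0"
  using fin hom nz
proof (induction \<Phi>)
  case empty
  then show ?case using M(1) by auto
next
  case (insert \<psi> \<Phi>)
  have "\<exists>y\<in>M. \<forall>\<phi>\<in>\<Phi>. \<phi> y \<noteq> 0"
    by (rule insert.IH) (use insert.prems in auto)
  then obtain y where y: "y \<in> M" "\<forall>\<phi>\<in>\<Phi>. \<phi> y \<noteq> 0" by blast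
  obtain x where x: "x \<in> M" "\<psi> x \<noteq> 0" using insert.prems(2) by blast
  show ?case
  proof (cases "\<psi> y = 0")
    case False
    then show ?thesis using y by auto
  next
    case True
    define w where "w m = ((prd y) ^^ m) x" for m
    have w: "w m \<in> M \<and> (\<forall>\<phi>\<in>insert \<psi> \<Phi>. \<phi> (w m) = nmul m (\<phi> y) + \<phi> x)" for m
    proof (induction m)
      case 0
      then show ?case using x by (simp add: w_def)
    next
      case (Suc m)
      have "w (Suc m) = prd y (w m)" by (simp add: w_def)
      moreover have "\<phi> (prd y (w m)) = nmul (Suc m) (\<phi> y) + \<phi> x" if \<phi>: "\<phi> \<in> insert \<psi> \<Phi>" for \<phi>
      proof -
        have "\<phi> (prd y (w m)) = \<phi> y + \<phi> (w m)"
          using insert.prems(1)[OF \<phi> y(1)] Suc by blast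
        also have "\<phi> (w m) = nmul m (\<phi> y) + \<phi> x" using Suc \<phi> by blast
        finally show ?thesis by (simp add: add.assoc)
      qed
      ultimately show ?case using Suc y(1) M(2) by metis
    qed
    have "finite {m. \<phi> (w m) = 0}" if "\<phi> \<in> \<Phi>" for \<phi>
    proof -
      have "m = n" if "\<phi> (w m) = 0" "\<phi> (w n) = 0" for m n
      proof -
        have "nmul m (\<phi> y) + \<phi> x = nmul n (\<phi> y) + \<phi> x"
          using that w[of m] w[of n] \<open>\<phi> \<in> \<Phi>\<close> by simp
        then have "nmul m (\<phi> y) = nmul n (\<phi> y)" by simp
        then show ?thesis using nmul_inj_nat y(2) \<open>\<phi> \<in> \<Phi>\<close> by metis
      qed
      then have "{m. \<phi> (w m) = 0} = {} \<or> (\<exists>n. {m. \<phi> (w m) = 0} = {n})" by blast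
      then show ?thesis by (metis finite.emptyI finite.insertI)
    qed
    then have "finite (\<Union>\<phi>\<in>\<Phi>. {m. \<phi> (w m) = 0})" using insert.hyps(1) by blast
    then obtain m where m: "m \<notin> (\<Union>\<phi>\<in>\<Phi>. {m. \<phi> (w m) = 0})"
      using ex_new_if_finite infinite_UNIV_nat by blast
    have "\<psi> (w m) \<noteq> 0" using w[of m] True x(2) by simp
    then show ?thesis using m w[of m] by (intro bexI[of _ "w m"]) auto
  qed
qed

section \<open>Conjugacy of the valuations that extend a given one\<close>

context closed_extension
begin

text \<open>If no conjugate of \<open>y\<close> had \<open>u1\<close>-value \<open>u2 y\<close>, the
  minimal polynomial of \<open>y\<close> would have no side of this slope with respect to
  \<open>u1\<close>. Its coefficients lie in \<open>K\<close>, where both valuations agree; so with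
  respect to \<open>u2\<close> a single term would be least at \<open>y\<close>, and the polynomial
  could not vanish there.\<close>

lemma conjugate_with_value:
  fixes u1 u2 :: "'a \<Rightarrow> 'v::linordered_ab_group_add"
  assumes u1: "valuation_on R (carrier R) u1" and u2: "valuation_on R (carrier R) u2"
    and agree: "\<forall>x\<in>K - {\<zero>}. u1 x = u2 x" and y: "y \<in> carrier R" "y \<noteq> \<zero>"
  shows "\<exists>s\<in>field_auts R K. u1 (s y) = u2 y"
proof (rule ccontr)
  assume none: "\<not> ?thesis"
  interpret V1: valued_field R u1 by unfold_locales (rule u1)
  interpret V2: valued_field R u2 by unfold_locales (rule u2)
  obtain ys where ys: "set ys \<subseteq> carrier R" "y \<in> set ys" "\<forall>i. root_coeff ys i \<in> K"
    "\<forall>z\<in>set ys. \<exists>s\<in>field_auts R K. s y = z"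
    using Irr_roots[OF y(1)] by blast
  have "z \<noteq> \<zero> \<and> u1 z \<noteq> u2 y" if z: "z \<in> set ys" for z
  proof -
    obtain s where "s \<in> field_auts R K" "s y = z" using ys(4) z by blast
    then show ?thesis using none y by auto
  qed
  then have "set ys \<subseteq> carrier R - {\<zero>}" "\<forall>z\<in>set ys. u1 z \<noteq> u2 y" using ys(1) by auto
  from V1.root_coeff_unique_min[OF this] obtain k where k: "k \<le> length ys" "root_coeff ys k \<noteq> \<zero>"
    "\<forall>i. i \<noteq> k \<longrightarrow> root_coeff ys i \<in> V1.vgt (u1 (root_coeff ys k) + nmul k (u2 y) - nmul i (u2 y))"
    by blast
  let ?f = "\<lambda>i. root_coeff ys i \<otimes> y [^] i"
  have rcC: "root_coeff ys i \<in> carrier R" for i using ys(1) by simp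
  have val: "u2 (?f i) = u1 (root_coeff ys i) + nmul i (u2 y)" if "root_coeff ys i \<noteq> \<zero>" for i
    using that rcC ys(3) agree V2.u_mult[of "root_coeff ys i" "y [^] i"] V2.u_pow[OF y] pow_nonzero[OF y] y
    by simp
  have "finsum R ?f {..length ys} \<noteq> \<zero>"
  proof (rule V2.finsum_unique_min)
    show "finite {..length ys}" "k \<in> {..length ys}" using k by auto
    show "?f k \<in> carrier R" "?f k \<noteq> \<zero>"
      using rcC y k(2) pow_nonzero[OF y] by (auto simp: integral_iff)
    fix i assume "i \<noteq> k"
    then have i: "root_coeff ys i \<in> V1.vgt (u1 (root_coeff ys k) + nmul k (u2 y) - nmul i (u2 y))"
      using k(3) by blast
    show "?f i \<in> V2.vgt (u2 (?f k))"
    proof (cases "root_coeff ys i = \<zero>")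
      case True
      then show ?thesis using y by (simp add: V2.zero_vgt)
    next
      case False
      then show ?thesis
        using i val[OF False] val[OF k(2)] rcC y
        by (simp add: V1.vgt_def V2.vgt_def diff_less_eq)
    qed
  qed
  then show False using root_coeff_eval_root[OF ys(1,2)] by simp
qed

text \<open>Each element has finitely many conjugates, so there are only finitely many restrictions
  of automorphisms to \<open>T\<close>.\<close>

lemma finite_aut_representatives:
  assumes "finite T" "T \<subseteq> carrier R"
  shows "\<exists>G\<subseteq>field_auts R K. finite G \<and> (\<forall>s\<in>field_auts R K. \<exists>s'\<in>G. \<forall>t\<in>T. s t = s' t)"
proof -
  let ?r = "\<lambda>s. restrict s T"
  have "?r ` field_auts R K \<subseteq> PiE T (\<lambda>t. {s t | s. s \<in> field_auts R K})"
    by (auto simp: PiE_def)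
  moreover have "finite (PiE T (\<lambda>t. {s t | s. s \<in> field_auts R K}))"
    by (intro finite_PiE assms(1) finite_conjugates) (use assms(2) in auto)
  ultimately have "finite (?r ` field_auts R K)" by (rule finite_subset)
  from finite_subset_image[OF this subset_refl] obtain G where
    G: "G \<subseteq> field_auts R K" "finite G" "?r ` field_auts R K = ?r ` G" by blast
  have "\<exists>s'\<in>G. \<forall>t\<in>T. s t = s' t" if "s \<in> field_auts R K" for s
  proof -
    have "?r s \<in> ?r ` G" using G(3) that by blast
    then obtain s' where "s' \<in> G" "?r s = ?r s'" by blast
    then show ?thesis by (metis restrict_apply')
  qed
  then show ?thesis using G by blast
qed

text \<open>If every automorphism failed at some element of \<open>T\<close>, the maps
  \<open>u1 (s y) - u2 y\<close>, for \<open>s\<close> in a finite set of representatives, would be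
  nonzero homomorphisms. They would then be nonzero at a common \<open>y\<close>, although
  \<open>conjugate_with_value\<close> provides an automorphism without failure at
  \<open>y\<close>.\<close>

lemma simultaneous_conjugates_with_values:
  fixes u1 u2 :: "'a \<Rightarrow> 'v::linordered_ab_group_add"
  assumes u1: "valuation_on R (carrier R) u1" and u2: "valuation_on R (carrier R) u2"
    and agree: "\<forall>x\<in>K - {\<zero>}. u1 x = u2 x" and T: "finite T" "T \<subseteq> carrier R - {\<zero>}"
  shows "\<exists>s\<in>field_auts R K. \<forall>t\<in>T. u1 (s t) = u2 t"
proof (rule ccontr)
  assume none: "\<not> ?thesis"
  interpret V1: valued_field R u1 by unfold_locales (rule u1)
  interpret V2: valued_field R u2 by unfold_locales (rule u2)
  have TC: "T \<subseteq> carrier R" using T by auto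
  obtain G where G: "G \<subseteq> field_auts R K" "finite G"
    "\<forall>s\<in>field_auts R K. \<exists>s'\<in>G. \<forall>t\<in>T. s t = s' t"
    using finite_aut_representatives[OF T(1) TC] by blast
  \<comment> \<open>The elements on which an automorphism is determined by its restriction to
    \<open>T\<close>. They take the place of the multiplicative group of the field generated by
    \<open>T\<close> over \<open>K\<close>.\<close>
  define M where "M = {y \<in> carrier R - {\<zero>}. \<forall>s\<in>field_auts R K. \<forall>s'\<in>field_auts R K.
    (\<forall>t\<in>T. s t = s' t) \<longrightarrow> s y = s' y}"
  have MC: "x \<in> carrier R" "x \<noteq> \<zero>" if "x \<in> M" for x using that by (auto simp: M_def)
  define \<Phi> where "\<Phi> = (\<lambda>s y. u1 (s y) - u2 y) ` G"
  have "\<exists>y\<in>M. \<forall>\<phi>\<in>\<Phi>. \<phi> y \<noteq> 0"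
  proof (rule finite_homs_common_nonzero[of _ \<one> _ "(\<otimes>)"])
    show "finite \<Phi>" using G by (simp add: \<Phi>_def)
    show "\<one> \<in> M" by (auto simp: M_def)
    show "x \<otimes> y \<in> M" if "x \<in> M" "y \<in> M" for x y
    proof -
      have "x \<otimes> y \<noteq> \<zero>" using MC that by (simp add: integral_iff)
      moreover have "s (x \<otimes> y) = s' (x \<otimes> y)"
        if "s \<in> field_auts R K" "s' \<in> field_auts R K" "\<forall>t\<in>T. s t = s' t" for s s'
      proof -
        have "s x = s' x" "s y = s' y" using \<open>x \<in> M\<close> \<open>y \<in> M\<close> that unfolding M_def by blast+
        then show ?thesis using MC \<open>x \<in> M\<close> \<open>y \<in> M\<close> that(1,2) by simp
      qed
      moreover have "x \<otimes> y \<in> carrier R" using MC that by simp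
      ultimately show ?thesis unfolding M_def by blast
    qed
    show "\<phi> (x \<otimes> y) = \<phi> x + \<phi> y" if "\<phi> \<in> \<Phi>" "x \<in> M" "y \<in> M" for \<phi> x y
    proof -
      obtain s where "s \<in> G" "\<phi> = (\<lambda>y. u1 (s y) - u2 y)" using \<open>\<phi> \<in> \<Phi>\<close> by (auto simp: \<Phi>_def)
      moreover have "s \<in> field_auts R K" using \<open>s \<in> G\<close> G by auto
      ultimately show ?thesis
        using MC[OF that(2)] MC[OF that(3)] by (simp add: V1.u_mult V2.u_mult)
    qed
    show "\<exists>x\<in>M. \<phi> x \<noteq> 0" if "\<phi> \<in> \<Phi>" for \<phi>
    proof -
      obtain s where s: "s \<in> G" "\<phi> = (\<lambda>y. u1 (s y) - u2 y)" using \<open>\<phi> \<in> \<Phi>\<close> by (auto simp: \<Phi>_def)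
      then obtain t where t: "t \<in> T" "u1 (s t) \<noteq> u2 t" using none G(1) by blast
      then have "t \<in> M" using T(2) by (auto simp: M_def)
      then show ?thesis using s(2) t by auto
    qed
  qed
  then obtain y where y: "y \<in> M" "\<forall>\<phi>\<in>\<Phi>. \<phi> y \<noteq> 0" by blast
  obtain s where s: "s \<in> field_auts R K" "u1 (s y) = u2 y"
    using conjugate_with_value[OF u1 u2 agree MC[OF y(1)]] by blast
  obtain s' where s': "s' \<in> G" "\<forall>t\<in>T. s t = s' t" using G(3) s(1) by blast
  then have "s y = s' y" using y(1) s(1) G(1) unfolding M_def by blast
  moreover have "u1 (s' y) - u2 y \<noteq> 0" using y(2) s'(1) by (auto simp: \<Phi>_def)
  ultimately show False using s(2) by simp
qed

end


section \<open>Henselizations\<close>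

lemma (in field) root_coeff_eval_eq_zero_iff:
  assumes "set ys \<subseteq> carrier R" "x \<in> carrier R"
  shows "(\<Oplus>i\<in>{..length ys}. root_coeff ys i \<otimes> x [^] i) = \<zero> \<longleftrightarrow> x \<in> set ys"
proof -
  have "foldr (\<lambda>y a. (x \<ominus> y) \<otimes> a) ys \<one> = \<zero> \<longrightarrow> x \<in> set ys"
    using assms(1)
  proof (induction ys)
    case (Cons y ys)
    then show ?case
      using assms(2) foldr_prod_closed[of ys x] by (auto simp: integral_iff)
  qed simp
  then show ?thesis
    using root_coeff_eval[OF assms] foldr_prod_zero[OF assms(1)] by auto
qed

context field
begin

text \<open>The separable part of the fixed field of the decomposition group. Preserving the values of a
  finite set stands for the open neighbourhoods of the decomposition group.\<close>

definition decomposition_field :: "('a \<Rightarrow> 'v) \<Rightarrow> 'a set \<Rightarrow> 'a set" where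
  "decomposition_field u K = {x \<in> separable_elems K. \<exists>T. finite T \<and> T \<subseteq> carrier R - {\<zero>} \<and>
     (\<forall>s\<in>field_auts R K. (\<forall>t\<in>T. u (s t) = u t) \<longrightarrow> s x = x)}"

lemma valuation_on_aut:
  assumes "valuation_on R (carrier R) u" and s: "s \<in> field_auts R K"
  shows "valuation_on R (carrier R) (\<lambda>x. u (s x))"
proof -
  have 1: "\<forall>x\<in>carrier R - {\<zero>}. \<forall>y\<in>carrier R - {\<zero>}. u (x \<otimes> y) = u x + u y"
    and 2: "\<forall>x\<in>carrier R - {\<zero>}. \<forall>y\<in>carrier R - {\<zero>}. x \<oplus> y \<noteq> \<zero> \<longrightarrow> min (u x) (u y) \<le> u (x \<oplus> y)"
    and F: "subfield (carrier R) R"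
    using assms(1) unfolding valuation_on_def by blast+
  have sC: "s x \<in> carrier R - {\<zero>}" if "x \<in> carrier R - {\<zero>}" for x using that s by simp
  show ?thesis
    unfolding valuation_on_def
  proof (intro conjI ballI impI F)
    fix x y assume xy: "x \<in> carrier R - {\<zero>}" "y \<in> carrier R - {\<zero>}"
    then have s1: "s (x \<otimes> y) = s x \<otimes> s y" and s2: "s (x \<oplus> y) = s x \<oplus> s y" using s by auto
    show "u (s (x \<otimes> y)) = u (s x) + u (s y)"
      unfolding s1 using 1 sC[OF xy(1)] sC[OF xy(2)] by blast
    assume "x \<oplus> y \<noteq> \<zero>"
    then have "s x \<oplus> s y \<noteq> \<zero>" using s xy s2 aut_zero_iff[OF s, of "x \<oplus> y"] by simp
    then show "min (u (s x)) (u (s y)) \<le> u (s (x \<oplus> y))"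
      unfolding s2 using 2 sC[OF xy(1)] sC[OF xy(2)] by blast
  qed
qed

lemma aut_finsum:
  assumes s: "s \<in> field_auts R K" and "f \<in> A \<rightarrow> carrier R"
  shows "s (finsum R f A) = (\<Oplus>i\<in>A. s (f i))"
proof -
  interpret s: ring_hom_cring R R s using aut_ring_hom_cring[OF s] .
  show ?thesis using s.hom_finsum[OF assms(2)] by (simp add: comp_def)
qed

lemma aut_finprod:
  assumes s: "s \<in> field_auts R K" and "f \<in> A \<rightarrow> carrier R"
  shows "s (finprod R f A) = (\<Otimes>i\<in>A. s (f i))"
proof -
  interpret s: ring_hom_cring R R s using aut_ring_hom_cring[OF s] .
  show ?thesis using s.hom_finprod[OF assms(2)] by (simp add: comp_def)
qed

lemma aut_inv:
  assumes s: "s \<in> field_auts R K" and x: "x \<in> carrier R" "x \<noteq> \<zero>"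
  shows "s (inv x) = inv (s x)"
proof -
  have "s x \<otimes> s (inv x) = s (x \<otimes> inv x)" using s x inv_closed_nonzero by simp
  also have "\<dots> = \<one>" using s r_inv_nonzero[OF x] by simp
  finally show ?thesis using s x inv_closed_nonzero comm_inv_char[of "s x" "s (inv x)"] by simp
qed

end

context valued_field
begin

lemma u_finprod:
  "finite A \<Longrightarrow> (\<And>a. a \<in> A \<Longrightarrow> f a \<in> carrier R - {\<zero>}) \<Longrightarrow>
    finprod R f A \<noteq> \<zero> \<and> u (finprod R f A) = (\<Sum>a\<in>A. u (f a))"
proof (induction A rule: finite_induct)
  case (insert a A)
  then have f: "f \<in> A \<rightarrow> carrier R" "f a \<in> carrier R" "f a \<noteq> \<zero>" by auto
  have "finprod R f A \<in> carrier R" using f by simp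
  then show ?case using insert f by (simp add: integral_iff u_mult)
qed (simp add: u_one)

end

context closed_extension
begin

lemma decomposition_field_subfield: "subfield (decomposition_field u K) R"
proof -
  let ?D = "decomposition_field u K"
  note sep = separable_elems_subfield
  note sr = subringE[OF subfieldE(1)[OF sep]]
  have DS: "?D \<subseteq> separable_elems K" by (auto simp: decomposition_field_def)
  have SC: "separable_elems K \<subseteq> carrier R" using separable_elems_carrier[OF K_subfield] .
  show ?thesis
  proof (rule subfieldI'[OF subringI])
    show "?D \<subseteq> carrier R" using DS SC by blast
    show "\<one> \<in> ?D"
      unfolding decomposition_field_def using sr(3) by (auto intro!: exI[of _ "{}"])
    show "\<ominus> x \<in> ?D" if "x \<in> ?D" for x
    proof -
      have "x \<in> carrier R" using that DS SC by blast
      then show ?thesis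
        using that sr(5)[of x] unfolding decomposition_field_def by fastforce
    qed
    show "inv x \<in> ?D" if "x \<in> ?D - {\<zero>}" for x
    proof -
      have x: "x \<in> carrier R" "x \<noteq> \<zero>" using that DS SC by auto
      have "inv x \<in> separable_elems K" using that DS subfield_m_inv(1)[OF sep, of x] by blast
      then show ?thesis
        using that x unfolding decomposition_field_def by (fastforce simp: aut_inv)
    qed
    fix x y assume xy: "x \<in> ?D" "y \<in> ?D"
    then have C: "x \<in> carrier R" "y \<in> carrier R" using DS SC by auto
    obtain T1 T2 where T: "finite T1" "T1 \<subseteq> carrier R - {\<zero>}"
      "\<forall>s\<in>field_auts R K. (\<forall>t\<in>T1. u (s t) = u t) \<longrightarrow> s x = x"
      "finite T2" "T2 \<subseteq> carrier R - {\<zero>}"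
      "\<forall>s\<in>field_auts R K. (\<forall>t\<in>T2. u (s t) = u t) \<longrightarrow> s y = y"
      using xy unfolding decomposition_field_def by blast
    have T12: "finite (T1 \<union> T2)" "T1 \<union> T2 \<subseteq> carrier R - {\<zero>}" using T by auto
    have fixd: "s x = x \<and> s y = y" if "s \<in> field_auts R K" "\<forall>t\<in>T1 \<union> T2. u (s t) = u t" for s
      using T(3,6) that by blast
    have xyS: "x \<in> separable_elems K" "y \<in> separable_elems K" using xy DS by blast+
    have "x \<oplus> y \<in> separable_elems K" "x \<otimes> y \<in> separable_elems K"
      using sr(6)[OF xyS] sr(7)[OF xyS] by simp_all
    moreover have "s (x \<oplus> y) = x \<oplus> y" "s (x \<otimes> y) = x \<otimes> y"
      if "s \<in> field_auts R K" "\<forall>t\<in>T1 \<union> T2. u (s t) = u t" for s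
      using fixd[OF that] C that(1) by simp_all
    ultimately show "x \<oplus> y \<in> ?D" "x \<otimes> y \<in> ?D"
      unfolding decomposition_field_def using T12 by blast+
  qed
qed

lemma base_subset_decomposition_field: "K \<subseteq> decomposition_field u K"
  unfolding decomposition_field_def
  using base_separable[OF K_subfield] by (auto simp: aut_fix intro!: exI[of _ "{}"])

text \<open>An automorphism \<open>s\<close> over \<open>F\<close> preserves \<open>u\<close>,
  because composing \<open>u\<close> with \<open>s\<close> gives another extension of the
  restriction to \<open>F\<close>. So it fixes the decomposition field, whose elements are separable
  over \<open>F\<close> and therefore lie in \<open>F\<close>.\<close>

lemma decomposition_field_minimal:
  fixes u :: "'a \<Rightarrow> 'v::linordered_ab_group_add"
  assumes u: "valuation_on R (carrier R) u" and F: "subfield F R" "K \<subseteq> F"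
    and det: "\<forall>u' :: 'a \<Rightarrow> 'v. valuation_on R (carrier R) u' \<and> extends_on R F u' u \<longrightarrow>
      extends_on R (carrier R) u' u"
  shows "decomposition_field u K \<subseteq> F"
proof
  interpret F: closed_extension R F using closed_extension_intermediate[OF F] .
  fix x assume "x \<in> decomposition_field u K"
  then obtain T where x: "x \<in> separable_elems K" and T: "T \<subseteq> carrier R - {\<zero>}"
    "\<forall>s\<in>field_auts R K. (\<forall>t\<in>T. u (s t) = u t) \<longrightarrow> s x = x"
    unfolding decomposition_field_def by blast
  have "s x = x" if s: "s \<in> field_auts R F" for s
  proof -
    have "extends_on R F (\<lambda>x. u (s x)) u"
      using aut_fix[OF s] by (simp add: extends_on_def)
    then have "extends_on R (carrier R) (\<lambda>x. u (s x)) u"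
      using det valuation_on_aut[OF u s] by blast
    then have "\<forall>t\<in>T. u (s t) = u t" using T(1) unfolding extends_on_def by blast
    then show ?thesis using T(2) s aut_mono[OF F(2)] by blast
  qed
  then show "x \<in> F"
    using F.separable_fixed_in_base separable_elems_mono[OF K_subfield F(1,2)] x by blast
qed

text \<open>The product of those conjugates of \<open>y\<close> that have the least value is fixed by the
  decomposition group, so all conjugates have the same value.\<close>

lemma decomposition_field_conjugate_value:
  fixes u :: "'a \<Rightarrow> 'v::linordered_ab_group_add"
  assumes u: "valuation_on R (carrier R) u" and y: "y \<in> carrier R" "y \<noteq> \<zero>"
    and s: "s \<in> field_auts R (decomposition_field u K)"
  shows "u (s y) = u y"
proof -
  let ?D = "decomposition_field u K"
  interpret V: valued_field R u by unfold_locales (rule u)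
  interpret D: closed_extension R ?D
    using closed_extension_intermediate[OF decomposition_field_subfield base_subset_decomposition_field] .
  obtain ys where ys: "set ys \<subseteq> carrier R" "y \<in> set ys" "\<forall>i. root_coeff ys i \<in> ?D"
    "\<forall>z\<in>set ys. \<exists>s\<in>field_auts R ?D. s y = z" "\<forall>s\<in>field_auts R ?D. s y \<in> set ys"
    using D.Irr_roots[OF y(1)] by blast
  have nz: "z \<noteq> \<zero>" if z: "z \<in> set ys" for z
  proof -
    obtain r where "r \<in> field_auts R ?D" "r y = z" using ys(4) z by blast
    then show ?thesis using y by auto
  qed
  define g where "g = Min (u ` set ys)"
  have g: "g \<le> u z" if "z \<in> set ys" for z using that by (simp add: g_def)
  define Y where "Y = {z \<in> set ys. u z = g}"
  have "g \<in> u ` set ys" unfolding g_def by (rule Min_in) (use ys(2) in auto)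
  then obtain y1 where y1: "y1 \<in> Y" unfolding Y_def by blast
  have finY: "finite Y" by (simp add: Y_def)
  have YC: "Y \<subseteq> carrier R - {\<zero>}" using ys(1) nz by (auto simp: Y_def)
  define w where "w = (\<Otimes>z\<in>Y. z)"
  have wC: "w \<in> carrier R" unfolding w_def using YC by (intro finprod_closed) auto
  have w: "w \<noteq> \<zero>" "u w = (\<Sum>z\<in>Y. g)"
    using V.u_finprod[OF finY, of "\<lambda>z. z"] YC unfolding w_def by (auto simp: Y_def)
  have "\<forall>i. \<exists>T. finite T \<and> T \<subseteq> carrier R - {\<zero>} \<and>
      (\<forall>s\<in>field_auts R K. (\<forall>t\<in>T. u (s t) = u t) \<longrightarrow> s (root_coeff ys i) = root_coeff ys i)"
    using ys(3) unfolding decomposition_field_def by blast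
  then obtain T where T: "\<forall>i. finite (T i) \<and> T i \<subseteq> carrier R - {\<zero>} \<and>
      (\<forall>s\<in>field_auts R K. (\<forall>t\<in>T i. u (s t) = u t) \<longrightarrow> s (root_coeff ys i) = root_coeff ys i)"
    by metis
  \<comment> \<open>Automorphisms preserving the values on \<open>T'\<close> fix the coefficients of
    the minimal polynomial over the decomposition field. They therefore permute its roots; they also
    preserve the values of these roots, hence map \<open>Y\<close> onto itself.\<close>
  define T' where "T' = set ys \<union> (\<Union>i\<le>length ys. T i)"
  have T': "finite T'" "T' \<subseteq> carrier R - {\<zero>}" using T ys(1) nz[of "\<zero>"] by (auto simp: T'_def)
  have fixw: "r w = w" if r: "r \<in> field_auts R K" "\<forall>t\<in>T'. u (r t) = u t" for r
  proof -
    have rc: "r (root_coeff ys i) = root_coeff ys i" if "i \<le> length ys" for i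
      using T r that unfolding T'_def by blast
    have rys: "r z \<in> set ys" if z: "z \<in> set ys" for z
    proof -
      have zC: "z \<in> carrier R" using z ys(1) by auto
      have cl: "(\<lambda>i. root_coeff ys i \<otimes> z [^] i) \<in> {..length ys} \<rightarrow> carrier R"
        using ys(1) zC by auto
      have "(\<Oplus>i\<in>{..length ys}. root_coeff ys i \<otimes> (r z) [^] i) =
          (\<Oplus>i\<in>{..length ys}. r (root_coeff ys i \<otimes> z [^] i))"
        using ys(1) zC r(1) rc by (intro finsum_cong') auto
      also have "\<dots> = r (\<Oplus>i\<in>{..length ys}. root_coeff ys i \<otimes> z [^] i)"
        using aut_finsum[OF r(1) cl] by simp
      also have "\<dots> = \<zero>" using root_coeff_eval_root[OF ys(1) z] r(1) by simp
      finally show ?thesis using root_coeff_eval_eq_zero_iff[OF ys(1), of "r z"] r(1) zC by auto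
    qed
    have sub: "r ` Y \<subseteq> Y" using rys r(2) unfolding Y_def T'_def by auto
    have inj: "inj_on r Y" using aut_eq_iff[OF r(1)] YC by (auto simp: inj_on_def)
    have rY: "r ` Y = Y" using endo_inj_surj[OF finY sub inj] .
    have "r w = (\<Otimes>z\<in>Y. r z)" unfolding w_def using aut_finprod[OF r(1), of "\<lambda>z. z" Y] YC by auto
    also have "\<dots> = (\<Otimes>z\<in>r ` Y. z)"
      by (rule finprod_reindex[symmetric]) (use inj YC rY in auto)
    finally show ?thesis unfolding rY w_def .
  qed
  \<comment> \<open>The product \<open>w\<close> may be inseparable over \<open>K\<close>. A
    separable power is as good, since values in an ordered group can be divided by \<open>q\<close>
    uniquely.\<close>
  obtain q where q: "q \<in> additive_exps" "w [^] q \<in> separable_elems K"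
    using exists_separable_power[OF wC] by blast
  have q0: "0 < q" using additive_expsD(1)[OF q(1)] by simp
  have "r (w [^] q) = w [^] q" if "r \<in> field_auts R K" "\<forall>t\<in>T'. u (r t) = u t" for r
    using fixw[OF that] that(1) wC by simp
  then have wD: "w [^] q \<in> ?D"
    unfolding decomposition_field_def using q(2) T' by blast
  have all: "u y2 = g" if y2: "y2 \<in> set ys" for y2
  proof (rule ccontr)
    assume ne: "u y2 \<noteq> g"
    then have gt: "g < u y2" using g[OF y2] by simp
    obtain s1 s2 where s12: "s1 \<in> field_auts R ?D" "s1 y = y1" "s2 \<in> field_auts R ?D" "s2 y = y2"
      using ys(4) y1 y2 unfolding Y_def by blast
    obtain t1 where t1: "t1 \<in> field_auts R ?D" "\<forall>x\<in>carrier R. t1 (s1 x) = x \<and> s1 (t1 x) = x"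
      using aut_inverse[OF s12(1) D.base_in_carrier] by blast
    define r where "r = (\<lambda>x. s2 (t1 x))"
    have r: "r \<in> field_auts R ?D" unfolding r_def by (rule aut_compose[OF s12(3) t1(1)])
    have ry1: "r y1 = y2" using t1(2) y(1) s12 unfolding r_def by auto
    have rY: "r z \<in> set ys" if z: "z \<in> Y" for z
    proof -
      obtain s3 where s3: "s3 \<in> field_auts R ?D" "s3 y = z" using ys(4) z unfolding Y_def by blast
      then have "r z = (\<lambda>x. r (s3 x)) y" by simp
      then show ?thesis using ys(5) aut_compose[OF r s3(1)] by metis
    qed
    \<comment> \<open>The automorphism \<open>r\<close> sends the factor \<open>y1\<close> of least
      value to \<open>y2\<close>, and no factor to a smaller value. So it raises the value of
      \<open>w\<close>, although it fixes \<open>w^q\<close>.\<close>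
    have "u w < (\<Sum>z\<in>Y. u (r z))"
      unfolding w(2)
    proof (rule sum_strict_mono_ex1[OF finY])
      show "\<forall>z\<in>Y. g \<le> u (r z)" using g rY by blast
      show "\<exists>z\<in>Y. g < u (r z)" using y1 ry1 gt by (intro bexI[of _ y1]) auto
    qed
    also have "\<dots> = u (\<Otimes>z\<in>Y. r z)"
      using V.u_finprod[OF finY, of r] YC r by (auto simp: subset_iff)
    also have "(\<Otimes>z\<in>Y. r z) = r w"
      unfolding w_def by (rule aut_finprod[OF r, symmetric]) (use YC in auto)
    finally have lt: "u w < u (r w)" .
    have "r (w [^] q) = w [^] q" using aut_fix[OF r wD] .
    then have "(r w) [^] q = w [^] q" using r wC by simp
    then have "nmul q (u (r w)) = nmul q (u w)"
      using V.u_pow[of "r w" q] V.u_pow[of w q] w(1) wC r by simp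
    then show False using nmul_eq_iff[OF q0] lt by (metis less_irrefl)
  qed
  show ?thesis using all ys(2,5) s by metis
qed

text \<open>Over the decomposition field, \<open>u' x\<close> is the \<open>u\<close>-value of some
  conjugate of \<open>x\<close>, and all these conjugates have the same \<open>u\<close>-value as
  \<open>x\<close>.\<close>

lemma decomposition_field_determines:
  fixes u u' :: "'a \<Rightarrow> 'v::linordered_ab_group_add"
  assumes u: "valuation_on R (carrier R) u" and u': "valuation_on R (carrier R) u'"
    and ext: "extends_on R (decomposition_field u K) u' u"
  shows "extends_on R (carrier R) u' u"
  unfolding extends_on_def
proof
  let ?D = "decomposition_field u K"
  interpret D: closed_extension R ?D
    using closed_extension_intermediate[OF decomposition_field_subfield base_subset_decomposition_field] .
  fix x assume x: "x \<in> carrier R - {\<zero>}"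
  have "\<forall>x\<in>?D - {\<zero>}. u x = u' x" using ext by (simp add: extends_on_def)
  then obtain s where "s \<in> field_auts R ?D" "u (s x) = u' x"
    using D.conjugate_with_value[OF u u', of x] x by blast
  then show "u' x = u x" using decomposition_field_conjugate_value[OF u, of x s] x by simp
qed

text \<open>The determining property and minimality together show that a least field exists, as the
  \<open>LEAST\<close> in \<open>henselization\<close> presupposes.\<close>

lemma henselization_eq:
  fixes u :: "'a \<Rightarrow> 'v::linordered_ab_group_add"
  assumes u: "valuation_on R (carrier R) u"
  shows "henselization R u K = decomposition_field u K"
  unfolding henselization_def
proof (rule Least_equality)
  show "subfield (decomposition_field u K) R \<and> K \<subseteq> decomposition_field u K \<and>
      (\<forall>u' :: 'a \<Rightarrow> 'v. valuation_on R (carrier R) u' \<and> extends_on R (decomposition_field u K) u' u \<longrightarrow>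
        extends_on R (carrier R) u' u)"
    using decomposition_field_subfield base_subset_decomposition_field decomposition_field_determines[OF u]
    by blast
  fix F assume "subfield F R \<and> K \<subseteq> F \<and> (\<forall>u' :: 'a \<Rightarrow> 'v. valuation_on R (carrier R) u' \<and> extends_on R F u' u \<longrightarrow>
      extends_on R (carrier R) u' u)"
  then show "decomposition_field u K \<le> F" using decomposition_field_minimal[OF u] by blast
qed

text \<open>On \<open>L\<close> the valuation \<open>u\<close> agrees with its composite with
  \<open>s\<close>. Hence some \<open>t\<close> over \<open>L\<close> can be put before
  \<open>s\<close> such that the composite \<open>r\<close> preserves the values that control the
  finitely many \<open>c i\<close>. Then \<open>r\<close> fixes the \<open>c i\<close> and acts on
  the \<open>y i\<close> like \<open>s\<close>, and it is applied to the relation.\<close>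

lemma relation_conjugate:
  fixes u :: "'a \<Rightarrow> 'v::linordered_ab_group_add"
  assumes u: "valuation_on R (carrier R) u" and L: "subfield L R" "K \<subseteq> L"
    and s: "s \<in> field_auts R K" "\<forall>l\<in>L - {\<zero>}. u (s l) = u l"
    and I: "finite I" and c: "\<And>i. i \<in> I \<Longrightarrow> c i \<in> decomposition_field u K"
    and y: "\<And>i. i \<in> I \<Longrightarrow> y i \<in> L" and rel: "(\<Oplus>i\<in>I. c i \<otimes> y i) = \<zero>"
  shows "(\<Oplus>i\<in>I. c i \<otimes> s (y i)) = \<zero>"
proof -
  interpret L: closed_extension R L using closed_extension_intermediate[OF L] .
  have "\<forall>i\<in>I. \<exists>T. finite T \<and> T \<subseteq> carrier R - {\<zero>} \<and>
      (\<forall>s\<in>field_auts R K. (\<forall>t\<in>T. u (s t) = u t) \<longrightarrow> s (c i) = c i)"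
    using c unfolding decomposition_field_def by blast
  then obtain T where T: "\<forall>i\<in>I. finite (T i) \<and> T i \<subseteq> carrier R - {\<zero>} \<and>
      (\<forall>s\<in>field_auts R K. (\<forall>t\<in>T i. u (s t) = u t) \<longrightarrow> s (c i) = c i)"
    by metis
  have fin: "finite (\<Union>i\<in>I. T i)" "(\<Union>i\<in>I. T i) \<subseteq> carrier R - {\<zero>}" using T I by auto
  obtain t where t: "t \<in> field_auts R L" "\<forall>x\<in>(\<Union>i\<in>I. T i). u (s (t x)) = u x"
    using L.simultaneous_conjugates_with_values[OF valuation_on_aut[OF u s(1)] u s(2) fin] by blast
  define r where "r = (\<lambda>x. s (t x))"
  have tK: "t \<in> field_auts R K" using t(1) aut_mono[OF L(2)] by blast
  have r: "r \<in> field_auts R K" unfolding r_def by (rule aut_compose[OF s(1) tK])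
  have rc: "r (c i) = c i" if "i \<in> I" for i
  proof -
    have "\<forall>x\<in>T i. u (r x) = u x" using t(2) that unfolding r_def by blast
    then show ?thesis using T r that by blast
  qed
  have ry: "r (y i) = s (y i)" if "i \<in> I" for i
    using aut_fix[OF t(1) y[OF that]] by (simp add: r_def)
  have cC: "c i \<in> carrier R" "y i \<in> carrier R" if "i \<in> I" for i
    using subfieldE(3)[OF decomposition_field_subfield[of u]] c[OF that] subfieldE(3)[OF L(1)] y[OF that] by auto
  have "(\<Oplus>i\<in>I. c i \<otimes> s (y i)) = (\<Oplus>i\<in>I. r (c i \<otimes> y i))"
    using cC rc ry r s(1) by (intro finsum_cong') auto
  also have "\<dots> = r (\<Oplus>i\<in>I. c i \<otimes> y i)"
    using aut_finsum[OF r, of "\<lambda>i. c i \<otimes> y i" I] cC by auto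
  finally show ?thesis using rel r by simp
qed

end


section \<open>Separating an extension from its conjugates\<close>

lemma (in abelian_monoid) finsum_swap:
  assumes "finite A" "finite B" "\<And>a b. a \<in> A \<Longrightarrow> b \<in> B \<Longrightarrow> f a b \<in> carrier G"
  shows "(\<Oplus>a\<in>A. \<Oplus>b\<in>B. f a b) = (\<Oplus>b\<in>B. \<Oplus>a\<in>A. f a b)"
  using assms(1,3)
proof (induction A rule: finite_induct)
  case (insert a A)
  have "(\<Oplus>a\<in>insert a A. \<Oplus>b\<in>B. f a b) = (\<Oplus>b\<in>B. f a b) \<oplus> (\<Oplus>a\<in>A. \<Oplus>b\<in>B. f a b)"
    using insert by (subst finsum_insert) auto
  also have "\<dots> = (\<Oplus>b\<in>B. f a b) \<oplus> (\<Oplus>b\<in>B. \<Oplus>a\<in>A. f a b)"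
    using insert by auto
  also have "\<dots> = (\<Oplus>b\<in>B. f a b \<oplus> (\<Oplus>a\<in>A. f a b))"
    using insert by (intro finsum_addf[symmetric]) auto
  also have "\<dots> = (\<Oplus>b\<in>B. \<Oplus>a\<in>insert a A. f a b)"
    using insert by (intro finsum_cong') auto
  finally show ?case .
qed simp

context valued_field
begin

lemma root_coeff_vge:
  "set ys \<subseteq> vge 0 \<Longrightarrow> root_coeff ys i \<in> vge 0"
proof (induction ys arbitrary: i)
  case Nil
  then show ?case using u_one by (auto simp: vge_def)
next
  case (Cons y ys)
  then show ?case
    using vge_add[of _ 0 "\<ominus> (y \<otimes> root_coeff ys i)"] vge_minus[OF vge_mult[of y 0 "root_coeff ys i" 0]]
      zero_vge by auto
qed

lemma root_coeff_vgt:
  "set ys \<subseteq> vgt 0 \<Longrightarrow> i < length ys \<Longrightarrow> root_coeff ys i \<in> vgt 0"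
proof (induction ys arbitrary: i)
  case (Cons y ys)
  have ge: "root_coeff ys i \<in> vge 0" by (rule root_coeff_vge) (use Cons.prems(1) vgt_subset_vge in auto)
  have "y \<otimes> root_coeff ys i \<in> vgt 0" using vgt_mult[OF _ ge, of y 0] Cons.prems(1) by simp
  then have "\<ominus> (y \<otimes> root_coeff ys i) \<in> vgt 0" by (rule vgt_minus)
  moreover have "(if i = 0 then \<zero> else root_coeff ys (i - 1)) \<in> vgt 0"
    using Cons zero_vgt by auto
  ultimately show ?case using vgt_add by simp
qed simp

lemma value_mult_inv:
  "x \<in> carrier R \<Longrightarrow> y \<in> carrier R \<Longrightarrow> x \<noteq> \<zero> \<Longrightarrow> y \<noteq> \<zero> \<Longrightarrow> u (x \<otimes> inv y) = u x - u y"
  using u_mult[of x "inv y"] u_inv[of y] inv_closed_nonzero[of y] inv_nonzero[of y] by simp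

end

locale valued_closed_extension = closed_extension R K + valued_field R u
  for R :: "('a, 'm) ring_scheme" (structure) and K :: "'a set"
    and u :: "'a \<Rightarrow> 'v::linordered_ab_group_add"
begin

text \<open>In the polynomial equation of \<open>l\<close>, the least value of a term occurs at
  least twice, since otherwise the sum would be nonzero. Comparing two such terms gives the multiple
  of \<open>u l\<close>.\<close>

lemma value_torsion:
  assumes l: "l \<in> carrier R" "l \<noteq> \<zero>"
  shows "\<exists>m>0. \<exists>c\<in>K - {\<zero>}. nmul m (u l) = u c"
proof -
  obtain ys where ys: "set ys \<subseteq> carrier R" "l \<in> set ys" "\<forall>i. root_coeff ys i \<in> K"
    using Irr_roots[OF l(1)] by blast
  let ?c = "root_coeff ys"
  let ?f = "\<lambda>i. ?c i \<otimes> l [^] i"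
  define N where "N = {i. i \<le> length ys \<and> ?c i \<noteq> \<zero>}"
  have cC: "?c i \<in> carrier R" for i using ys(1) by simp
  have val: "u (?f i) = u (?c i) + nmul i (u l)" if "i \<in> N" for i
    using that u_mult[of "?c i" "l [^] i"] cC l pow_nonzero[OF l] u_pow[OF l] by (simp add: N_def)
  have "length ys \<in> N" using root_coeff_top[OF ys(1)] by (simp add: N_def)
  then have ne: "finite (u ` ?f ` N)" "u ` ?f ` N \<noteq> {}" by (auto simp: N_def)
  obtain k where k: "k \<in> N" "u (?f k) = Min (u ` ?f ` N)" using Min_in[OF ne] by auto
  have min: "u (?f k) \<le> u (?f i)" if "i \<in> N" for i using k(2) ne(1) that by simp
  have "\<exists>i\<in>N. i \<noteq> k \<and> u (?f i) = u (?f k)"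
  proof (rule ccontr)
    assume no: "\<not> ?thesis"
    have "finsum R ?f {..length ys} \<noteq> \<zero>"
    proof (rule finsum_unique_min)
      show "finite {..length ys}" "k \<in> {..length ys}" using k by (auto simp: N_def)
      show "?f k \<in> carrier R" "?f k \<noteq> \<zero>"
        using k cC l pow_nonzero[OF l] by (auto simp: N_def integral_iff)
      fix i assume i: "i \<in> {..length ys}" "i \<noteq> k"
      show "?f i \<in> vgt (u (?f k))"
      proof (cases "?c i = \<zero>")
        case True
        then show ?thesis using l by (simp add: zero_vgt)
      next
        case False
        then have "i \<in> N" using i by (simp add: N_def)
        then have "u (?f k) < u (?f i)" using min no i(2) by (metis less_le)
        then show ?thesis using cC l by (simp add: vgt_def)
      qed
    qed
    then show False using root_coeff_eval_root[OF ys(1,2)] by simp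
  qed
  then obtain i where i: "i \<in> N" "i \<noteq> k" "u (?f i) = u (?f k)" by blast
  have main: "\<exists>m>0. \<exists>c\<in>K - {\<zero>}. nmul m (u l) = u c"
    if ij: "i < j" "i \<in> N" "j \<in> N" "u (?f i) = u (?f j)" for i j
  proof -
    define m where "m = j - i"
    have j: "j = i + m" "0 < m" using ij(1) by (auto simp: m_def)
    have "u (?c i) + nmul i (u l) = u (?c j) + (nmul i (u l) + nmul m (u l))"
      using ij val nmul_plus[of i m "u l"] j by simp
    then have "nmul m (u l) = u (?c i) - u (?c j)" by (simp add: algebra_simps)
    also have "\<dots> = u (?c i \<otimes> inv (?c j))"
      using value_mult_inv[of "?c i" "?c j"] ij cC by (simp add: N_def)
    finally have "nmul m (u l) = u (?c i \<otimes> inv (?c j))" .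
    moreover have "inv (?c j) \<in> K"
      using subfield_m_inv(1)[OF K_subfield, of "?c j"] ys(3) ij by (simp add: N_def)
    then have "?c i \<otimes> inv (?c j) \<in> K" using subringE(6)[OF subfieldE(1)[OF K_subfield]] ys(3) by blast
    moreover have "?c i \<otimes> inv (?c j) \<noteq> \<zero>"
      using ij cC inv_closed_nonzero inv_nonzero by (simp add: N_def integral_iff)
    ultimately show ?thesis using j(2) by blast
  qed
  show ?thesis
    using main[of i k] main[of k i] i k(1) by (metis linorder_neqE_nat)
qed

text \<open>The two candidates differ by the unit \<open>y\<close>, so they cannot both have
  positive value.\<close>

lemma unit_of_squares:
  assumes y: "y \<in> carrier R" "y \<noteq> \<zero>" "u y = 0"
  shows "\<exists>q\<in>{\<one> \<oplus> y \<otimes> y, (\<one> \<oplus> y) \<oplus> y \<otimes> y}. q \<noteq> \<zero> \<and> u q = 0"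
proof (rule ccontr)
  assume no: "\<not> ?thesis"
  have 1: "\<one> \<in> vge 0" using u_one by (simp add: vge_def)
  have yv: "y \<in> vge 0" using y by (simp add: vge_def)
  have yy: "y \<otimes> y \<in> vge 0" using vge_mult[OF yv yv] by simp
  let ?a = "\<one> \<oplus> y \<otimes> y" and ?b = "(\<one> \<oplus> y) \<oplus> y \<otimes> y"
  have ge: "?a \<in> vge 0" "?b \<in> vge 0" using vge_add 1 yv yy by blast+
  have gt: "q \<in> vgt 0" if q: "q \<in> {?a, ?b}" "q \<in> vge 0" for q
  proof -
    have "q = \<zero> \<or> u q \<noteq> 0" using no q(1) by blast
    then show ?thesis using q(2) unfolding vge_def vgt_def by auto
  qed
  have "?a \<in> vgt 0" "?b \<in> vgt 0" using gt[OF _ ge(1)] gt[OF _ ge(2)] by simp_all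
  then have "?b \<oplus> \<ominus> ?a \<in> vgt 0" using vgt_add vgt_minus by blast
  moreover have "?b \<oplus> \<ominus> ?a = y"
  proof -
    have "?b = ?a \<oplus> y" using y by (simp add: a_ac)
    then show ?thesis using y by (simp add: a_ac r_neg)
  qed
  ultimately show False using y by (simp add: vgt_def)
qed

text \<open>If \<open>u y > 0\<close>, then 1 is the dominant term and \<open>u q = 0\<close>; if
  \<open>u y < 0\<close>, the square dominates and \<open>u q\<close> is twice \<open>u y\<close>.
  Thus \<open>y / q\<close> has positive value whenever \<open>u y\<close> is nonzero, whatever its
  sign.\<close>

lemma value_quotient_squares:
  assumes y: "y \<in> carrier R" "y \<noteq> \<zero>" "u y \<noteq> 0"
    and q: "q \<in> {\<one> \<oplus> y \<otimes> y, (\<one> \<oplus> y) \<oplus> y \<otimes> y}"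
  shows "q \<noteq> \<zero> \<and> u q < u y"
proof -
  have nz: "y \<otimes> y \<noteq> \<zero>" and v: "u (y \<otimes> y) = u y + u y" using y u_mult by (auto simp: integral_iff)
  have C: "q \<in> carrier R" using q y by auto
  consider "0 < u y" | "u y < 0" using y(3) by (meson linorder_neqE)
  then show ?thesis
  proof cases
    case 1
    have yv: "y \<in> vgt 0" using y 1 by (simp add: vgt_def)
    have yyv: "y \<otimes> y \<in> vgt 0" using nz v 1 y by (simp add: vgt_def)
    have "\<one> \<oplus> y \<otimes> y \<noteq> \<zero>" "u (\<one> \<oplus> y \<otimes> y) = 0"
      "\<one> \<oplus> (y \<oplus> y \<otimes> y) \<noteq> \<zero>" "u (\<one> \<oplus> (y \<oplus> y \<otimes> y)) = 0"
      using u_add_strict[of \<one> "y \<otimes> y"] u_add_strict[of \<one> "y \<oplus> y \<otimes> y"] yyv yv vgt_add[OF yv yyv] u_one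
      by auto
    then show ?thesis using q y 1 by (auto simp: a_assoc)
  next
    case 2
    have l: "u y + u y < u y" "u y + u y < 0" using 2 by (simp_all add: add_neg_neg)
    have yv: "y \<in> vgt (u (y \<otimes> y))" "\<one> \<in> vgt (u (y \<otimes> y))"
      using y l u_one by (simp_all add: vgt_def v)
    have "y \<otimes> y \<oplus> \<one> \<noteq> \<zero>" "u (y \<otimes> y \<oplus> \<one>) = u y + u y"
      "y \<otimes> y \<oplus> (\<one> \<oplus> y) \<noteq> \<zero>" "u (y \<otimes> y \<oplus> (\<one> \<oplus> y)) = u y + u y"
      using u_add_strict[of "y \<otimes> y" \<one>] u_add_strict[of "y \<otimes> y" "\<one> \<oplus> y"] yv vgt_add[OF yv(2,1)] nz y v
      by auto
    then show ?thesis using q y l by (auto simp: a_comm)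
  qed
qed

text \<open>It suffices to find a unit \<open>y\<close> of the valuation ring of \<open>L\<close>
  whose images under the embeddings that change values of \<open>L\<close> all have nonzero value.
  Dividing \<open>y\<close> by a unit among \<open>1 + y^2\<close> and \<open>1 + y + y^2\<close>
  then makes all these values positive, and a power of the quotient is separable.\<close>

lemma exists_separating_unit:
  assumes L: "subfield L R" "K \<subseteq> L" "finite_dimension K L"
  shows "\<exists>z\<in>L \<inter> separable_elems K. z \<noteq> \<zero> \<and> u z = 0 \<and>
    (\<forall>s\<in>field_auts R K. (\<forall>l\<in>L - {\<zero>}. u (s l) = u l) \<or> s z \<in> vgt 0)"
proof -
  note LC = subfieldE(3)[OF L(1)]
  note sr = subringE[OF subfieldE(1)[OF L(1)]]
  obtain Us where Us: "set Us \<subseteq> carrier R" "Span K Us = L"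
    using L(3) exists_base[OF K_subfield] by (metis finite_dimension_def)
  obtain G where G: "G \<subseteq> field_auts R K" "finite G"
    "\<forall>s\<in>field_auts R K. \<exists>s'\<in>G. \<forall>t\<in>set Us. s t = s' t"
    using finite_aut_representatives[of "set Us"] Us(1) by blast
  \<comment> \<open>So the finite set \<open>G\<close> represents all embeddings of \<open>L\<close>
    over \<open>K\<close>.\<close>
  have agree: "s x = s' x"
    if s: "s \<in> field_auts R K" "s' \<in> field_auts R K" "\<forall>t\<in>set Us. s t = s' t" and x: "x \<in> L" for s s' x
  proof -
    have "x \<in> Span K Us" using x Us(2) by simp
    with K_subfield Us(1) show ?thesis
    proof (induction rule: Span_combination_induct)
      case zero show ?case using s by simp
    next
      case (add k e v)
      have "k \<in> carrier R" "e \<in> carrier R" "v \<in> carrier R"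
        using add base_in_carrier Us Span_subgroup_props(1)[OF K_subfield Us(1)] by auto
      then show ?case using s add aut_fix[OF s(1)] aut_fix[OF s(2)] by simp
    qed
  qed
  define bad where "bad s \<longleftrightarrow> (\<exists>l\<in>L - {\<zero>}. u (s l) \<noteq> u l)" for s
  define M where "M = {y \<in> L - {\<zero>}. u y = 0}"
  have MC: "y \<in> carrier R \<and> y \<noteq> \<zero>" if "y \<in> M" for y using that LC by (auto simp: M_def)
  define \<Phi> where "\<Phi> = (\<lambda>s y. u (s y)) ` {s \<in> G. bad s}"
  have "\<exists>y\<in>M. \<forall>\<phi>\<in>\<Phi>. \<phi> y \<noteq> 0"
  proof (rule finite_homs_common_nonzero[of _ \<one> _ "(\<otimes>)"])
    show "finite \<Phi>" using G by (simp add: \<Phi>_def)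
    show "\<one> \<in> M" using sr(3) u_one by (simp add: M_def)
    show "x \<otimes> y \<in> M" if "x \<in> M" "y \<in> M" for x y
    proof -
      have "x \<otimes> y \<in> L" using that sr(6) by (simp add: M_def)
      moreover have "x \<otimes> y \<noteq> \<zero>" using MC[OF that(1)] MC[OF that(2)] by (simp add: integral_iff)
      moreover have "u (x \<otimes> y) = 0"
        using MC[OF that(1)] MC[OF that(2)] u_mult[of x y] that by (simp add: M_def)
      ultimately show ?thesis by (simp add: M_def)
    qed
    show "\<phi> (x \<otimes> y) = \<phi> x + \<phi> y" if p: "\<phi> \<in> \<Phi>" "x \<in> M" "y \<in> M" for \<phi> x y
    proof -
      obtain s where s: "s \<in> G" "\<phi> = (\<lambda>y. u (s y))" using p(1) by (auto simp: \<Phi>_def)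
      then have "s \<in> field_auts R K" using G by auto
      then show ?thesis using MC[OF p(2)] MC[OF p(3)] s(2) by (simp add: u_mult)
    qed
    show "\<exists>x\<in>M. \<phi> x \<noteq> 0" if p: "\<phi> \<in> \<Phi>" for \<phi>
    proof -
      obtain s where s: "s \<in> G" "bad s" "\<phi> = (\<lambda>y. u (s y))" using p by (auto simp: \<Phi>_def)
      then have sK: "s \<in> field_auts R K" using G by auto
      obtain l where l: "l \<in> L - {\<zero>}" "u (s l) \<noteq> u l" using s(2) by (auto simp: bad_def)
      then have lC: "l \<in> carrier R" "l \<noteq> \<zero>" using LC by auto
      obtain m c where mc: "0 < m" "c \<in> K - {\<zero>}" "nmul m (u l) = u c"
        using value_torsion[OF lC] by blast
      have c: "c \<in> carrier R" "c \<noteq> \<zero>" using mc base_in_carrier by auto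
      \<comment> \<open>If \<open>s\<close> changes the value of \<open>l\<close>, it also changes
        that of \<open>l^m / c\<close>, because \<open>c\<close> is fixed and ordered groups are
        torsion free; but \<open>l^m / c\<close> has value zero.\<close>
      let ?x = "l [^] m \<otimes> inv c"
      have pC: "l [^] m \<in> carrier R" "l [^] m \<noteq> \<zero>" using lC pow_nonzero by auto
      have "l [^] m \<in> L" using l(1) by (induction m) (simp_all add: sr(3,6))
      moreover have "inv c \<in> L" using subfield_m_inv(1)[OF L(1), of c] mc(2) L(2) by blast
      ultimately have "?x \<in> L" using sr(6) by blast
      moreover have "?x \<noteq> \<zero>" using pC c inv_closed_nonzero inv_nonzero by (simp add: integral_iff)
      moreover have "u ?x = 0" using value_mult_inv[OF pC(1) c(1) pC(2) c(2)] u_pow[OF lC] mc(3) by simp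
      ultimately have xM: "?x \<in> M" by (simp add: M_def)
      have "s ?x = s l [^] m \<otimes> inv c"
        using sK pC c inv_closed_nonzero aut_inv[OF sK c] aut_fix[OF sK] mc(2) lC by simp
      then have "u (s ?x) = nmul m (u (s l)) - u c"
        using value_mult_inv[of "s l [^] m" c] pow_nonzero[of "s l" m] sK lC c u_pow[of "s l" m] by simp
      also have "\<dots> \<noteq> 0" using nmul_eq_iff[OF mc(1)] l(2) mc(3) by (metis eq_iff_diff_eq_0)
      finally show ?thesis using xM s(3) by auto
    qed
  qed
  then obtain y where y: "y \<in> M" "\<forall>\<phi>\<in>\<Phi>. \<phi> y \<noteq> 0" by blast
  have yL: "y \<in> L" and yC: "y \<in> carrier R" "y \<noteq> \<zero>" "u y = 0" using y(1) LC by (auto simp: M_def)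
  define F where "F x = {\<one> \<oplus> x \<otimes> x, (\<one> \<oplus> x) \<oplus> x \<otimes> x}" for x
  obtain q where q: "q \<in> F y" "q \<noteq> \<zero>" "u q = 0"
    using unit_of_squares[OF yC] unfolding F_def by blast
  have qC: "q \<in> carrier R" using q(1) yC by (auto simp: F_def)
  have qL: "q \<in> L" using q(1) yL sr(3,6,7) by (auto simp: F_def)
  define z0 where "z0 = y \<otimes> inv q"
  have z0L: "z0 \<in> L" unfolding z0_def using subfield_m_inv(1)[OF L(1), of q] qL q(2) yL sr(6) by blast
  have z0: "z0 \<in> carrier R" "z0 \<noteq> \<zero>" "u z0 = 0"
    using yC qC q inv_closed_nonzero inv_nonzero value_mult_inv[of y q] by (auto simp: z0_def integral_iff)
  have pos: "0 < u (s z0)" if s: "s \<in> field_auts R K" "bad s" for s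
  proof -
    obtain s' where s': "s' \<in> G" "\<forall>t\<in>set Us. s t = s' t" using G(3) s(1) by blast
    then have s'K: "s' \<in> field_auts R K" using G(1) by blast
    have "bad s'" using s(2) agree[OF s(1) s'K s'(2)] unfolding bad_def by auto
    then have "u (s' y) \<noteq> 0" using y(2) s'(1) by (auto simp: \<Phi>_def)
    then have sy: "u (s y) \<noteq> 0" using agree[OF s(1) s'K s'(2) yL] by simp
    have "s q \<in> F (s y)" using q(1) s(1) yC by (auto simp: F_def)
    then have sq: "u (s q) < u (s y)"
      using value_quotient_squares[of "s y" "s q"] sy s(1) yC by (auto simp: F_def)
    have "s z0 = s y \<otimes> inv (s q)"
      using s(1) yC qC q(2) inv_closed_nonzero aut_inv[OF s(1) qC q(2)] by (simp add: z0_def)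
    then have "u (s z0) = u (s y) - u (s q)"
      using value_mult_inv[of "s y" "s q"] s(1) yC qC q(2) by simp
    then show ?thesis using sq by simp
  qed
  \<comment> \<open>Taking a power changes neither the vanishing nor the positivity of a
    value.\<close>
  obtain d where d: "d \<in> additive_exps" "z0 [^] d \<in> separable_elems K"
    using exists_separable_power[OF z0(1)] by blast
  have d0: "0 < d" using additive_expsD(1)[OF d(1)] by simp
  have "z0 [^] d \<in> L" using z0L by (induction d) (simp_all add: sr(3,6))
  moreover have "z0 [^] d \<noteq> \<zero>" "u (z0 [^] d) = 0" using pow_nonzero z0 u_pow by simp_all
  moreover have "(\<forall>l\<in>L - {\<zero>}. u (s l) = u l) \<or> s (z0 [^] d) \<in> vgt 0" if s: "s \<in> field_auts R K" for s
  proof (cases "bad s")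
    case True
    have "0 < u (s z0 [^] d)"
      using u_pow[of "s z0" d] nmul_pos[OF pos[OF s True] d0] s z0 by simp
    then show ?thesis using s z0 by (simp add: vgt_def)
  qed (simp add: bad_def)
  ultimately show ?thesis using d(2) by blast
qed

end


section \<open>Relations over the valuation ring\<close>

context closed_extension
begin

text \<open>Artin's shortest-relation argument.\<close>

lemma conjugate_relations_trivial:
  assumes J: "finite J" and b: "\<And>j. j \<in> J \<Longrightarrow> b j \<in> carrier R"
    and indep: "\<And>k. (\<forall>j\<in>J. k j \<in> K) \<Longrightarrow> (\<Oplus>j\<in>J. k j \<otimes> b j) = \<zero> \<Longrightarrow> \<forall>j\<in>J. k j = \<zero>"
    and h: "\<forall>j\<in>J. h j \<in> separable_elems K"
      "\<forall>s\<in>field_auts R K. (\<Oplus>j\<in>J. h j \<otimes> s (b j)) = \<zero>"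
  shows "\<forall>j\<in>J. h j = \<zero>"
proof (rule ccontr)
  assume nonzero: "\<not> ?thesis"
  note sepC = separable_elems_carrier[OF K_subfield]
  note sr = subringE[OF subfieldE(1)[OF separable_elems_subfield]]
  define S where "S = {h. (\<forall>j\<in>J. h j \<in> separable_elems K) \<and>
    (\<forall>s\<in>field_auts R K. (\<Oplus>j\<in>J. h j \<otimes> s (b j)) = \<zero>)}"
  define supp where "supp h = {j \<in> J. h j \<noteq> \<zero>}" for h :: "'c \<Rightarrow> 'a"
  have "h \<in> S \<and> supp h \<noteq> {}" using h nonzero by (auto simp: S_def supp_def)
  then obtain g where g: "g \<in> S" "supp g \<noteq> {}"
    "\<forall>h. h \<in> S \<and> supp h \<noteq> {} \<longrightarrow> card (supp g) \<le> card (supp h)"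
    using arg_min_nat_lemma[of "\<lambda>h. h \<in> S \<and> supp h \<noteq> {}" h "\<lambda>h. card (supp h)"] by blast
  obtain j1 where j1: "j1 \<in> J" "g j1 \<noteq> \<zero>" using g(2) by (auto simp: supp_def)
  have gS: "g j \<in> separable_elems K" if "j \<in> J" for j using g(1) that by (simp add: S_def)
  then have gC: "g j \<in> carrier R" if "j \<in> J" for j using sepC that by blast
  define c where "c = inv (g j1)"
  have cS: "c \<in> separable_elems K"
    unfolding c_def using subfield_m_inv(1)[OF separable_elems_subfield, of "g j1"] gS j1 by blast
  have cC: "c \<in> carrier R" using cS sepC by blast
  have c0: "c \<noteq> \<zero>" unfolding c_def using inv_nonzero gC j1 by blast
  define f where "f j = c \<otimes> g j" for j
  have fS: "f j \<in> separable_elems K" if "j \<in> J" for j unfolding f_def using sr(6) cS gS that by blast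
  then have fC: "f j \<in> carrier R" if "j \<in> J" for j using sepC that by blast
  have f1: "f j1 = \<one>" unfolding f_def c_def using l_inv_nonzero gC j1 by blast
  have frel: "(\<Oplus>j\<in>J. f j \<otimes> s (b j)) = \<zero>" if s: "s \<in> field_auts R K" for s
  proof -
    have "(\<Oplus>j\<in>J. f j \<otimes> s (b j)) = (\<Oplus>j\<in>J. c \<otimes> (g j \<otimes> s (b j)))"
      using gC cC b s by (intro finsum_cong') (auto simp: f_def m_assoc)
    also have "\<dots> = c \<otimes> (\<Oplus>j\<in>J. g j \<otimes> s (b j))"
      using gC cC b s J by (intro finsum_rdistr[symmetric]) auto
    also have "(\<Oplus>j\<in>J. g j \<otimes> s (b j)) = \<zero>" using g(1) s by (simp add: S_def)
    finally show ?thesis using cC by simp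
  qed
  have fixed: "r (f j) = f j" if r: "r \<in> field_auts R K" and j: "j \<in> J" for r j
  proof -
    \<comment> \<open>At \<open>j1\<close> the entry of \<open>f\<close> is 1, which
      \<open>r\<close> fixes. So the difference has strictly smaller support and must vanish by
      minimality.\<close>
    define d where "d j = r (f j) \<oplus> \<ominus> f j" for j
    have dS: "d j \<in> separable_elems K" if "j \<in> J" for j
      unfolding d_def using sr(5,7) separable_elems_aut[OF K_subfield r] fS[OF that] by blast
    have "(\<Oplus>j\<in>J. d j \<otimes> s (b j)) = \<zero>" if s: "s \<in> field_auts R K" for s
    proof -
      \<comment> \<open>Applying \<open>r\<close> to the relation for \<open>t\<close> after
        \<open>s\<close>, where \<open>t\<close> is the inverse of \<open>r\<close>, gives the
        relation for \<open>s\<close> with coefficients \<open>r (f j)\<close>.\<close>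
      obtain t where t: "t \<in> field_auts R K" "\<forall>x\<in>carrier R. t (r x) = x \<and> r (t x) = x"
        using aut_inverse[OF r base_in_carrier] by blast
      have ts: "(\<lambda>x. t (s x)) \<in> field_auts R K" by (rule aut_compose[OF t(1) s])
      have A: "(\<Oplus>j\<in>J. r (f j) \<otimes> s (b j)) = \<zero>"
      proof -
        have "(\<Oplus>j\<in>J. r (f j) \<otimes> s (b j)) = (\<Oplus>j\<in>J. r (f j \<otimes> t (s (b j))))"
          using fC b r s t by (intro finsum_cong') auto
        also have "\<dots> = r (\<Oplus>j\<in>J. f j \<otimes> t (s (b j)))"
          by (rule aut_finsum[OF r, symmetric]) (use fC b s t in auto)
        finally show ?thesis using frel[OF ts] r by simp
      qed
      have "(\<Oplus>j\<in>J. d j \<otimes> s (b j)) = (\<Oplus>j\<in>J. r (f j) \<otimes> s (b j) \<oplus> \<ominus> \<one> \<otimes> (f j \<otimes> s (b j)))"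
        using fC b r s by (intro finsum_cong') (auto simp: d_def l_distr l_minus)
      also have "\<dots> = (\<Oplus>j\<in>J. r (f j) \<otimes> s (b j)) \<oplus> (\<Oplus>j\<in>J. \<ominus> \<one> \<otimes> (f j \<otimes> s (b j)))"
        using fC b r s by (intro finsum_addf) auto
      also have "(\<Oplus>j\<in>J. \<ominus> \<one> \<otimes> (f j \<otimes> s (b j))) = \<ominus> \<one> \<otimes> (\<Oplus>j\<in>J. f j \<otimes> s (b j))"
        using fC b s J by (intro finsum_rdistr[symmetric]) auto
      finally show ?thesis using A frel[OF s] by simp
    qed
    then have dSS: "d \<in> S" using dS by (simp add: S_def)
    have "supp d \<subseteq> supp g - {j1}"
    proof
      fix j assume j: "j \<in> supp d"
      then have jJ: "j \<in> J" "d j \<noteq> \<zero>" by (auto simp: supp_def)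
      have "j \<noteq> j1" using jJ f1 r by (auto simp: d_def r_neg)
      moreover have "g j \<noteq> \<zero>"
      proof
        assume "g j = \<zero>"
        then show False using jJ(2) cC r by (simp add: d_def f_def)
      qed
      ultimately show "j \<in> supp g - {j1}" using jJ by (simp add: supp_def)
    qed
    moreover have "j1 \<in> supp g" "finite (supp g)" using j1 J by (auto simp: supp_def)
    ultimately have "card (supp d) < card (supp g)"
      by (metis Diff_subset card_mono card_Diff1_less finite_Diff le_less_trans)
    then have "supp d = {}" using g(3) dSS by (metis not_le)
    then have "d j = \<zero>" using j by (auto simp: supp_def)
    then have "r (f j) = \<ominus> (\<ominus> f j)"
      unfolding d_def using fC[OF j] r minus_equality[of "r (f j)" "\<ominus> f j"] by simp
    then show ?thesis using fC[OF j] by simp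
  qed
  have "f j \<in> K" if "j \<in> J" for j
    using separable_fixed_in_base[OF fS[OF that]] fixed that by blast
  moreover have "(\<Oplus>j\<in>J. f j \<otimes> b j) = \<zero>" using frel[OF aut_id] .
  ultimately have "f j1 = \<zero>" using indep[of f] j1 by blast
  then show False using f1 by simp
qed

end

context valued_closed_extension
begin

lemma exists_min_value:
  assumes "finite J" "j0 \<in> J" "k j0 \<noteq> \<zero>"
  shows "\<exists>m\<in>J. k m \<noteq> \<zero> \<and> (\<forall>j\<in>J. k j \<noteq> \<zero> \<longrightarrow> u (k m) \<le> u (k j))"
proof -
  let ?S = "(\<lambda>j. u (k j)) ` {j \<in> J. k j \<noteq> \<zero>}"
  have fin: "finite ?S" "?S \<noteq> {}" using assms by auto
  have "Min ?S \<in> ?S" by (rule Min_in[OF fin])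
  then obtain m where "Min ?S = u (k m)" "m \<in> {j \<in> J. k j \<noteq> \<zero>}" by (rule imageE)
  then have m: "m \<in> J" "k m \<noteq> \<zero>" "u (k m) = Min ?S" by simp_all
  have "u (k m) \<le> u (k j)" if "j \<in> J" "k j \<noteq> \<zero>" for j
    unfolding m(3) using fin(1) that by (intro Min_le) auto
  then show ?thesis using m by blast
qed

lemma quotient_vge:
  assumes "x \<in> carrier R" "y \<in> carrier R" "y \<noteq> \<zero>" "x \<noteq> \<zero> \<Longrightarrow> u y \<le> u x"
  shows "x \<otimes> inv y \<in> vge 0"
proof (cases "x = \<zero>")
  case True
  then show ?thesis using assms inv_closed_nonzero by (simp add: zero_vge)
next
  case False
  then show ?thesis using assms inv_closed_nonzero value_mult_inv[of x y] by (simp add: vge_def)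
qed

lemma relation_over_valuation_ring:
  fixes y c :: "'i \<Rightarrow> 'a"
  assumes L: "subfield L R" "K \<subseteq> L"
    and z: "z \<in> L" "z \<in> separable_elems K"
    and zs: "set zs \<subseteq> vgt 0" "set zs \<subseteq> separable_elems K"
      "\<forall>s\<in>field_auts R K. (\<forall>l\<in>L - {\<zero>}. u (s l) = u l) \<or> s z \<in> set zs"
    and I: "finite I" and y: "\<forall>i\<in>I. y i \<in> L"
    and c: "\<forall>i\<in>I. c i \<in> decomposition_field u K" "i0 \<in> I" "c i0 \<noteq> \<zero>"
      "(\<Oplus>i\<in>I. c i \<otimes> y i) = \<zero>"
  shows "\<exists>a. (\<forall>p\<in>{..length zs} \<times> I. a p \<in> K \<inter> vge 0 \<and> (fst p < length zs \<longrightarrow> a p \<in> vgt 0)) \<and>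
    (\<exists>i\<in>I. a (length zs, i) \<notin> vgt 0) \<and>
    (\<Oplus>p\<in>{..length zs} \<times> I. a p \<otimes> (z [^] fst p \<otimes> y (snd p))) = \<zero>"
proof (rule ccontr)
  assume none: "\<not> ?thesis"
  let ?D = "decomposition_field u K"
  note K = K_subfield
  note sr = subringE[OF subfieldE(1)[OF K]]
  note LC = subfieldE(3)[OF L(1)]
  note DC = subfieldE(3)[OF decomposition_field_subfield[of u]]
  note sepC = separable_elems_carrier[OF K]
  define n where "n = length zs"
  define P where "P = {..n} \<times> I"
  define W where "W = {n} \<times> I"
  define b :: "nat \<times> 'i \<Rightarrow> 'a" where "b p = z [^] fst p \<otimes> y (snd p)" for p
  define V where "V = K \<inter> vge 0"
  have zC: "z \<in> carrier R" and yC: "\<And>i. i \<in> I \<Longrightarrow> y i \<in> carrier R" using z y LC by auto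
  have finP: "finite P" using I by (simp add: P_def)
  have WP: "W \<subseteq> P" by (auto simp: W_def P_def)
  have bC: "b p \<in> carrier R" if "p \<in> P" for p using that zC yC by (auto simp: P_def b_def)
  have OC: "V \<subseteq> carrier R" using vge_carrier by (auto simp: V_def)
  have V_add: "x \<oplus> y \<in> V" if "x \<in> V" "y \<in> V" for x y
    using that sr(7) vge_add by (auto simp: V_def)
  have V_mult: "x \<otimes> y \<in> V" if "x \<in> V" "y \<in> V" for x y
    using that sr(6) vge_mult[of x 0 y 0] by (auto simp: V_def)
  have V_minus: "\<ominus> x \<in> V" if "x \<in> V" for x
    using that sr(5) vge_minus by (auto simp: V_def)
  have V_01: "\<zero> \<in> V" "\<one> \<in> V" using sr(2,3) zero_vge u_one by (auto simp: V_def vge_def)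
  have none': False if "\<forall>p\<in>P. a p \<in> V" "\<forall>p\<in>P. p \<notin> W \<longrightarrow> a p \<in> vgt 0" "w \<in> W" "a w \<notin> vgt 0"
    "(\<Oplus>p\<in>P. a p \<otimes> b p) = \<zero>" for a w
  proof -
    have 1: "\<forall>p\<in>{..length zs} \<times> I. a p \<in> K \<inter> vge 0 \<and> (fst p < length zs \<longrightarrow> a p \<in> vgt 0)"
      using that(1,2) unfolding P_def V_def n_def W_def by auto
    have 2: "\<exists>i\<in>I. a (length zs, i) \<notin> vgt 0" using that(3,4) unfolding W_def n_def by auto
    have 3: "(\<Oplus>p\<in>{..length zs} \<times> I. a p \<otimes> (z [^] fst p \<otimes> y (snd p))) = \<zero>"
      using that(5) unfolding P_def n_def b_def .
    show False using none 1 2 3 by blast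
  qed
  \<comment> \<open>The members of \<open>W\<close>, those with exponent \<open>n\<close>, are never
    discarded: coordinates at these positions yield the final contradiction.\<close>
  define gen where "gen J \<longleftrightarrow> W \<subseteq> J \<and> J \<subseteq> P \<and>
    (\<forall>p\<in>P. \<exists>a. (\<forall>j\<in>J. a j \<in> V) \<and> b p = (\<Oplus>j\<in>J. a j \<otimes> b j))" for J
  have delta: "(\<Oplus>j\<in>J. (if p = j then \<one> else \<zero>) \<otimes> b j) = b p" if "p \<in> J" "J \<subseteq> P" for p J
  proof -
    have "finite J" using that finP finite_subset by blast
    have "(\<Oplus>j\<in>J. (if p = j then \<one> else \<zero>) \<otimes> b j) = (\<Oplus>j\<in>J. if p = j then b j else \<zero>)"
      using bC that by (intro finsum_cong') auto
    also have "\<dots> = b p"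
      by (rule finsum_singleton) (use that \<open>finite J\<close> bC in auto)
    finally show ?thesis .
  qed
  have "gen P"
    unfolding gen_def
  proof (intro conjI ballI WP subset_refl)
    fix p assume "p \<in> P"
    then show "\<exists>a. (\<forall>j\<in>P. a j \<in> V) \<and> b p = (\<Oplus>j\<in>P. a j \<otimes> b j)"
      using delta[OF _ subset_refl, of p] V_01
      by (intro exI[of _ "\<lambda>j. if p = j then \<one> else \<zero>"]) auto
  qed
  then obtain J where J: "gen J" "\<forall>J'. gen J' \<longrightarrow> card J \<le> card J'"
    using arg_min_nat_lemma[of gen P card] by blast
  have WJ: "W \<subseteq> J" and JP: "J \<subseteq> P" using J(1) by (auto simp: gen_def)
  have finJ: "finite J" using JP finP finite_subset by blast
  have bJ: "b j \<in> carrier R" if "j \<in> J" for j using bC JP that by blast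
  have indep: "\<forall>j\<in>J. k j = \<zero>" if kK: "\<forall>j\<in>J. k j \<in> K" and rel: "(\<Oplus>j\<in>J. k j \<otimes> b j) = \<zero>" for k
  proof (rule ccontr)
    assume "\<not> ?thesis"
    then obtain j0 where "j0 \<in> J" "k j0 \<noteq> \<zero>" by blast
    from exists_min_value[OF finJ, of j0 k] this obtain jm where
      jm: "jm \<in> J" "k jm \<noteq> \<zero>" "\<forall>j\<in>J. k j \<noteq> \<zero> \<longrightarrow> u (k jm) \<le> u (k j)" by blast
    have kC: "k j \<in> carrier R" if "j \<in> J" for j using kK that base_in_carrier by blast
    define r where "r i j = k j \<otimes> inv (k i)" for i j
    have rO: "r i j \<in> V" if ij: "i \<in> J" "j \<in> J" "k i \<noteq> \<zero>" "u (k i) = u (k jm)" for i j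
    proof -
      have "inv (k i) \<in> K" using subfield_m_inv(1)[OF K, of "k i"] kK ij by blast
      then have "r i j \<in> K" unfolding r_def using sr(6) kK ij(2) by blast
      moreover have "r i j \<in> vge 0"
        unfolding r_def by (rule quotient_vge) (use kC ij jm in auto)
      ultimately show ?thesis by (simp add: V_def)
    qed
    have rrel: "(\<Oplus>j\<in>J. r i j \<otimes> b j) = \<zero>" if i: "i \<in> J" "k i \<noteq> \<zero>" for i
    proof -
      have iC: "inv (k i) \<in> carrier R" using inv_closed_nonzero kC i by blast
      have "(\<Oplus>j\<in>J. r i j \<otimes> b j) = (\<Oplus>j\<in>J. inv (k i) \<otimes> (k j \<otimes> b j))"
        using kC bJ iC by (intro finsum_cong') (auto simp: r_def m_ac)
      also have "\<dots> = inv (k i) \<otimes> (\<Oplus>j\<in>J. k j \<otimes> b j)"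
        using kC bJ iC finJ by (intro finsum_rdistr[symmetric]) auto
      finally show ?thesis using rel iC by simp
    qed
    have rC: "r i j \<in> carrier R" if "i \<in> J" "j \<in> J" "k i \<noteq> \<zero>" for i j
      unfolding r_def using kC inv_closed_nonzero that by simp
    show False
    proof (cases "\<exists>i\<in>J - W. k i \<noteq> \<zero> \<and> u (k i) = u (k jm)")
      case True
      then obtain i where i: "i \<in> J" "i \<notin> W" "k i \<noteq> \<zero>" "u (k i) = u (k jm)" by blast
      let ?J = "J - {i}"
      have finJ': "finite ?J" using finJ by simp
      have ri: "r i i = \<one>" unfolding r_def using r_inv_nonzero kC i by blast
      have bi: "b i \<oplus> (\<Oplus>j\<in>?J. r i j \<otimes> b j) = \<zero>"
      proof -
        have "(\<Oplus>j\<in>insert i ?J. r i j \<otimes> b j) = r i i \<otimes> b i \<oplus> (\<Oplus>j\<in>?J. r i j \<otimes> b j)"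
          by (rule finsum_insert) (use finJ rC bJ i in auto)
        then show ?thesis using rrel[OF i(1,3)] ri bJ[OF i(1)] i(1) by (simp add: insert_absorb)
      qed
      have "gen ?J"
        unfolding gen_def
      proof (intro conjI ballI)
        show "W \<subseteq> ?J" "?J \<subseteq> P" using WJ JP i by auto
        fix p assume "p \<in> P"
        then obtain a where a: "\<forall>j\<in>J. a j \<in> V" "b p = (\<Oplus>j\<in>J. a j \<otimes> b j)"
          using J(1) unfolding gen_def by blast
        have aC: "a j \<in> carrier R" if "j \<in> J" for j using a(1) OC that by blast
        define a' where "a' j = a j \<oplus> \<ominus> (a i \<otimes> r i j)" for j
        have "\<forall>j\<in>?J. a' j \<in> V"
        proof
          fix j assume "j \<in> ?J"
          then have j: "j \<in> J" by simp
          have "a i \<otimes> r i j \<in> V" by (rule V_mult) (use a(1) i j rO in auto)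
          then show "a' j \<in> V" unfolding a'_def using V_add V_minus a(1) j by simp
        qed
        moreover have "b p = (\<Oplus>j\<in>?J. a' j \<otimes> b j)"
        proof -
          let ?S = "\<Oplus>j\<in>?J. r i j \<otimes> b j" and ?A = "\<Oplus>j\<in>?J. a j \<otimes> b j"
          have SC: "?S \<in> carrier R" "?A \<in> carrier R" using rC bJ aC i by auto
          have "b i = \<ominus> ?S" using bi bJ[OF i(1)] SC by (simp add: minus_equality)
          then have bi': "a i \<otimes> b i = (\<ominus> a i) \<otimes> ?S"
            using aC[OF i(1)] SC by (simp add: l_minus r_minus)
          have "b p = (\<Oplus>j\<in>insert i ?J. a j \<otimes> b j)" using a(2) i(1) by (simp add: insert_absorb)
          also have "\<dots> = a i \<otimes> b i \<oplus> ?A"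
            by (rule finsum_insert) (use finJ aC bJ i in auto)
          also have "\<dots> = ?A \<oplus> (\<ominus> a i) \<otimes> ?S"
            unfolding bi' using SC aC[OF i(1)] by (simp add: a_comm)
          also have "(\<ominus> a i) \<otimes> ?S = (\<Oplus>j\<in>?J. (\<ominus> a i) \<otimes> (r i j \<otimes> b j))"
            using finJ' rC bJ aC i by (intro finsum_rdistr) auto
          also have "?A \<oplus> \<dots> = (\<Oplus>j\<in>?J. a j \<otimes> b j \<oplus> (\<ominus> a i) \<otimes> (r i j \<otimes> b j))"
            using rC bJ aC i by (intro finsum_addf[symmetric]) auto
          also have "\<dots> = (\<Oplus>j\<in>?J. a' j \<otimes> b j)"
            using rC bJ aC i by (intro finsum_cong') (auto simp: a'_def l_distr l_minus m_assoc)
          finally show ?thesis .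
        qed
        ultimately show "\<exists>a. (\<forall>j\<in>?J. a j \<in> V) \<and> b p = (\<Oplus>j\<in>?J. a j \<otimes> b j)" by blast
      qed
      then have "card J \<le> card ?J" using J(2) by blast
      then show False using card_Diff1_less[OF finJ i(1)] by simp
    next
      case False
      \<comment> \<open>Here the coefficients of least value all sit at exponent \<open>n\<close>.
        Division by one of them yields the very relation assumed not to exist.\<close>
      define a where "a p = (if p \<in> J then r jm p else \<zero>)" for p
      have jmW: "jm \<in> W" using False jm by blast
      have aO: "\<forall>p\<in>P. a p \<in> V" using rO[OF jm(1) _ jm(2) refl] V_01 by (simp add: a_def)
      moreover have "\<forall>p\<in>P. p \<notin> W \<longrightarrow> a p \<in> vgt 0"
      proof (intro ballI impI)
        fix p assume p: "p \<in> P" "p \<notin> W"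
        show "a p \<in> vgt 0"
        proof (cases "p \<in> J \<and> k p \<noteq> \<zero>")
          case True
          then have "u (k jm) < u (k p)" using False jm(3) p(2) by (metis DiffI less_le)
          then show ?thesis
            using True rC[OF jm(1) _ jm(2)] value_mult_inv[of "k p" "k jm"] kC jm
            by (simp add: a_def vgt_def r_def)
        next
          case False
          then have "a p = \<zero>" using inv_closed_nonzero kC jm by (auto simp: a_def r_def)
          then show ?thesis by (simp add: zero_vgt)
        qed
      qed
      moreover have "a jm \<notin> vgt 0"
        using r_inv_nonzero[OF kC[OF jm(1)] jm(2)] jm(1) u_one by (simp add: a_def r_def vgt_def)
      moreover have "(\<Oplus>p\<in>P. a p \<otimes> b p) = \<zero>"
      proof -
        have "(\<Oplus>p\<in>P. a p \<otimes> b p) = (\<Oplus>j\<in>J. r jm j \<otimes> b j)"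
          by (rule add.finprod_mono_neutral_cong_right)
            (use finP JP bC rC[OF jm(1) _ jm(2)] bJ in \<open>auto simp: a_def\<close>)
        then show ?thesis using rrel[OF jm(1,2)] by simp
      qed
      ultimately show False using none' jmW by blast
    qed
  qed
  \<comment> \<open>Members of \<open>W\<close> belong to \<open>J\<close> and get unit vectors as
    coordinates, which isolates the coefficients at \<open>z^n\<close>.\<close>
  have "\<forall>p\<in>P. \<exists>a. (\<forall>j\<in>J. a j \<in> V) \<and> b p = (\<Oplus>j\<in>J. a j \<otimes> b j) \<and>
      (p \<in> W \<longrightarrow> (\<forall>j\<in>J. a j = (if p = j then \<one> else \<zero>)))"
  proof
    fix p assume p: "p \<in> P"
    show "\<exists>a. (\<forall>j\<in>J. a j \<in> V) \<and> b p = (\<Oplus>j\<in>J. a j \<otimes> b j) \<and>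
      (p \<in> W \<longrightarrow> (\<forall>j\<in>J. a j = (if p = j then \<one> else \<zero>)))"
    proof (cases "p \<in> W")
      case True
      then have "p \<in> J" using WJ by blast
      then show ?thesis using delta[OF _ JP, of p] V_01
        by (intro exI[of _ "\<lambda>j. if p = j then \<one> else \<zero>"]) simp
    next
      case False
      then show ?thesis using J(1) p unfolding gen_def by blast
    qed
  qed
  then obtain A where A: "\<forall>p\<in>P. (\<forall>j\<in>J. A p j \<in> V) \<and> b p = (\<Oplus>j\<in>J. A p j \<otimes> b j) \<and>
      (p \<in> W \<longrightarrow> (\<forall>j\<in>J. A p j = (if p = j then \<one> else \<zero>)))"
    by metis
  have AO: "A p j \<in> V" if "p \<in> P" "j \<in> J" for p j using A that by blast
  then have AC: "A p j \<in> carrier R" if "p \<in> P" "j \<in> J" for p j using OC that by blast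
  obtain im where im: "im \<in> I" "c im \<noteq> \<zero>" "\<forall>i\<in>I. c i \<noteq> \<zero> \<longrightarrow> u (c im) \<le> u (c i)"
    using exists_min_value[OF I c(2), of c] c(3) by blast
  have cC: "c i \<in> carrier R" if "i \<in> I" for i using c(1) DC that by blast
  \<comment> \<open>Division by a coefficient of least value makes all coefficients integral and the
    one at \<open>im\<close> equal to 1.\<close>
  define e where "e i = c i \<otimes> inv (c im)" for i
  have invC: "inv (c im) \<in> carrier R" using inv_closed_nonzero cC im by blast
  have eC: "e i \<in> carrier R" if "i \<in> I" for i using cC invC that by (simp add: e_def)
  have "inv (c im) \<in> ?D"
    using subfield_m_inv(1)[OF decomposition_field_subfield, of "c im"] c(1) im by blast
  then have eD: "e i \<in> ?D" if "i \<in> I" for i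
    unfolding e_def using subringE(6)[OF subfieldE(1)[OF decomposition_field_subfield]] c(1) that by blast
  then have eS: "e i \<in> separable_elems K" if "i \<in> I" for i
    using that by (auto simp: decomposition_field_def)
  have ege: "e i \<in> vge 0" if "i \<in> I" for i
    unfolding e_def by (rule quotient_vge) (use cC im that in auto)
  have eim: "e im = \<one>" unfolding e_def using r_inv_nonzero cC im by blast
  have erel: "(\<Oplus>i\<in>I. e i \<otimes> y i) = \<zero>"
  proof -
    have "(\<Oplus>i\<in>I. e i \<otimes> y i) = (\<Oplus>i\<in>I. inv (c im) \<otimes> (c i \<otimes> y i))"
      using cC yC invC by (intro finsum_cong') (auto simp: e_def m_ac)
    also have "\<dots> = inv (c im) \<otimes> (\<Oplus>i\<in>I. c i \<otimes> y i)"
      using cC yC invC I by (intro finsum_rdistr[symmetric]) auto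
    finally show ?thesis using c(4) invC by simp
  qed
  have zsC: "set zs \<subseteq> carrier R" using zs(1) vgt_carrier by blast
  define g where "g = root_coeff zs"
  have gC: "g m \<in> carrier R" for m unfolding g_def using zsC by simp
  have gS: "g m \<in> separable_elems K" for m
    unfolding g_def using root_coeff_subfield[OF separable_elems_subfield zs(2)] .
  \<comment> \<open>The coordinates of \<open>z^m\<close> times the given relation, expanded
    formally in the family indexed by \<open>J\<close>.\<close>
  define t where "t m j = (\<Oplus>i\<in>I. e i \<otimes> A (m, i) j)" for m j
  have mP: "(m, i) \<in> P" if "m \<in> {..n}" "i \<in> I" for m i using that by (simp add: P_def)
  have tC: "t m j \<in> carrier R" if "m \<in> {..n}" "j \<in> J" for m j
    unfolding t_def using eC AC[OF mP[OF that(1)] that(2)] by auto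
  have tge: "t m j \<in> vge 0" if mj: "m \<in> {..n}" "j \<in> J" for m j
    unfolding t_def
  proof (rule vge_finsum)
    fix i assume i: "i \<in> I"
    have "A (m, i) j \<in> vge 0" using AO[OF mP[OF mj(1) i] mj(2)] by (simp add: V_def)
    then show "e i \<otimes> A (m, i) j \<in> vge 0" using vge_mult[OF ege[OF i]] by simp
  qed
  note sS = subringE[OF subfieldE(1)[OF separable_elems_subfield]]
  have sep_sum: "(\<Oplus>i\<in>B. f i) \<in> separable_elems K" if "finite B" "\<forall>i\<in>B. f i \<in> separable_elems K"
    for B :: "'k set" and f
    using that
  proof (induction B rule: finite_induct)
    case (insert x B)
    then have "f \<in> B \<rightarrow> carrier R" "f x \<in> carrier R" using sepC by auto
    then show ?case using insert sS(7) by simp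
  qed (simp add: sS(2))
  \<comment> \<open>The coordinates of \<open>g(z)\<close> times the relation. Under
    \<open>s\<close> their combination becomes \<open>g(s z)\<close> times the conjugate of the
    relation.\<close>
  define h where "h j = (\<Oplus>m\<in>{..n}. g m \<otimes> t m j)" for j
  have "\<forall>j\<in>J. h j = \<zero>"
  proof (rule conjugate_relations_trivial[OF finJ bJ indep])
    show "\<forall>j\<in>J. h j \<in> separable_elems K"
    proof
      fix j assume j: "j \<in> J"
      have "A (m, i) j \<in> separable_elems K" if "m \<in> {..n}" "i \<in> I" for m i
        using AO[OF mP[OF that] j] base_separable[OF K] by (simp add: V_def)
      then have "t m j \<in> separable_elems K" if "m \<in> {..n}" for m
        unfolding t_def using that eS sS(6) by (intro sep_sum I) blast
      then show "h j \<in> separable_elems K"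
        unfolding h_def using gS sS(6) by (intro sep_sum) auto
    qed
    show "\<forall>s\<in>field_auts R K. (\<Oplus>j\<in>J. h j \<otimes> s (b j)) = \<zero>"
    proof
      fix s assume s: "s \<in> field_auts R K"
      have sbC: "s (b j) \<in> carrier R" if "j \<in> J" for j using bJ[OF that] s by simp
      have sy: "s (y i) \<in> carrier R" if "i \<in> I" for i using yC[OF that] s by simp
      have sz: "s z \<in> carrier R" using zC s by simp
      let ?Y = "\<Oplus>i\<in>I. e i \<otimes> s (y i)"
      have YC: "?Y \<in> carrier R" using eC sy by auto
      have tb: "(\<Oplus>j\<in>J. t m j \<otimes> s (b j)) = (s z) [^] m \<otimes> ?Y" if m: "m \<in> {..n}" for m
      proof -
        note AmC = AC[OF mP[OF m]]
        have sb: "(\<Oplus>j\<in>J. A (m, i) j \<otimes> s (b j)) = (s z) [^] m \<otimes> s (y i)" if i: "i \<in> I" for i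
        proof -
          have "s (b (m, i)) = s (\<Oplus>j\<in>J. A (m, i) j \<otimes> b j)" using A mP[OF m i] by metis
          also have "\<dots> = (\<Oplus>j\<in>J. s (A (m, i) j \<otimes> b j))"
            by (rule aut_finsum[OF s]) (use AmC[OF i] bJ in auto)
          also have "\<dots> = (\<Oplus>j\<in>J. A (m, i) j \<otimes> s (b j))"
          proof (intro finsum_cong' refl)
            fix j assume j: "j \<in> J"
            have "s (A (m, i) j) = A (m, i) j"
              using AO[OF mP[OF m i] j] aut_fix[OF s] by (simp add: V_def)
            then show "s (A (m, i) j \<otimes> b j) = A (m, i) j \<otimes> s (b j)"
              using s AmC[OF i j] bJ[OF j] by simp
          qed (use AmC[OF i] sbC in auto)
          also have "s (b (m, i)) = (s z) [^] m \<otimes> s (y i)"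
            using s zC yC[OF i] by (simp add: b_def)
          finally show ?thesis by simp
        qed
        have "(\<Oplus>j\<in>J. t m j \<otimes> s (b j)) = (\<Oplus>j\<in>J. \<Oplus>i\<in>I. e i \<otimes> (A (m, i) j \<otimes> s (b j)))"
        proof (intro finsum_cong' refl)
          fix j assume j: "j \<in> J"
          have "t m j \<otimes> s (b j) = (\<Oplus>i\<in>I. e i \<otimes> A (m, i) j \<otimes> s (b j))"
            unfolding t_def using eC AmC[OF _ j] sbC[OF j] I by (intro finsum_ldistr) auto
          also have "\<dots> = (\<Oplus>i\<in>I. e i \<otimes> (A (m, i) j \<otimes> s (b j)))"
            using eC AmC[OF _ j] sbC[OF j] by (intro finsum_cong') (auto simp: m_assoc)
          finally show "t m j \<otimes> s (b j) = (\<Oplus>i\<in>I. e i \<otimes> (A (m, i) j \<otimes> s (b j)))" .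
        qed (use eC AmC sbC in auto)
        also have "\<dots> = (\<Oplus>i\<in>I. \<Oplus>j\<in>J. e i \<otimes> (A (m, i) j \<otimes> s (b j)))"
          using finJ I eC AmC sbC by (intro finsum_swap) auto
        also have "\<dots> = (\<Oplus>i\<in>I. (s z) [^] m \<otimes> (e i \<otimes> s (y i)))"
        proof (intro finsum_cong' refl)
          fix i assume i: "i \<in> I"
          have "(\<Oplus>j\<in>J. e i \<otimes> (A (m, i) j \<otimes> s (b j))) = e i \<otimes> (\<Oplus>j\<in>J. A (m, i) j \<otimes> s (b j))"
            using eC[OF i] AmC[OF i] sbC finJ by (intro finsum_rdistr[symmetric]) auto
          then show "(\<Oplus>j\<in>J. e i \<otimes> (A (m, i) j \<otimes> s (b j))) = (s z) [^] m \<otimes> (e i \<otimes> s (y i))"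
            using sb[OF i] eC[OF i] sz sy[OF i] by (simp add: m_lcomm)
        qed (use eC sy sz in auto)
        also have "\<dots> = (s z) [^] m \<otimes> ?Y"
          using eC sy sz I by (intro finsum_rdistr[symmetric]) auto
        finally show ?thesis .
      qed
      have "(\<Oplus>j\<in>J. h j \<otimes> s (b j)) = (\<Oplus>j\<in>J. \<Oplus>m\<in>{..n}. g m \<otimes> (t m j \<otimes> s (b j)))"
      proof (intro finsum_cong' refl)
        fix j assume j: "j \<in> J"
        have "h j \<otimes> s (b j) = (\<Oplus>m\<in>{..n}. g m \<otimes> t m j \<otimes> s (b j))"
          unfolding h_def using gC tC[OF _ j] sbC[OF j] by (intro finsum_ldistr) auto
        also have "\<dots> = (\<Oplus>m\<in>{..n}. g m \<otimes> (t m j \<otimes> s (b j)))"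
          using gC tC[OF _ j] sbC[OF j] by (intro finsum_cong') (auto simp: m_assoc)
        finally show "h j \<otimes> s (b j) = (\<Oplus>m\<in>{..n}. g m \<otimes> (t m j \<otimes> s (b j)))" .
      qed (use gC tC sbC in auto)
      also have "\<dots> = (\<Oplus>m\<in>{..n}. \<Oplus>j\<in>J. g m \<otimes> (t m j \<otimes> s (b j)))"
        using finJ gC tC sbC by (intro finsum_swap) auto
      also have "\<dots> = (\<Oplus>m\<in>{..n}. g m \<otimes> (s z) [^] m \<otimes> ?Y)"
      proof (intro finsum_cong' refl)
        fix m assume m: "m \<in> {..n}"
        have "(\<Oplus>j\<in>J. g m \<otimes> (t m j \<otimes> s (b j))) = g m \<otimes> (\<Oplus>j\<in>J. t m j \<otimes> s (b j))"
          using gC tC[OF m] sbC finJ by (intro finsum_rdistr[symmetric]) auto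
        then show "(\<Oplus>j\<in>J. g m \<otimes> (t m j \<otimes> s (b j))) = g m \<otimes> (s z) [^] m \<otimes> ?Y"
          using tb[OF m] gC sz YC by (simp add: m_assoc)
      qed (use gC sz YC in auto)
      also have "\<dots> = (\<Oplus>m\<in>{..n}. g m \<otimes> (s z) [^] m) \<otimes> ?Y"
        using gC sz YC by (intro finsum_ldistr[symmetric]) auto
      finally have eq: "(\<Oplus>j\<in>J. h j \<otimes> s (b j)) = (\<Oplus>m\<in>{..n}. g m \<otimes> (s z) [^] m) \<otimes> ?Y" .
      have GC: "(\<Oplus>m\<in>{..n}. g m \<otimes> (s z) [^] m) \<in> carrier R" using gC sz by auto
      \<comment> \<open>Either the relation is preserved by \<open>s\<close>, or \<open>s z\<close>
        is a root of \<open>g\<close>; one of the two factors vanishes.\<close>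
      consider "\<forall>l\<in>L - {\<zero>}. u (s l) = u l" | "s z \<in> set zs" using zs(3) s by blast
      then show "(\<Oplus>j\<in>J. h j \<otimes> s (b j)) = \<zero>"
      proof cases
        case 1
        have "?Y = \<zero>"
          by (rule relation_conjugate[OF valuation L s 1 I]) (use eD y erel in auto)
        then show ?thesis unfolding eq using GC by simp
      next
        case 2
        have "(\<Oplus>m\<in>{..n}. g m \<otimes> (s z) [^] m) = \<zero>"
          unfolding n_def g_def by (rule root_coeff_eval_root[OF zsC 2])
        then show ?thesis unfolding eq using YC by simp
      qed
    qed
  qed
  moreover have imJ: "(n, im) \<in> J" using WJ im(1) by (auto simp: W_def)
  ultimately have h0: "h (n, im) = \<zero>" by blast
  have nW: "(n, i) \<in> W" if "i \<in> I" for i using that by (simp add: W_def)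
  \<comment> \<open>At this coordinate the top coefficient of \<open>g\<close> contributes
    \<open>e im = 1\<close>. The lower ones have positive value and are multiplied by integral
    elements.\<close>
  have "t n (n, im) = (\<Oplus>i\<in>I. if im = i then e i else \<zero>)"
    unfolding t_def
  proof (intro finsum_cong' refl)
    fix i assume i: "i \<in> I"
    have "A (n, i) (n, im) = (if (n, i) = (n, im) then \<one> else \<zero>)"
      using A WP nW[OF i] imJ by blast
    then show "e i \<otimes> A (n, i) (n, im) = (if im = i then e i else \<zero>)" using eC[OF i] by auto
  qed (use eC in auto)
  also have "\<dots> = e im" by (rule finsum_singleton) (use im I eC in auto)
  finally have tn: "t n (n, im) = \<one>" using eim by simp
  have gn: "g n = \<one>" unfolding g_def n_def using root_coeff_top[OF zsC] .
  have "h (n, im) = g n \<otimes> t n (n, im) \<oplus> (\<Oplus>m\<in>{..<n}. g m \<otimes> t m (n, im))"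
  proof -
    have "{..n} = insert n {..<n}" by auto
    then show ?thesis
      unfolding h_def using gC tC[OF _ imJ] by (simp only:) (rule finsum_insert; auto)
  qed
  moreover have "(\<Oplus>m\<in>{..<n}. g m \<otimes> t m (n, im)) \<in> vgt 0"
  proof (rule vgt_finsum)
    fix m assume m: "m \<in> {..<n}"
    then have "g m \<in> vgt 0" unfolding g_def n_def using root_coeff_vgt[OF zs(1)] by simp
    then show "g m \<otimes> t m (n, im) \<in> vgt 0" using vgt_mult[OF _ tge[OF _ imJ]] m by fastforce
  qed
  ultimately have "h (n, im) \<noteq> \<zero>"
    using u_add_strict[of \<one>] tn gn u_one by simp
  then show False using h0 by simp
qed

end


section \<open>Residue fields\<close>

lemma (in abelian_monoid) finsum_product:
  assumes "finite A" "finite B" "\<And>a b. a \<in> A \<Longrightarrow> b \<in> B \<Longrightarrow> f (a, b) \<in> carrier G"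
  shows "(\<Oplus>p\<in>A \<times> B. f p) = (\<Oplus>a\<in>A. \<Oplus>b\<in>B. f (a, b))"
  using assms(1,3)
proof (induction A rule: finite_induct)
  case (insert a A)
  have "(\<Oplus>p\<in>insert a A \<times> B. f p) = (\<Oplus>p\<in>Pair a ` B \<union> A \<times> B. f p)"
    by (rule arg_cong[where f = "finsum G f"]) auto
  also have "\<dots> = (\<Oplus>p\<in>Pair a ` B. f p) \<oplus> (\<Oplus>p\<in>A \<times> B. f p)"
    using insert assms(2) by (intro finsum_Un_disjoint) auto
  also have "(\<Oplus>p\<in>Pair a ` B. f p) = (\<Oplus>b\<in>B. f (a, b))"
    using insert by (intro finsum_reindex) (auto simp: inj_on_def)
  also have "(\<Oplus>p\<in>A \<times> B. f p) = (\<Oplus>a\<in>A. \<Oplus>b\<in>B. f (a, b))"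
    using insert by auto
  also have "(\<Oplus>b\<in>B. f (a, b)) \<oplus> (\<Oplus>a\<in>A. \<Oplus>b\<in>B. f (a, b)) = (\<Oplus>a\<in>insert a A. \<Oplus>b\<in>B. f (a, b))"
    using insert by (intro finsum_insert[symmetric]) auto
  finally show ?case .
qed simp

section \<open>Linear algebra with indexed families\<close>

context ring
begin

lemma combine_carrier_update:
  assumes "subring S R" shows "ring.combine (R\<lparr>carrier := S\<rparr>) Ks Us = combine Ks Us"
  by (induction Ks Us rule: combine.induct)
     (simp_all add: ring.combine.simps[OF subring_is_ring[OF assms]])

lemma combine_eq_finsum:
  assumes "length Ks = length Us" "set Ks \<subseteq> carrier R" "set Us \<subseteq> carrier R"
  shows "combine Ks Us = (\<Oplus>i\<in>{..<length Us}. Ks ! i \<otimes> Us ! i)"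
  using assms
proof (induction Ks Us rule: list_induct2)
  case (Cons k Ks v Us)
  have c: "Ks ! i \<in> carrier R" "Us ! i \<in> carrier R" if "i < length Us" for i
    using Cons that by (auto simp: subset_iff)
  have eq: "{..<Suc (length Us)} = insert 0 (Suc ` {..<length Us})"
    by (simp add: lessThan_Suc_eq_insert_0)
  have "(\<Oplus>i\<in>{..<Suc (length Us)}. (k # Ks) ! i \<otimes> (v # Us) ! i) =
      k \<otimes> v \<oplus> (\<Oplus>i\<in>Suc ` {..<length Us}. (k # Ks) ! i \<otimes> (v # Us) ! i)"
    unfolding eq using Cons.prems c by (subst finsum_insert) auto
  also have "(\<Oplus>i\<in>Suc ` {..<length Us}. (k # Ks) ! i \<otimes> (v # Us) ! i) =
      (\<Oplus>i\<in>{..<length Us}. Ks ! i \<otimes> Us ! i)"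
    using c by (subst finsum_reindex) auto
  finally show ?case using Cons by simp
qed simp

text \<open>Indexing allows repetitions among the \<open>y i\<close>: a distinct list of indices is
  mapped to a list of vectors longer than the dimension.\<close>

lemma dependent_family:
  assumes H: "subfield H R" and E: "dimension n H E" and I: "finite I" "n < card I"
    and y: "\<And>i. i \<in> I \<Longrightarrow> y i \<in> E"
  shows "\<exists>c. (\<forall>i\<in>I. c i \<in> H) \<and> (\<exists>i\<in>I. c i \<noteq> \<zero>) \<and> (\<Oplus>i\<in>I. c i \<otimes> y i) = \<zero>"
proof -
  obtain xs where xs: "distinct xs" "set xs = I" using finite_distinct_list[OF I(1)] by blast
  then have len: "length xs = card I" using distinct_card by fastforce
  let ?Us = "map y xs"
  have EC: "E \<subseteq> carrier R" using space_subgroup_props(1)[OF H E] .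
  have sub: "set ?Us \<subseteq> E" using xs y by auto
  have C: "set ?Us \<subseteq> carrier R" using sub EC by blast
  have "dependent H ?Us"
    using independent_length_le_dimension[OF H E _ sub] len I(2) by auto
  from dependent_imp_non_trivial_combine[OF H C this] obtain Ks where
    Ks: "length Ks = length ?Us" "combine Ks ?Us = \<zero>" "set Ks \<subseteq> H" "set Ks \<noteq> {\<zero>}"
    by blast
  have KC: "set Ks \<subseteq> carrier R" using Ks(3) subfieldE(3)[OF H] by blast
  define c where "c i = the (map_of (zip xs Ks) i)" for i
  have cn: "c (xs ! j) = Ks ! j" if "j < length xs" for j
    using map_of_zip_nth[OF _ xs(1), of Ks j] Ks(1) that by (simp add: c_def)
  have bij: "I = (\<lambda>j. xs ! j) ` {..<length xs}" "inj_on (\<lambda>j. xs ! j) {..<length xs}"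
    using xs by (auto simp: in_set_conv_nth inj_on_nth)
  have cH: "c i \<in> H" if i: "i \<in> I" for i
  proof -
    obtain j where "j < length xs" "i = xs ! j" using i bij(1) by auto
    then show ?thesis using cn Ks(1,3) by (simp add: subset_iff)
  qed
  have cC: "c i \<in> carrier R" "y i \<in> carrier R" if "i \<in> I" for i
    using cH[OF that] y[OF that] subfieldE(3)[OF H] EC by auto
  have "(\<Oplus>i\<in>I. c i \<otimes> y i) = (\<Oplus>j\<in>{..<length xs}. c (xs ! j) \<otimes> y (xs ! j))"
    unfolding bij(1) by (rule finsum_reindex) (use cC bij in auto)
  also have "\<dots> = (\<Oplus>j\<in>{..<length ?Us}. Ks ! j \<otimes> ?Us ! j)"
    using cn KC C Ks(1) by (intro finsum_cong') (auto simp: subset_iff)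
  also have "\<dots> = \<zero>" using combine_eq_finsum[OF Ks(1) KC C] Ks(2) by simp
  finally have rel: "(\<Oplus>i\<in>I. c i \<otimes> y i) = \<zero>" .
  have "Ks \<noteq> []" using Ks(1) len I(2) by auto
  then obtain k where "k \<in> set Ks" "k \<noteq> \<zero>" using Ks(4) by (cases Ks) auto
  then obtain j where j: "j < length Ks" "Ks ! j \<noteq> \<zero>" by (auto simp: in_set_conv_nth)
  then have "c (xs ! j) \<noteq> \<zero>" "xs ! j \<in> I" using cn Ks(1) xs by auto
  then show ?thesis using cH rel by blast
qed

lemma independentI:
  assumes H: "subfield H R" and U: "set Us \<subseteq> carrier R"
    and triv: "\<And>k. (\<forall>i<length Us. k i \<in> H) \<Longrightarrow> (\<Oplus>i\<in>{..<length Us}. k i \<otimes> Us ! i) = \<zero> \<Longrightarrow>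
      \<forall>i<length Us. k i = \<zero>"
  shows "independent H Us"
proof (rule ccontr)
  assume "dependent H Us"
  from dependent_imp_non_trivial_combine[OF H U this] obtain Ks where
    Ks: "length Ks = length Us" "combine Ks Us = \<zero>" "set Ks \<subseteq> H" "set Ks \<noteq> {\<zero>}"
    by blast
  have KC: "set Ks \<subseteq> carrier R" using Ks(3) subfieldE(3)[OF H] by blast
  have "\<forall>i<length Us. Ks ! i = \<zero>"
    by (rule triv) (use Ks combine_eq_finsum[OF Ks(1) KC U] in \<open>auto simp: subset_iff\<close>)
  then have "set Ks \<subseteq> {\<zero>}" using Ks(1) by (auto simp: in_set_conv_nth)
  then have "Ks = []" using Ks(4) by (cases Ks) auto
  then have "Us = []" using Ks(1) by simp
  then show False using \<open>dependent H Us\<close> by simp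
qed

text \<open>A longest independent list spans. This is how the residue field extension is shown to be
  finite, without which \<open>ring.dim\<close> carries no information.\<close>

lemma finite_dimensionI_bound:
  assumes H: "subfield H R" and E: "subalgebra H E R"
    and bound: "\<And>Us. independent H Us \<Longrightarrow> set Us \<subseteq> E \<Longrightarrow> length Us \<le> N"
  shows "\<exists>Us. independent H Us \<and> set Us \<subseteq> E \<and> Span H Us = E"
proof -
  let ?P = "\<lambda>m. \<exists>Us. independent H Us \<and> set Us \<subseteq> E \<and> length Us = m"
  have "?P 0" by (intro exI[of _ "[]"]) auto
  moreover have "\<forall>m. ?P m \<longrightarrow> m \<le> N" using bound by blast
  ultimately obtain m where m: "?P m" "\<forall>m'. ?P m' \<longrightarrow> m' \<le> m"
    using Nat.ex_has_greatest_nat[of ?P 0 N] by blast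
  then obtain Us where Us: "independent H Us" "set Us \<subseteq> E" "length Us = m" by blast
  have "E \<subseteq> Span H Us"
  proof
    fix v assume v: "v \<in> E"
    show "v \<in> Span H Us"
    proof (rule ccontr)
      assume nv: "v \<notin> Span H Us"
      have "v \<in> carrier R" using subalgebra_in_carrier[OF E] v by blast
      then have "independent H (v # Us)" using li_Cons[OF _ nv Us(1)] by blast
      then have "?P (Suc m)" using Us v by (intro exI[of _ "v # Us"]) auto
      then show False using m(2) by auto
    qed
  qed
  moreover have "Span H Us \<subseteq> E" using subalgebra_Span_incl[OF H E Us(2)] .
  ultimately show ?thesis using Us by blast
qed

end

locale valued_finite_extension = valued_closed_extension R K u
  for R :: "('a, 'm) ring_scheme" (structure) and K :: "'a set"
    and u :: "'a \<Rightarrow> 'v::linordered_ab_group_add" +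
  fixes L :: "'a set"
  assumes L_subfield: "subfield L R" and K_subset_L: "K \<subseteq> L"
    and finite_dim: "finite_dimension K L"
begin

lemma L_carrier: "L \<subseteq> carrier R"
  using subfieldE(3)[OF L_subfield] .

lemmas L_ring = subringE[OF subfieldE(1)[OF L_subfield]]
lemmas K_ring = subringE[OF subfieldE(1)[OF K_subfield]]

lemma L_inv: "x \<in> L \<Longrightarrow> x \<noteq> \<zero> \<Longrightarrow> inv x \<in> L"
  using subfield_m_inv(1)[OF L_subfield, of x] by blast

lemma K_inv: "x \<in> K \<Longrightarrow> x \<noteq> \<zero> \<Longrightarrow> inv x \<in> K"
  using subfield_m_inv(1)[OF K_subfield, of x] by blast

lemma valuation_ring_eq: "F \<subseteq> carrier R \<Longrightarrow> valuation_ring R F u = F \<inter> vge 0"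
  by (auto simp: valuation_ring_def vge_def)

lemma valuation_ideal_eq: "F \<subseteq> carrier R \<Longrightarrow> valuation_ideal R F u = F \<inter> vgt 0"
  by (auto simp: valuation_ideal_def vgt_def)

lemma one_vge: "\<one> \<in> vge 0"
  using u_one by (simp add: vge_def)

lemma vge_mult0: "x \<in> vge 0 \<Longrightarrow> y \<in> vge 0 \<Longrightarrow> x \<otimes> y \<in> vge 0"
  using vge_mult[of x 0 y 0] by simp

lemma vge_pow: "x \<in> vge 0 \<Longrightarrow> x [^] (n::nat) \<in> vge 0"
  by (induction n) (simp_all add: one_vge vge_mult0)

lemma subring_vge: "subfield F R \<Longrightarrow> subring (F \<inter> vge 0) R"
proof (rule subringI)
  assume F: "subfield F R"
  note sr = subringE[OF subfieldE(1)[OF F]]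
  show "F \<inter> vge 0 \<subseteq> carrier R" using vge_carrier by blast
  show "\<one> \<in> F \<inter> vge 0" using sr(3) one_vge by blast
  show "\<ominus> h \<in> F \<inter> vge 0" if "h \<in> F \<inter> vge 0" for h using that sr(5) vge_minus by blast
  show "h1 \<otimes> h2 \<in> F \<inter> vge 0" "h1 \<oplus> h2 \<in> F \<inter> vge 0"
    if "h1 \<in> F \<inter> vge 0" "h2 \<in> F \<inter> vge 0" for h1 h2
    using that sr(6,7) vge_mult0 vge_add by blast+
qed

lemma valuation_ideal_is_ideal: "ideal (L \<inter> vgt 0) (R\<lparr>carrier := L \<inter> vge 0\<rparr>)"
proof -
  let ?A = "R\<lparr>carrier := L \<inter> vge 0\<rparr>"
  interpret A: ring ?A using subring_is_ring[OF subring_vge[OF L_subfield]] .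
  show ?thesis
  proof (rule idealI)
    show "ring ?A" by (rule A.ring_axioms)
    show "subgroup (L \<inter> vgt 0) (add_monoid ?A)"
    proof (rule A.add.subgroupI)
      show "L \<inter> vgt 0 \<subseteq> carrier ?A" using vgt_subset_vge by auto
      show "L \<inter> vgt 0 \<noteq> {}" using L_ring(2) zero_vgt by blast
      fix a assume a: "a \<in> L \<inter> vgt 0"
      then have aC: "a \<in> carrier R" using vgt_carrier by blast
      have "\<ominus> a \<in> L \<inter> vgt 0" using a L_ring(5) vgt_minus by blast
      moreover have "\<ominus>\<^bsub>?A\<^esub> a = \<ominus> a"
      proof (rule A.minus_equality)
        show "\<ominus> a \<oplus>\<^bsub>?A\<^esub> a = \<zero>\<^bsub>?A\<^esub>" using aC by (simp add: l_neg)
        show "a \<in> carrier ?A" "\<ominus> a \<in> carrier ?A"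
          using a calculation vgt_subset_vge by auto
      qed
      ultimately show "\<ominus>\<^bsub>?A\<^esub> a \<in> L \<inter> vgt 0" by simp
    next
      show "a \<oplus>\<^bsub>?A\<^esub> b \<in> L \<inter> vgt 0" if "a \<in> L \<inter> vgt 0" "b \<in> L \<inter> vgt 0" for a b
        using that L_ring(7) vgt_add by simp
    qed
    fix a x assume "a \<in> L \<inter> vgt 0" "x \<in> carrier ?A"
    then have a: "a \<in> L" "a \<in> vgt 0" "x \<in> L" "x \<in> vge 0" by auto
    have "a \<otimes> x \<in> vgt 0" using vgt_mult[OF a(2,4)] by simp
    moreover have "a \<otimes> x \<in> L" using L_ring(6) a by blast
    moreover have "x \<otimes> a = a \<otimes> x" using a L_carrier m_comm by blast
    ultimately show "x \<otimes>\<^bsub>?A\<^esub> a \<in> L \<inter> vgt 0" "a \<otimes>\<^bsub>?A\<^esub> x \<in> L \<inter> vgt 0" by simp_all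
  qed
qed

text \<open>The \<open>y i\<close> lift a basis of the residue field extension. Independence of the
  residues is expressed without the quotient: a combination over the valuation ring of
  \<open>K\<close> is a non-unit only if all coefficients are.\<close>

lemma residue_lifts:
  assumes f: "ring.dim (residue_field R L u) (residue_map R L u ` valuation_ring R K u)
      (carrier (residue_field R L u)) = f"
  shows "\<exists>y. (\<forall>i<f. y i \<in> L \<inter> vge 0) \<and>
    (\<forall>b. (\<forall>i<f. b i \<in> K \<inter> vge 0) \<and> (\<Oplus>i\<in>{..<f}. b i \<otimes> y i) \<in> vgt 0 \<longrightarrow> (\<forall>i<f. b i \<in> vgt 0))"
proof -
  define A where "A = R\<lparr>carrier := L \<inter> vge 0\<rparr>"
  define M where "M = L \<inter> vgt 0"
  define Q where "Q = A Quot M"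
  define r where "r = (+>\<^bsub>A\<^esub>) M"
  define V where "V = K \<inter> vge 0"
  note subA = subring_vge[OF L_subfield]
  have carA: "carrier A = L \<inter> vge 0" by (simp add: A_def)
  interpret A: ring A unfolding A_def using subring_is_ring[OF subA] .
  have cringA: "cring A" unfolding A_def
    using subcring_iff[of "L \<inter> vge 0"] subcringI'[OF subA] subringE(1)[OF subA] by blast
  interpret M: ideal M A unfolding A_def M_def by (rule valuation_ideal_is_ideal)
  interpret r: ring_hom_ring A Q r unfolding Q_def r_def by (rule M.rcos_ring_hom_ring)
  have ringQ: "ring Q" unfolding Q_def by (rule M.quotient_is_ring)
  interpret Q: cring Q unfolding Q_def by (rule M.quotient_is_cring[OF cringA])
  have res_Q: "residue_field R L u = Q"
    using valuation_ring_eq[OF L_carrier] valuation_ideal_eq[OF L_carrier]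
    by (simp add: residue_field_def Q_def A_def M_def)
  have res_r: "residue_map R L u = r"
    using valuation_ideal_eq[OF L_carrier]
    by (auto simp: residue_map_def r_def A_def M_def a_r_coset_def r_coset_def fun_eq_iff)
  have carQ: "carrier Q = r ` (L \<inter> vge 0)"
    by (auto simp: Q_def r_def FactRing_def A_RCOSETS_def RCOSETS_def A_def a_r_coset_def)
  have r0: "r x = \<zero>\<^bsub>Q\<^esub> \<longleftrightarrow> x \<in> vgt 0" if x: "x \<in> L \<inter> vge 0" for x
  proof -
    have z: "\<zero>\<^bsub>Q\<^esub> = M" by (simp add: Q_def FactRing_def)
    show ?thesis
      unfolding z r_def using M.rcos_const_imp_mem[of x] A.a_rcos_zero[OF M.ideal_axioms, of x] x
      by (auto simp: carA M_def)
  qed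
  have unit: "\<exists>b\<in>L \<inter> vge 0. r x \<otimes>\<^bsub>Q\<^esub> r b = \<one>\<^bsub>Q\<^esub> \<and> (x \<in> K \<longrightarrow> b \<in> K)"
    if x: "x \<in> L \<inter> vge 0" "x \<notin> vgt 0" for x
  proof -
    have xu: "x \<in> carrier R" "x \<noteq> \<zero>" "u x = 0" using x by (auto simp: vge_def vgt_def)
    then have "inv x \<in> vge 0" using u_inv inv_closed_nonzero by (simp add: vge_def)
    then have ix: "inv x \<in> L \<inter> vge 0" using L_inv x xu by blast
    have "x \<otimes>\<^bsub>A\<^esub> inv x = \<one>\<^bsub>A\<^esub>" using r_inv_nonzero xu by (simp add: A_def)
    then have "r x \<otimes>\<^bsub>Q\<^esub> r (inv x) = \<one>\<^bsub>Q\<^esub>"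
      using r.hom_mult[of x "inv x"] x ix r.hom_one by (simp add: carA)
    then show ?thesis using ix K_inv xu by blast
  qed
  have one_not: "\<one> \<notin> vgt 0" using u_one by (simp add: vgt_def)
  have "\<one>\<^bsub>Q\<^esub> \<noteq> \<zero>\<^bsub>Q\<^esub>"
    using r0[of \<one>] r.hom_one one_not L_ring(3) one_vge by (simp add: A_def)
  moreover have "\<exists>b\<in>carrier Q. a \<otimes>\<^bsub>Q\<^esub> b = \<one>\<^bsub>Q\<^esub>" if a: "a \<in> carrier Q" "a \<noteq> \<zero>\<^bsub>Q\<^esub>" for a
  proof -
    obtain x where "x \<in> L \<inter> vge 0" "a = r x" using a(1) carQ by blast
    then show ?thesis using unit[of x] r0[of x] a(2) carQ by blast
  qed
  ultimately have "field Q" by (intro Q.cring_fieldI2) auto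
  interpret Q: field Q by fact
  have VL: "V \<subseteq> L \<inter> vge 0" using K_subset_L by (auto simp: V_def)
  have "subring V A"
    unfolding V_def A_def
  proof -
    have "ring (R\<lparr>carrier := K \<inter> vge 0\<rparr>)" using subring_is_ring[OF subring_vge[OF K_subfield]] .
    then show "subring (K \<inter> vge 0) (R\<lparr>carrier := L \<inter> vge 0\<rparr>)"
      using A.ring_incl_imp_subring[of "K \<inter> vge 0"] VL unfolding A_def V_def by simp
  qed
  then have rV: "subring (r ` V) Q" by (rule r.img_is_subring)
  have kappa: "subfield (r ` V) Q"
  proof (rule Q.subfieldI'[OF rV])
    fix k assume "k \<in> r ` V - {\<zero>\<^bsub>Q\<^esub>}"
    then obtain x where x: "x \<in> V" "k = r x" "k \<noteq> \<zero>\<^bsub>Q\<^esub>" by blast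
    then have "x \<in> L \<inter> vge 0" "x \<notin> vgt 0" "x \<in> K" using VL r0 by (auto simp: V_def)
    with unit[of x] obtain b where b: "b \<in> L \<inter> vge 0" "r x \<otimes>\<^bsub>Q\<^esub> r b = \<one>\<^bsub>Q\<^esub>" "b \<in> K" by blast
    have "k \<in> carrier Q" "r b \<in> carrier Q" using b(1) x VL carQ by blast+
    then have "inv\<^bsub>Q\<^esub> k = r b" using Q.comm_inv_char[of k "r b"] b(2) x(2) by simp
    then show "inv\<^bsub>Q\<^esub> k \<in> r ` V" using b by (simp add: V_def)
  qed
  have key: "\<exists>y. (\<forall>i<length Xs. y i \<in> L \<inter> vge 0) \<and>
      (\<forall>b. (\<forall>i<length Xs. b i \<in> V) \<and> (\<Oplus>i\<in>{..<length Xs}. b i \<otimes> y i) \<in> vgt 0 \<longrightarrow>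
        (\<forall>i<length Xs. b i \<in> vgt 0))"
    if Xs: "ring.independent Q (r ` V) Xs" "set Xs \<subseteq> carrier Q" for Xs
  proof -
    define n where "n = length Xs"
    have "\<forall>i. \<exists>y. i < n \<longrightarrow> y \<in> L \<inter> vge 0 \<and> r y = Xs ! i"
    proof
      fix i
      show "\<exists>y. i < n \<longrightarrow> y \<in> L \<inter> vge 0 \<and> r y = Xs ! i"
      proof (cases "i < n")
        case True
        then have "Xs ! i \<in> r ` (L \<inter> vge 0)" using Xs(2) carQ unfolding n_def by auto
        then show ?thesis by auto
      qed simp
    qed
    then obtain y where y: "\<forall>i. i < n \<longrightarrow> y i \<in> L \<inter> vge 0 \<and> r (y i) = Xs ! i" by metis
    have "\<forall>i<n. b i \<in> vgt 0" if b: "\<forall>i<n. b i \<in> V" "(\<Oplus>i\<in>{..<n}. b i \<otimes> y i) \<in> vgt 0" for b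
    proof -
      let ?b = "map b [0..<n]" and ?y = "map y [0..<n]"
      have sb: "set ?b \<subseteq> carrier A" "set ?y \<subseteq> carrier A" using b(1) y VL by (auto simp: carA)
      have AC: "carrier A \<subseteq> carrier R" using vge_carrier by (auto simp: carA)
      have "combine ?b ?y = (\<Oplus>i\<in>{..<length ?y}. ?b ! i \<otimes> ?y ! i)"
        by (rule combine_eq_finsum) (use sb AC in auto)
      also have "\<dots> = (\<Oplus>i\<in>{..<n}. b i \<otimes> y i)"
        using sb AC by (intro finsum_cong') (auto simp: subset_iff)
      finally have comb: "ring.combine A ?b ?y = (\<Oplus>i\<in>{..<n}. b i \<otimes> y i)"
        using combine_carrier_update[OF subA] by (simp add: A_def)
      have "(\<Oplus>i\<in>{..<n}. b i \<otimes> y i) \<in> L \<inter> vge 0"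
        using A.combine_in_carrier[OF sb] unfolding comb carA .
      then have "r (ring.combine A ?b ?y) = \<zero>\<^bsub>Q\<^esub>" unfolding comb using r0 b(2) by blast
      moreover have "map r ?y = Xs" using y by (intro nth_equalityI) (auto simp: n_def)
      ultimately have "ring.combine Q (map r ?b) Xs = \<zero>\<^bsub>Q\<^esub>" using r.combine_hom[OF sb] by simp
      moreover have "set (map r ?b) \<subseteq> r ` V" using b(1) by auto
      ultimately have "set (take (length Xs) (map r ?b)) \<subseteq> {\<zero>\<^bsub>Q\<^esub>}"
        using ring.independent_imp_trivial_combine[OF ringQ kappa Xs(1)] by blast
      then have "(\<lambda>i. r (b i)) ` {0..<n} \<subseteq> {\<zero>\<^bsub>Q\<^esub>}" by (simp add: n_def image_image)
      then have "\<forall>i<n. r (b i) = \<zero>\<^bsub>Q\<^esub>" by (simp add: image_subset_iff)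
      then show ?thesis using r0 b(1) VL by blast
    qed
    then show ?thesis using y unfolding n_def by blast
  qed
  \<comment> \<open>The lifts are independent over \<open>K\<close>: a relation between them,
    divided by a coefficient of least value, would reduce to a nontrivial relation between the
    residues.\<close>
  have bound: "length Xs \<le> dim K L" if Xs: "ring.independent Q (r ` V) Xs" "set Xs \<subseteq> carrier Q" for Xs
  proof -
    obtain y where y: "\<forall>i<length Xs. y i \<in> L \<inter> vge 0"
      "\<forall>b. (\<forall>i<length Xs. b i \<in> V) \<and> (\<Oplus>i\<in>{..<length Xs}. b i \<otimes> y i) \<in> vgt 0 \<longrightarrow>
        (\<forall>i<length Xs. b i \<in> vgt 0)"
      using key[OF Xs] by blast
    define n where "n = length Xs"
    let ?y = "map y [0..<n]"
    have yC: "y i \<in> carrier R" if "i < n" for i using y(1) that vge_carrier by (auto simp: n_def)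
    have "independent K ?y"
    proof (rule independentI[OF K_subfield])
      show "set ?y \<subseteq> carrier R" using yC by auto
      fix k assume k: "\<forall>i<length ?y. k i \<in> K" "(\<Oplus>i\<in>{..<length ?y}. k i \<otimes> ?y ! i) = \<zero>"
      have kK: "k i \<in> K" if "i < n" for i using k(1) that by simp
      have kC: "k i \<in> carrier R" if "i < n" for i using kK[OF that] base_in_carrier by blast
      have krel: "(\<Oplus>i\<in>{..<n}. k i \<otimes> y i) = \<zero>"
      proof -
        have "(\<Oplus>i\<in>{..<n}. k i \<otimes> y i) = (\<Oplus>i\<in>{..<length ?y}. k i \<otimes> ?y ! i)"
          using kC yC by (intro finsum_cong') auto
        then show ?thesis using k(2) by simp
      qed
      show "\<forall>i<length ?y. k i = \<zero>"
      proof (rule ccontr)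
        assume "\<not> ?thesis"
        then obtain j0 where "j0 \<in> {..<n}" "k j0 \<noteq> \<zero>" by auto
        from exists_min_value[of "{..<n}" j0 k, OF _ this] obtain m where
          m: "m < n" "k m \<noteq> \<zero>" "\<forall>j\<in>{..<n}. k j \<noteq> \<zero> \<longrightarrow> u (k m) \<le> u (k j)" by auto
        define b where "b i = k i \<otimes> inv (k m)" for i
        have iC: "inv (k m) \<in> carrier R" using inv_closed_nonzero kC m by blast
        have "b i \<in> V" if i: "i < n" for i
        proof -
          have "b i \<in> vge 0" unfolding b_def by (rule quotient_vge) (use kC m i in auto)
          moreover have "b i \<in> K" unfolding b_def using K_ring(6) kK i K_inv m by blast
          ultimately show ?thesis by (simp add: V_def)
        qed
        moreover have "(\<Oplus>i\<in>{..<n}. b i \<otimes> y i) = \<zero>"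
        proof -
          have "(\<Oplus>i\<in>{..<n}. b i \<otimes> y i) = (\<Oplus>i\<in>{..<n}. inv (k m) \<otimes> (k i \<otimes> y i))"
            using kC yC iC by (intro finsum_cong') (auto simp: b_def m_ac)
          also have "\<dots> = inv (k m) \<otimes> (\<Oplus>i\<in>{..<n}. k i \<otimes> y i)"
            using kC yC iC by (intro finsum_rdistr[symmetric]) auto
          finally show ?thesis using krel iC by simp
        qed
        ultimately have "b m \<in> vgt 0" using y(2) m(1) zero_vgt unfolding n_def by auto
        moreover have "b m = \<one>" unfolding b_def using r_inv_nonzero kC m by blast
        ultimately show False using one_not by simp
      qed
    qed
    then have ind: "independent K ?y" .
    have sub: "set ?y \<subseteq> L" using y(1) by (auto simp: n_def)
    have "length ?y \<le> (dim over K) L"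
      by (rule independent_length_le_dimension[OF K_subfield finite_dimensionE[OF K_subfield finite_dim] ind sub])
    then show ?thesis by (simp add: n_def over_def)
  qed
  obtain Xs where Xs: "ring.independent Q (r ` V) Xs" "set Xs \<subseteq> carrier Q" "ring.Span Q (r ` V) Xs = carrier Q"
    using ring.finite_dimensionI_bound[OF ringQ kappa ring.carrier_is_subalgebra[OF ringQ] bound] subfieldE(3)[OF kappa] by blast
  have "ring.dim Q (r ` V) (carrier Q) = length Xs"
    using ring.dimI[OF ringQ kappa ring.dimensionI[OF ringQ kappa Xs(1,3)]] by (simp add: over_def)
  then have "length Xs = f"
    using f valuation_ring_eq[OF base_in_carrier] unfolding res_Q res_r V_def by simp
  then show ?thesis using key[OF Xs(1,2)] unfolding V_def by simp
qed

end


section \<open>Essential finite generation\<close>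

context valued_finite_extension
begin

text \<open>The value of the sum is the least \<open>g\<close> for which some \<open>b (g, i)\<close> is a unit.\<close>

lemma initial_segment_combination:
  fixes f :: nat
  assumes E: "finite E" "\<forall>g\<in>E. 0 \<le> g \<and> (\<forall>x\<in>K - {\<zero>}. 0 < u x \<longrightarrow> g < u x)"
    and t: "\<forall>g\<in>E. t g \<in> carrier R - {\<zero>} \<and> u (t g) = g"
    and y: "\<forall>i<f. y i \<in> vge 0"
      "\<forall>b. (\<forall>i<f. b i \<in> K \<inter> vge 0) \<and> (\<Oplus>i\<in>{..<f}. b i \<otimes> y i) \<in> vgt 0 \<longrightarrow> (\<forall>i<f. b i \<in> vgt 0)"
    and b: "\<forall>p\<in>E \<times> {..<f}. b p \<in> K \<inter> vge 0" "p0 \<in> E \<times> {..<f}" "b p0 \<notin> vgt 0"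
  shows "(\<Oplus>p\<in>E \<times> {..<f}. b p \<otimes> (t (fst p) \<otimes> y (snd p))) \<noteq> \<zero> \<and>
    u (\<Oplus>p\<in>E \<times> {..<f}. b p \<otimes> (t (fst p) \<otimes> y (snd p))) \<in> E"
proof -
  have bV: "b (g, i) \<in> K \<inter> vge 0" if "g \<in> E" "i < f" for g i using b(1) that by blast
  then have bC: "b (g, i) \<in> carrier R" if "g \<in> E" "i < f" for g i using that base_in_carrier by blast
  have tC: "t g \<in> carrier R" if "g \<in> E" for g using t that by blast
  have yC: "y i \<in> carrier R" if "i < f" for i using y(1) that vge_carrier by blast
  define h where "h g = (\<Oplus>i\<in>{..<f}. b (g, i) \<otimes> y i)" for g
  have hC: "h g \<in> carrier R" if "g \<in> E" for g unfolding h_def using bC yC that by auto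
  have hge: "h g \<in> vge 0" if "g \<in> E" for g
    unfolding h_def by (rule vge_finsum) (use bV[OF that] y(1) vge_mult0 in auto)
  \<comment> \<open>For \<open>g\<close> in \<open>S\<close> the factor \<open>h g\<close> is a
    unit, so the corresponding term has value exactly \<open>g\<close>.\<close>
  define S where "S = {g \<in> E. \<exists>i<f. b (g, i) \<notin> vgt 0}"
  have S: "finite S" "S \<noteq> {}" using E(1) b(2,3) by (auto simp: S_def)
  define g0 where "g0 = Min S"
  have g0: "g0 \<in> S" "\<And>g. g \<in> S \<Longrightarrow> g0 \<le> g" using S by (auto simp: g0_def)
  have g0E: "g0 \<in> E" using g0(1) by (simp add: S_def)
  have unit: "h g \<noteq> \<zero> \<and> u (h g) = 0" if g: "g \<in> S" for g
  proof -
    have gE: "g \<in> E" using g by (simp add: S_def)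
    have "h g \<notin> vgt 0"
    proof
      assume "h g \<in> vgt 0"
      then have "\<forall>i<f. b (g, i) \<in> vgt 0"
        using y(2)[rule_format, of "\<lambda>i. b (g, i)"] bV[OF gE] unfolding h_def by blast
      then show False using g by (auto simp: S_def)
    qed
    then show ?thesis using hge[OF gE] unfolding vge_def vgt_def by auto
  qed
  let ?F = "\<lambda>g. t g \<otimes> h g"
  have val: "?F g \<noteq> \<zero> \<and> u (?F g) = g" if g: "g \<in> S" for g
  proof -
    have gE: "g \<in> E" using g by (simp add: S_def)
    show ?thesis using unit[OF g] t gE hC[OF gE] u_mult[of "t g" "h g"] by (auto simp: integral_iff)
  qed
  have eq: "(\<Oplus>p\<in>E \<times> {..<f}. b p \<otimes> (t (fst p) \<otimes> y (snd p))) = (\<Oplus>g\<in>E. ?F g)"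
  proof -
    have "(\<Oplus>p\<in>E \<times> {..<f}. b p \<otimes> (t (fst p) \<otimes> y (snd p))) =
        (\<Oplus>g\<in>E. \<Oplus>i\<in>{..<f}. b (g, i) \<otimes> (t g \<otimes> y i))"
      by (subst finsum_product[OF E(1) finite_lessThan]) (use bC tC yC in auto)
    also have "\<dots> = (\<Oplus>g\<in>E. ?F g)"
    proof (intro finsum_cong' refl)
      fix g assume g: "g \<in> E"
      have "(\<Oplus>i\<in>{..<f}. b (g, i) \<otimes> (t g \<otimes> y i)) = (\<Oplus>i\<in>{..<f}. t g \<otimes> (b (g, i) \<otimes> y i))"
        using bC[OF g] tC[OF g] yC by (intro finsum_cong') (auto simp: m_lcomm)
      also have "\<dots> = ?F g"
        unfolding h_def using bC[OF g] tC[OF g] yC by (intro finsum_rdistr[symmetric]) auto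
      finally show "(\<Oplus>i\<in>{..<f}. b (g, i) \<otimes> (t g \<otimes> y i)) = ?F g" .
    qed (use tC hC in auto)
    finally show ?thesis .
  qed
  have rest: "?F g \<in> vgt (u (?F g0))" if g: "g \<in> E" "g \<noteq> g0" for g
  proof (cases "g \<in> S")
    case True
    then have "g0 < g" using g0(2)[OF True] g(2) by simp
    then show ?thesis using val[OF True] val[OF g0(1)] tC hC g by (simp add: vgt_def)
  next
    case False
    have "h g \<in> vgt g0"
      unfolding h_def
    proof (rule vgt_finsum)
      fix i assume "i \<in> {..<f}"
      then have i: "i < f" by simp
      have bgt: "b (g, i) \<in> vgt 0" using False g(1) i by (auto simp: S_def)
      \<comment> \<open>A positive value of \<open>K\<close> exceeds every element of
        \<open>E\<close>, in particular \<open>g0\<close>.\<close>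
      have "b (g, i) \<in> vgt g0"
        using bgt bV[OF g(1) i] E(2) g0E unfolding vgt_def by auto
      then show "b (g, i) \<otimes> y i \<in> vgt g0" using vgt_mult[of _ g0 "y i" 0] y(1) i by auto
    qed
    moreover have "t g \<in> vge 0" using t E(2) g by (auto simp: vge_def)
    ultimately have "h g \<otimes> t g \<in> vgt g0" using vgt_mult[of "h g" g0 "t g" 0] by simp
    then show ?thesis using val[OF g0(1)] tC hC g by (simp add: m_comm)
  qed
  have "(\<Oplus>g\<in>E. ?F g) \<noteq> \<zero>" "u (\<Oplus>g\<in>E. ?F g) = u (?F g0)"
    using finsum_unique_min[OF E(1) g0E, of ?F] val[OF g0(1)] tC hC g0E rest by auto
  then show ?thesis unfolding eq using val[OF g0(1)] g0E by simp
qed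

text \<open>The field generated over the henselization of \<open>K\<close> by a basis of
  \<open>L\<close> already determines \<open>u\<close>, so it contains the henselization of
  \<open>L\<close> by minimality, and it is finite-dimensional.\<close>

lemma henselization_finite_dimension:
  "finite_dimension (decomposition_field u K) (decomposition_field u L)"
  "subfield (decomposition_field u L) R" "L \<subseteq> decomposition_field u L"
proof -
  let ?H = "decomposition_field u K" and ?HL = "decomposition_field u L"
  interpret L: closed_extension R L
    using closed_extension_intermediate[OF L_subfield K_subset_L] .
  have H: "subfield ?H R" by (rule decomposition_field_subfield)
  have KH: "K \<subseteq> ?H" by (rule base_subset_decomposition_field)
  interpret H: closed_extension R ?H using closed_extension_intermediate[OF H KH] .
  show HL: "subfield ?HL R" by (rule L.decomposition_field_subfield)
  show L_HL: "L \<subseteq> ?HL" by (rule L.base_subset_decomposition_field)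
  obtain Us where Us: "set Us \<subseteq> carrier R" "Span K Us = L"
    using finite_dim exists_base[OF K_subfield] by (metis finite_dimension_def)
  define M where "M = finite_extension ?H Us"
  have alg: "\<And>x. x \<in> set Us \<Longrightarrow> (algebraic over ?H) x"
    using H.algebraic_extension Us(1) by blast
  have M: "subfield M R" unfolding M_def by (rule finite_extension_is_subfield[OF H Us(1) alg])
  have Mfin: "finite_dimension ?H M"
    unfolding M_def by (rule finite_extension_finite_dimension(1)[OF H Us(1) alg])
  have HM: "?H \<subseteq> M" unfolding M_def using finite_extension_incl[OF subfieldE(3)[OF H] Us(1)] .
  have UM: "set Us \<subseteq> M" unfolding M_def using finite_extension_mem[OF subfieldE(1)[OF H] Us(1)] .
  note Mr = subringE[OF subfieldE(1)[OF M]]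
  have LM: "L \<subseteq> M"
  proof
    fix x assume "x \<in> L"
    then have "x \<in> Span K Us" using Us(2) by simp
    with K_subfield Us(1) show "x \<in> M"
    proof (induction rule: Span_combination_induct)
      case zero show ?case by (rule Mr(2))
    next
      case (add k e v)
      have "k \<in> M" "e \<in> M" using add(1,2) KH HM UM by blast+
      then show ?case using Mr(7)[OF Mr(6) add(4)] by simp
    qed
  qed
  have "?HL \<subseteq> M"
  proof (rule L.decomposition_field_minimal[OF valuation M LM], intro allI impI)
    fix u' :: "'a \<Rightarrow> 'v"
    assume u': "valuation_on R (carrier R) u' \<and> extends_on R M u' u"
    then have "extends_on R ?H u' u" using HM unfolding extends_on_def by blast
    then show "extends_on R (carrier R) u' u"
      using decomposition_field_determines[OF valuation] u' by blast
  qed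
  moreover have "?H \<subseteq> ?HL"
  proof (rule decomposition_field_minimal[OF valuation HL])
    show "K \<subseteq> ?HL" using K_subset_L L_HL by blast
  next
    show "\<forall>u' :: 'a \<Rightarrow> 'v. valuation_on R (carrier R) u' \<and> extends_on R ?HL u' u \<longrightarrow>
        extends_on R (carrier R) u' u"
      using L.decomposition_field_determines[OF valuation] by blast
  qed
  then have "subalgebra ?H ?HL R"
    using subringE(6)[OF subfieldE(1)[OF HL]]
    by (intro subalgebra.intro subalgebra_axioms.intro subring.axioms(1) subfieldE(1)[OF HL]) blast
  ultimately show "finite_dimension ?H ?HL"
    using subalbegra_incl_imp_finite_dimension[OF H Mfin] by blast
qed

text \<open>\<open>card E\<close> is the initial index, so \<open>dim\<close> combines both
  numerical hypotheses of the theorem, stated for the single valuation \<open>u\<close>.\<close>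

lemma essentially_finitely_generated_of_defectless:
  defines "E \<equiv> {g \<in> u ` (L - {\<zero>}). 0 \<le> g \<and> (\<forall>d\<in>u ` (K - {\<zero>}). 0 < d \<longrightarrow> g < d)}"
  assumes residue_dim: "ring.dim (residue_field R L u) (residue_map R L u ` valuation_ring R K u)
      (carrier (residue_field R L u)) = f"
    and E: "finite E"
    and dim: "dim (decomposition_field u K) (decomposition_field u L) = card E * f"
  shows "essentially_finitely_generated R (valuation_ring R K u) (valuation_ring R L u)"
proof -
  let ?H = "decomposition_field u K" and ?HL = "decomposition_field u L"
  have H: "subfield ?H R" by (rule decomposition_field_subfield)
  have HLdim: "dimension (card E * f) ?H ?HL"
    using finite_dimensionE[OF H henselization_finite_dimension(1)] dim by (simp add: over_def)
  have E_prop: "\<forall>g\<in>E. 0 \<le> g \<and> (\<forall>x\<in>K - {\<zero>}. 0 < u x \<longrightarrow> g < u x)" by (auto simp: E_def)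
  have "\<forall>g\<in>E. \<exists>x\<in>L - {\<zero>}. u x = g" by (auto simp: E_def)
  then obtain t where t: "\<forall>g\<in>E. t g \<in> L - {\<zero>} \<and> u (t g) = g" by metis
  obtain y where y: "\<forall>i<f. y i \<in> L \<inter> vge 0"
    "\<forall>b. (\<forall>i<f. b i \<in> K \<inter> vge 0) \<and> (\<Oplus>i\<in>{..<f}. b i \<otimes> y i) \<in> vgt 0 \<longrightarrow> (\<forall>i<f. b i \<in> vgt 0)"
    using residue_lifts[OF residue_dim] by blast
  define I0 where "I0 = E \<times> {..<f}"
  define s where "s p = t (fst p) \<otimes> y (snd p)" for p
  have tge: "t g \<in> L \<inter> vge 0" if "g \<in> E" for g
    using t E_prop that L_carrier unfolding vge_def by auto
  have sV: "s p \<in> L \<inter> vge 0" if "p \<in> I0" for p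
    using tge[of "fst p"] y(1) that L_ring(6) vge_mult0 by (auto simp: s_def I0_def)
  obtain z where z: "z \<in> L" "z \<in> separable_elems K" "z \<noteq> \<zero>" "u z = 0"
    "\<forall>s\<in>field_auts R K. (\<forall>l\<in>L - {\<zero>}. u (s l) = u l) \<or> s z \<in> vgt 0"
    using exists_separating_unit[OF L_subfield K_subset_L finite_dim] by blast
  have zC: "z \<in> carrier R" using z(1) L_carrier by blast
  have zV: "z \<in> L \<inter> vge 0" using z zC by (simp add: vge_def)
  have "finite {s z | s. s \<in> field_auts R K}" by (rule finite_conjugates[OF zC])
  then have "finite {s z | s. s \<in> field_auts R K \<and> s z \<in> vgt 0}"
    by (rule finite_subset[rotated]) blast
  \<comment> \<open>The conjugates of \<open>z\<close> of positive value. They include all images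
    under embeddings that change values of \<open>L\<close>; repetitions in the list do no
    harm.\<close>
  then obtain zs where zs: "set zs = {s z | s. s \<in> field_auts R K \<and> s z \<in> vgt 0}"
    using finite_list by blast
  have zs1: "set zs \<subseteq> vgt 0" "set zs \<subseteq> separable_elems K"
    using zs separable_elems_aut[OF K_subfield _ z(2)] by auto
  have zs2: "\<forall>s\<in>field_auts R K. (\<forall>l\<in>L - {\<zero>}. u (s l) = u l) \<or> s z \<in> set zs"
    using z(5) unfolding zs by blast
  define n where "n = length zs"
  define V where "V = K \<inter> vge 0"
  define W where "W = L \<inter> vge 0"
  define B where "B = generate_ring R (V \<union> insert z (s ` I0))"
  have WC: "W \<subseteq> carrier R" using L_carrier by (auto simp: W_def)
  have VW: "V \<subseteq> W" using K_subset_L by (auto simp: V_def W_def)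
  have subW: "subring W R" unfolding W_def by (rule subring_vge[OF L_subfield])
  have subV: "subring V R" unfolding V_def by (rule subring_vge[OF K_subfield])
  have genW: "V \<union> insert z (s ` I0) \<subseteq> W" using VW zV sV by (auto simp: W_def)
  have genC: "V \<union> insert z (s ` I0) \<subseteq> carrier R" using genW WC by blast
  have subB: "subring B R" unfolding B_def by (rule generate_ring_is_subring[OF genC])
  have BW: "B \<subseteq> W" unfolding B_def by (rule generate_ring_min_subring1[OF genC subW genW])
  have genB: "V \<union> insert z (s ` I0) \<subseteq> B" unfolding B_def by (rule subsetI) (rule generate_ring.incl)
  note Br = subringE[OF subB]
  have BC: "B \<subseteq> carrier R" using BW WC by blast
  have B_pow: "z [^] m \<in> B" for m :: nat using genB by (induction m) (simp_all add: Br(3,6))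
  have B_sum: "(\<Oplus>i\<in>A. g i) \<in> B" if "finite A" "\<forall>i\<in>A. g i \<in> B" for A :: "'k set" and g
    using that
  proof (induction A rule: finite_induct)
    case (insert a A)
    then have "g \<in> A \<rightarrow> carrier R" "g a \<in> carrier R" using BC by auto
    then show ?case using insert Br(7) by simp
  qed (simp add: Br(2))
  \<comment> \<open>The elements of \<open>B\<close> that are units of \<open>W\<close>. Fractions
    with these denominators lie in \<open>W\<close>, so what remains is to write each element of
    \<open>W\<close> as such a fraction.\<close>
  define S where "S = {b \<in> B. b \<noteq> \<zero> \<and> u b = 0}"
  have invS: "inv b \<in> W \<and> b \<otimes> inv b = \<one> \<and> inv\<^bsub>R\<lparr>carrier := W\<rparr>\<^esub> b = inv b" if b: "b \<in> S" for b
  proof -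
    have bb: "b \<in> W" "b \<in> carrier R" "b \<noteq> \<zero>" "u b = 0" using b BW BC by (auto simp: S_def)
    have iW: "inv b \<in> W"
      using L_inv[of b] bb u_inv[of b] inv_closed_nonzero[of b] by (auto simp: W_def vge_def)
    have r: "b \<otimes> inv b = \<one>" using r_inv_nonzero bb by blast
    interpret A: cring "R\<lparr>carrier := W\<rparr>"
      using subcring_iff[OF WC] subcringI'[OF subW] by blast
    have "inv\<^bsub>R\<lparr>carrier := W\<rparr>\<^esub> b = inv b"
      using A.comm_inv_char[of b "inv b"] bb iW r by simp
    then show ?thesis using iW r by blast
  qed
  have main: "\<exists>a\<in>B. \<exists>b\<in>S. x = a \<otimes> inv b" if x: "x \<in> W" for x
  proof -
    have xC: "x \<in> carrier R" using x WC by blast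
    \<comment> \<open>The index \<open>None\<close> stands for \<open>x\<close> and keeps it apart
      from the \<open>s p\<close> even if it equals one of them. The family has one member more than
      the dimension over the henselization.\<close>
    define I where "I = insert None (Some ` I0)"
    define Y where "Y i = (case i of None \<Rightarrow> x | Some p \<Rightarrow> s p)" for i
    have finI: "finite I0" "finite I" using E by (auto simp: I0_def I_def)
    have cardI: "card E * f < card I"
      using finI by (simp add: I_def card_image I0_def card_cartesian_product)
    have YW: "Y i \<in> W" if "i \<in> I" for i using that x sV by (auto simp: I_def Y_def W_def)
    have YL: "\<forall>i\<in>I. Y i \<in> L" using YW by (auto simp: W_def)
    have YC: "Y i \<in> carrier R" if "i \<in> I" for i using YW[OF that] WC by blast
    have "\<exists>c. (\<forall>i\<in>I. c i \<in> ?H) \<and> (\<exists>i\<in>I. c i \<noteq> \<zero>) \<and> (\<Oplus>i\<in>I. c i \<otimes> Y i) = \<zero>"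
      by (rule dependent_family[OF H HLdim finI(2) cardI])
        (use YL henselization_finite_dimension(3) in blast)
    then obtain c i0 where c: "\<forall>i\<in>I. c i \<in> ?H" "i0 \<in> I" "c i0 \<noteq> \<zero>" "(\<Oplus>i\<in>I. c i \<otimes> Y i) = \<zero>"
      by blast
    obtain a where a: "\<forall>p\<in>{..n} \<times> I. a p \<in> V \<and> (fst p < n \<longrightarrow> a p \<in> vgt 0)"
      "\<exists>i\<in>I. a (n, i) \<notin> vgt 0"
      "(\<Oplus>p\<in>{..n} \<times> I. a p \<otimes> (z [^] fst p \<otimes> Y (snd p))) = \<zero>"
      using relation_over_valuation_ring[OF L_subfield K_subset_L z(1,2) zs1 zs2 finI(2) YL c]
      unfolding n_def V_def by blast
    have aV: "a (m, i) \<in> V" if "m \<le> n" "i \<in> I" for m i using a(1) that by simp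
    have agt: "a (m, i) \<in> vgt 0" if "m < n" "i \<in> I" for m i using a(1) that by fastforce
    have aC: "a (m, i) \<in> carrier R" if "m \<le> n" "i \<in> I" for m i
      using aV[OF that] VW WC by blast
    define P where "P i = (\<Oplus>m\<in>{..n}. a (m, i) \<otimes> z [^] m)" for i
    have PB: "P i \<in> B" if i: "i \<in> I" for i
      unfolding P_def
    proof (rule B_sum)
      show "\<forall>m\<in>{..n}. a (m, i) \<otimes> z [^] m \<in> B"
        using aV[OF _ i] genB B_pow Br(6) by blast
    qed simp
    then have PC: "P i \<in> carrier R" if "i \<in> I" for i using that BC by blast
    have relI: "(\<Oplus>i\<in>I. P i \<otimes> Y i) = \<zero>"
    proof -
      have "(\<Oplus>i\<in>I. P i \<otimes> Y i) = (\<Oplus>i\<in>I. \<Oplus>m\<in>{..n}. a (m, i) \<otimes> (z [^] m \<otimes> Y i))"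
      proof (intro finsum_cong' refl)
        fix i assume i: "i \<in> I"
        have "P i \<otimes> Y i = (\<Oplus>m\<in>{..n}. a (m, i) \<otimes> z [^] m \<otimes> Y i)"
          unfolding P_def using aC[OF _ i] zC YC[OF i] by (intro finsum_ldistr) auto
        also have "\<dots> = (\<Oplus>m\<in>{..n}. a (m, i) \<otimes> (z [^] m \<otimes> Y i))"
          using aC[OF _ i] zC YC[OF i] by (intro finsum_cong') (auto simp: m_assoc)
        finally show "P i \<otimes> Y i = (\<Oplus>m\<in>{..n}. a (m, i) \<otimes> (z [^] m \<otimes> Y i))" .
      qed (use aC zC YC in auto)
      also have "\<dots> = (\<Oplus>m\<in>{..n}. \<Oplus>i\<in>I. a (m, i) \<otimes> (z [^] m \<otimes> Y i))"
        using finI aC zC YC by (intro finsum_swap) auto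
      also have "\<dots> = (\<Oplus>p\<in>{..n} \<times> I. a p \<otimes> (z [^] fst p \<otimes> Y (snd p)))"
        using finsum_product[of "{..n}" I "\<lambda>p. a p \<otimes> (z [^] fst p \<otimes> Y (snd p))"] finI aC zC YC by auto
      finally show ?thesis using a(3) by simp
    qed
    define b where "b = P None"
    have NI: "None \<in> I" by (simp add: I_def)
    have bC: "b \<in> carrier R" "b \<in> B" using PC[OF NI] PB[OF NI] by (simp_all add: b_def)
    define Q where "Q = (\<Oplus>p\<in>I0. P (Some p) \<otimes> s p)"
    have SI: "Some p \<in> I" if "p \<in> I0" for p using that by (simp add: I_def)
    have sC: "s p \<in> carrier R" if "p \<in> I0" for p using sV[OF that] vge_carrier by blast
    have QB: "Q \<in> B"
      unfolding Q_def using finI PB[OF SI] genB Br(6) by (intro B_sum) blast+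
    then have QC: "Q \<in> carrier R" using BC by blast
    have bx: "b \<otimes> x \<oplus> Q = \<zero>"
    proof -
      have "(\<Oplus>i\<in>I. P i \<otimes> Y i) = P None \<otimes> Y None \<oplus> (\<Oplus>i\<in>Some ` I0. P i \<otimes> Y i)"
        unfolding I_def using finI PC YC by (intro finsum_insert) (auto simp: I_def)
      also have "(\<Oplus>i\<in>Some ` I0. P i \<otimes> Y i) = (\<Oplus>p\<in>I0. P (Some p) \<otimes> Y (Some p))"
        using PC YC by (intro finsum_reindex) (auto simp: I_def)
      finally show ?thesis using relI by (simp add: b_def Q_def Y_def)
    qed
    \<comment> \<open>Otherwise a unit coefficient occurs at some \<open>s p\<close>. The
      combination \<open>G\<close> of the \<open>s p\<close> at exponent \<open>n\<close> then has a
      value in \<open>E\<close>, while every remaining term has a larger value, so the total could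
      not vanish.\<close>
    have top: "a (n, None) \<notin> vgt 0"
    proof
      assume N: "a (n, None) \<in> vgt 0"
      then obtain p0 where p0: "p0 \<in> I0" "a (n, Some p0) \<notin> vgt 0" using a(2) by (auto simp: I_def)
      define b' where "b' p = a (n, Some p)" for p
      define G where "G = (\<Oplus>p\<in>I0. b' p \<otimes> s p)"
      have b'V: "b' p \<in> V" if "p \<in> I0" for p using aV SI[OF that] by (simp add: b'_def)
      then have b'C: "b' p \<in> carrier R" if "p \<in> I0" for p using that VW WC by blast
      have "G \<noteq> \<zero> \<and> u G \<in> E"
        unfolding G_def s_def I0_def
      proof (rule initial_segment_combination[OF E E_prop _ _ y(2)])
        show "\<forall>g\<in>E. t g \<in> carrier R - {\<zero>} \<and> u (t g) = g" using t L_carrier by blast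
        show "\<forall>i<f. y i \<in> vge 0" using y(1) by blast
        show "\<forall>p\<in>E \<times> {..<f}. b' p \<in> K \<inter> vge 0" using b'V unfolding I0_def V_def by blast
        show "p0 \<in> E \<times> {..<f}" "b' p0 \<notin> vgt 0" using p0 by (simp_all add: I0_def b'_def)
      qed
      then have G: "G \<noteq> \<zero>" "u G \<in> E" by blast+
      have GC: "G \<in> carrier R" unfolding G_def using b'C sC by auto
      \<comment> \<open>A non-unit of \<open>V\<close> exceeds in value not only zero but every
        element of \<open>E\<close>; this is where the choice of the representatives
        matters.\<close>
      have up: "c \<in> vgt (u G)" if "c \<in> V" "c \<in> vgt 0" for c
        using that E_prop G(2) unfolding V_def vgt_def by auto
      let ?T = "\<lambda>p. a p \<otimes> (z [^] fst p \<otimes> Y (snd p))"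
      have TC: "?T (m, i) \<in> carrier R" if "m \<le> n" "i \<in> I" for m i using aC[OF that] zC YC[OF that(2)] by simp
      define J where "J = {n} \<times> Some ` I0"
      have JP: "J \<subseteq> {..n} \<times> I" by (auto simp: J_def I_def)
      have "(\<Oplus>p\<in>J. ?T p) = (\<Oplus>p\<in>I0. ?T (n, Some p))"
      proof -
        have eq: "J = (\<lambda>p. (n, Some p)) ` I0" by (auto simp: J_def)
        show ?thesis unfolding eq
          by (rule finsum_reindex) (use TC SI in \<open>auto simp: inj_on_def\<close>)
      qed
      also have "\<dots> = (\<Oplus>p\<in>I0. z [^] n \<otimes> (b' p \<otimes> s p))"
        using b'C zC sC by (intro finsum_cong') (auto simp: b'_def Y_def m_lcomm)
      also have "\<dots> = z [^] n \<otimes> G"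
        unfolding G_def using finI b'C zC sC by (intro finsum_rdistr[symmetric]) auto
      finally have sumJ: "(\<Oplus>p\<in>J. ?T p) = z [^] n \<otimes> G" .
      let ?R = "\<Oplus>p\<in>{..n} \<times> I - J. ?T p"
      have "?R \<in> vgt (u G)"
      proof (rule vgt_finsum)
        fix p assume p: "p \<in> {..n} \<times> I - J"
        then obtain m i where mi: "p = (m, i)" "m \<le> n" "i \<in> I" by auto
        have "a (m, i) \<in> vgt 0"
        proof (cases "m = n")
          case True
          then have "i = None" using p mi by (auto simp: J_def I_def)
          then show ?thesis using N True by simp
        next
          case False
          then show ?thesis using agt mi by simp
        qed
        then have "a (m, i) \<in> vgt (u G)" using up aV[OF mi(2,3)] by blast
        moreover have "z [^] m \<otimes> Y i \<in> vge 0"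
          using vge_mult0 vge_pow zV YW[OF mi(3)] by (simp add: W_def)
        ultimately show "?T p \<in> vgt (u G)" using mi(1) vgt_mult[of "a (m, i)" "u G" _ 0] by simp
      qed
      then have R: "?R \<in> vgt (u G)" .
      have split: "(\<Oplus>p\<in>{..n} \<times> I. ?T p) = (\<Oplus>p\<in>J. ?T p) \<oplus> ?R"
      proof -
        have "J \<union> ({..n} \<times> I - J) = {..n} \<times> I" using JP by blast
        moreover have "(\<Oplus>p\<in>J \<union> ({..n} \<times> I - J). ?T p) = (\<Oplus>p\<in>J. ?T p) \<oplus> (\<Oplus>p\<in>{..n} \<times> I - J. ?T p)"
        proof (rule finsum_Un_disjoint)
          show "finite J" "finite ({..n} \<times> I - J)" "J \<inter> ({..n} \<times> I - J) = {}"
            using finI finite_subset[OF JP] by auto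
          show "?T \<in> J \<rightarrow> carrier R" "?T \<in> {..n} \<times> I - J \<rightarrow> carrier R" using TC JP by auto
        qed
        ultimately show ?thesis by (simp only:)
      qed
      have zG: "z [^] n \<otimes> G \<in> carrier R" "z [^] n \<otimes> G \<noteq> \<zero>" "u (z [^] n \<otimes> G) = u G"
        using pow_nonzero[OF zC z(3)] G GC zC u_mult[of "z [^] n" G] u_pow[OF zC z(3)] z(4)
        by (simp_all add: integral_iff)
      have "z [^] n \<otimes> G \<oplus> ?R \<noteq> \<zero>"
        by (rule u_add_strict(1)[OF zG(1,2)]) (use R zG(3) in simp)
      moreover have "z [^] n \<otimes> G \<oplus> ?R = \<zero>" using split a(3) unfolding sumJ by (simp only:)
      ultimately show False by blast
    qed
    \<comment> \<open>The term with \<open>z^n\<close> is a unit, and all terms of lower exponent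
      have positive value.\<close>
    have bu: "b \<noteq> \<zero> \<and> u b = 0"
    proof -
      let ?T = "\<lambda>m. a (m, None) \<otimes> z [^] m"
      have an: "a (n, None) \<noteq> \<zero>" "u (a (n, None)) = 0"
        using top aV[OF _ NI, of n] aC[OF _ NI, of n] by (auto simp: V_def vge_def vgt_def)
      have Tn: "?T n \<in> carrier R" "?T n \<noteq> \<zero>" "u (?T n) = 0"
        using an aC[OF _ NI, of n] zC pow_nonzero[OF zC z(3)] u_mult[of "a (n, None)" "z [^] n"]
          u_pow[OF zC z(3)] z(4) by (auto simp: integral_iff)
      have "?T m \<in> vgt (u (?T n))" if "m \<in> {..n}" "m \<noteq> n" for m
      proof -
        have "z [^] m \<in> vge 0" using vge_pow zV by blast
        then show ?thesis
          using vgt_mult[OF agt[OF _ NI, of m], of "z [^] m" 0] that unfolding Tn(3) by simp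
      qed
      then have "finsum R ?T {..n} \<noteq> \<zero>" "u (finsum R ?T {..n}) = 0"
        using finsum_unique_min[of "{..n}" n ?T] Tn by auto
      then show ?thesis by (simp add: b_def P_def)
    qed
    have bS: "b \<in> S" using bu bC by (simp add: S_def)
    have iC: "inv b \<in> carrier R" "b \<otimes> inv b = \<one>" using invS[OF bS] WC by auto
    have "b \<otimes> x = \<ominus> Q" using bx bC xC QC by (simp add: minus_equality[symmetric])
    then have "\<ominus> Q \<otimes> inv b = x"
      using bC(1) xC iC by (metis m_assoc m_comm l_one m_closed)
    moreover have "\<ominus> Q \<in> B" using Br(5) QB by blast
    ultimately show ?thesis using bS by blast
  qed
  have Wset: "W = {a \<otimes> inv\<^bsub>R\<lparr>carrier := W\<rparr>\<^esub> b | a b. a \<in> B \<and> b \<in> S}" (is "W = ?F")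
  proof
    show "W \<subseteq> ?F"
    proof
      fix x assume "x \<in> W"
      then obtain a b where ab: "a \<in> B" "b \<in> S" "x = a \<otimes> inv b" using main by blast
      then have "x = a \<otimes> inv\<^bsub>R\<lparr>carrier := W\<rparr>\<^esub> b" using invS by simp
      then show "x \<in> ?F" using ab by blast
    qed
    show "?F \<subseteq> W"
    proof
      fix x assume "x \<in> ?F"
      then obtain a b where ab: "a \<in> B" "b \<in> S" "x = a \<otimes> inv\<^bsub>R\<lparr>carrier := W\<rparr>\<^esub> b" by blast
      then have "x = a \<otimes> inv b" using invS by simp
      then show "x \<in> W" using subringE(6)[OF subW] BW ab invS by blast
    qed
  qed
  have Smon: "submonoid S (R\<lparr>carrier := B\<rparr>)"
  proof
    show "S \<subseteq> carrier (R\<lparr>carrier := B\<rparr>)" by (auto simp: S_def)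
    show "\<one>\<^bsub>R\<lparr>carrier := B\<rparr>\<^esub> \<in> S" using Br(3) u_one by (simp add: S_def)
    show "x \<otimes>\<^bsub>R\<lparr>carrier := B\<rparr>\<^esub> y \<in> S" if "x \<in> S" "y \<in> S" for x y
      using that Br(6) BC u_mult[of x y] integral_iff[of x y] unfolding S_def by auto
  qed
  have Sunits: "S \<subseteq> Units (R\<lparr>carrier := W\<rparr>)"
  proof
    fix b assume b: "b \<in> S"
    then have "b \<in> W" "inv b \<in> W" "b \<otimes> inv b = \<one>" using invS BW by (auto simp: S_def)
    moreover from this have "inv b \<otimes> b = \<one>" using m_comm WC by (metis subsetD)
    ultimately show "b \<in> Units (R\<lparr>carrier := W\<rparr>)" unfolding Units_def by auto
  qed
  show ?thesis
    unfolding essentially_finitely_generated_def valuation_ring_eq[OF L_carrier]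
      valuation_ring_eq[OF base_in_carrier] V_def[symmetric] W_def[symmetric]
  proof (intro conjI exI)
    show "subring V R" "subring W R" "V \<subseteq> W" by (rule subV subW VW)+
    show "finite (insert z (s ` I0))" using E by (simp add: I0_def)
    show "insert z (s ` I0) \<subseteq> W" using genW by blast
    show "submonoid S (R\<lparr>carrier := generate_ring R (V \<union> insert z (s ` I0))\<rparr>)"
      using Smon unfolding B_def .
    show "S \<subseteq> Units (R\<lparr>carrier := W\<rparr>)" by (rule Sunits)
    show "W = {a \<otimes> inv\<^bsub>R\<lparr>carrier := W\<rparr>\<^esub> b | a b.
        a \<in> generate_ring R (V \<union> insert z (s ` I0)) \<and> b \<in> S}"
      using Wset unfolding B_def .
  qed
qed

end

section \<open>Transfer to one valuation on the algebraic closure\<close>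

theorem theorem1p5:
  fixes \<Omega> :: "('a, 'm) ring_scheme" (structure)
    and k K L :: "'a set"
    and \<nu> \<omega> \<nu>bar :: "'a \<Rightarrow> 'v::linordered_ab_group_add"
  assumes function_field: "algebraic_function_field \<Omega> k K"
    and abhyankar: "abhyankar_valuation \<Omega> k K \<nu>"
    and finite_ext: "subfield L \<Omega>" "K \<subseteq> L" "ring.finite_dimension \<Omega> K L"
    and omega: "valuation_on \<Omega> L \<omega>" "extends_on \<Omega> K \<omega> \<nu>"
    and alg_closure: "algebraic_closure \<Omega> L"
    and nubar: "valuation_on \<Omega> (carrier \<Omega>) \<nu>bar" "extends_on \<Omega> L \<nu>bar \<omega>"
    and residue_separable:
      "separable_extension (residue_field \<Omega> L \<omega>) (residue_map \<Omega> L \<omega> ` k)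
         (carrier (residue_field \<Omega> L \<omega>))"
    and defectless: "defect \<Omega> \<nu>bar K L \<nu> \<omega> = 1"
    and index_eq:
      "initial_index (value_group \<Omega> L \<omega>) (value_group \<Omega> K \<nu>) =
         ramification_index \<Omega> K L \<nu> \<omega>"
  shows "essentially_finitely_generated \<Omega> (valuation_ring \<Omega> K \<nu>) (valuation_ring \<Omega> L \<omega>)"
proof -
  interpret A: algebraic_closure \<Omega> L by (rule alg_closure)
  have K: "subfield K \<Omega>" using function_field by (simp add: algebraic_function_field_def)
  \<comment> \<open>The closure is given over \<open>L\<close>. It is algebraic over
    \<open>K\<close> because simple extensions of \<open>L\<close> are finite-dimensional over
    \<open>K\<close>.\<close>
  have "closed_extension \<Omega> K"
  proof -
    interpret K: subfield K \<Omega> by (rule K)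
    show ?thesis
    proof
      fix x assume x: "x \<in> carrier \<Omega>"
      let ?F = "A.simple_extension L x"
      have "A.finite_dimension L ?F"
        using A.finite_dimension_simple_extension[OF finite_ext(1) x] A.algebraic_extension[OF x] by blast
      then have "A.finite_dimension K ?F"
        using A.telescopic_base_dim(1)[OF K finite_ext(1,3)] by blast
      then show "(A.algebraic over K) x"
        using A.finite_dimension_imp_algebraic[OF K A.simple_extension_is_subring]
          A.simple_extension_mem x subfieldE(1)[OF finite_ext(1)] by blast
    next
      fix P assume "P \<in> carrier (K [X])"
      then show "A.splitted P"
        using A.roots_over_carrier A.carrier_polynomial_shell[OF subfieldE(1)[OF K]] by blast
    qed
  qed
  then interpret K: closed_extension \<Omega> K .
  interpret K: valued_closed_extension \<Omega> K \<nu>bar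
    by unfold_locales (rule nubar(1))
  interpret valued_finite_extension \<Omega> K \<nu>bar L
    by unfold_locales (rule finite_ext)+
  have L: "closed_extension \<Omega> L" by (rule closed_extension.intro[OF alg_closure])
  have eqL: "\<nu>bar x = \<omega> x" if "x \<in> L" "x \<noteq> \<zero>" for x
    using nubar(2) that by (simp add: extends_on_def)
  have eqK: "\<nu>bar x = \<nu> x" if "x \<in> K" "x \<noteq> \<zero>" for x
    using omega(2) that finite_ext(2) eqL[of x] by (auto simp: extends_on_def)
  have vgL: "value_group \<Omega> L \<omega> = \<nu>bar ` (L - {\<zero>})"
    unfolding value_group_def using eqL by (intro image_cong) auto
  have vgK: "value_group \<Omega> K \<nu> = \<nu>bar ` (K - {\<zero>})"
    unfolding value_group_def using eqK by (intro image_cong) auto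
  have vrL: "valuation_ring \<Omega> L \<omega> = valuation_ring \<Omega> L \<nu>bar"
    unfolding valuation_ring_def by (rule Collect_cong) (metis eqL)
  have vrK: "valuation_ring \<Omega> K \<nu> = valuation_ring \<Omega> K \<nu>bar"
    unfolding valuation_ring_def by (rule Collect_cong) (metis eqK)
  have viL: "valuation_ideal \<Omega> L \<omega> = valuation_ideal \<Omega> L \<nu>bar"
    unfolding valuation_ideal_def by (rule Collect_cong) (metis eqL)
  have rf: "residue_field \<Omega> L \<omega> = residue_field \<Omega> L \<nu>bar"
    unfolding residue_field_def vrL viL ..
  have rm: "residue_map \<Omega> L \<omega> = residue_map \<Omega> L \<nu>bar"
    unfolding residue_map_def viL ..
  define E where "E = {g \<in> \<nu>bar ` (L - {\<zero>}). 0 \<le> g \<and> (\<forall>d\<in>\<nu>bar ` (K - {\<zero>}). 0 < d \<longrightarrow> g < d)}"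
  define f where "f = inertia_degree \<Omega> K L \<nu> \<omega>"
  have f: "ring.dim (residue_field \<Omega> L \<nu>bar) (residue_map \<Omega> L \<nu>bar ` valuation_ring \<Omega> K \<nu>bar)
      (carrier (residue_field \<Omega> L \<nu>bar)) = f"
    unfolding f_def inertia_degree_def rf rm vrK ..
  \<comment> \<open>The set \<open>E\<close> is the one counted by the initial index, so the index
    hypothesis turns its cardinality into the ramification index.\<close>
  have e: "ramification_index \<Omega> K L \<nu> \<omega> = card E"
    using index_eq unfolding initial_index_def vgL vgK E_def by simp
  have hens: "henselization \<Omega> \<nu>bar K = A.decomposition_field \<nu>bar K"
    "henselization \<Omega> \<nu>bar L = A.decomposition_field \<nu>bar L"
    using K.henselization_eq[OF nubar(1)] closed_extension.henselization_eq[OF L nubar(1)]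
    by (simp_all only:)
  \<comment> \<open>Division by zero gives zero, so a quotient equal to 1 also shows that the
    denominator is nonzero.\<close>
  have quot: "c \<noteq> 0 \<and> d = c" if "(of_nat d :: rat) / of_nat c = 1" for c d :: nat
    using that by (cases "c = 0") simp_all
  have "A.dim (A.decomposition_field \<nu>bar K) (A.decomposition_field \<nu>bar L) = card E * f"
    and "card E * f \<noteq> 0"
    using quot defectless unfolding defect_def hens e f_def[symmetric] by blast+
  note dim = this(1)
  \<comment> \<open>An infinite set has cardinality 0 by convention, which the nonzero denominator
    excludes.\<close>
  have "finite E" using \<open>card E * f \<noteq> 0\<close> by (metis card.infinite mult_0)
  from essentially_finitely_generated_of_defectless[OF f this[unfolded E_def] dim[unfolded E_def]]
  show ?thesis unfolding vrL vrK .
qed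

end
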